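(* Let $V$ be a finite-dimensional real symplectic vector space with skew form $\langle\,,\rangle$. On $V\times V$ consider the constant symplectic forms $$\Omega_1((a_1,a_2),(b_1,b_2))=\langle a_1,b_2\rangle+\langle a_2,b_1\rangle,\qquad \Omega_2((a_1,a_2),(b_1,b_2))=\langle a_1,b_1\rangle-\langle a_2,b_2\rangle,$$ and the constant indefinite metric $g$ with $g((a,b),(a,b))=\tfrac12\langle a,b\rangle$. Let $M\subset V\times V$ be a submanifold which is Lagrangian for $\Omega_1$ and $\Omega_2$, and transversal to the two projections onto $V$. Then $g|_M$ is a special pseudo-Kähler metric. Conversely, any special pseudo-Kähler metric on a manifold $M$ is locally induced (as the restriction of $g$) from such an embedding of $M$ in $V\times V$ for some symplectic vector space $V$, i.e. an embedding that is Lagrangian for both $\Omega_1$ and $\Omega_2$ and transversal to the two projections.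
   Context: A special Kähler manifold is a complex manifold $M$, with complex structure $I$, together with a Kähler metric $g$ with Kähler form $\omega$ and a flat torsion-free connection $\nabla$ on the tangent bundle $T$ such that $\nabla\omega=0$ and $d_\nabla I=0\in\Omega^2(M,T)$. Here $I$ is regarded as a 1-form with values in $T$, i.e. $I\in\Omega^1(M,T)$, and $d_\nabla:\Omega^p(M,T)\to\Omega^{p+1}(M,T)$ is the covariant exterior derivative defined by $\nabla$. "Special pseudo-Kähler" means the same definition, but with the metric allowed to be indefinite (nondegenerate). Saying that $g|_M$ is a special pseudo-Kähler metric means that $M$ carries an integrable complex structure $I$ and a connection $\nabla$ making it special pseudo-Kähler with metric $g|_M$. $M$ is transversal to the two projections if the restriction to $M$ of each of the two projections $V\times V\to V$ is a local diffeomorphism. The full metric $g$ is obtained from its quadratic form by polarization. Lagrangian means the form restricts to zero and $\dim M=\dim V$. *)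

theory Defs
  imports "HOL-Analysis.Analysis"
begin

section \<open>Smooth maps between open sets\<close>

abbreviation D :: "('a::real_normed_vector \<Rightarrow> 'b::real_normed_vector) \<Rightarrow> 'a \<Rightarrow> 'a \<Rightarrow> 'b"
  where "D f x \<equiv> frechet_derivative f (at x)"

text \<open>The set \<open>S\<close> is always open where these two notions are used.\<close>

primrec Ck_on :: "nat \<Rightarrow> 'a::real_normed_vector set \<Rightarrow> ('a \<Rightarrow> 'b::real_normed_vector) \<Rightarrow> bool" where
  "Ck_on 0 S f \<longleftrightarrow> continuous_on S f"
| "Ck_on (Suc k) S f \<longleftrightarrow> (\<forall>x\<in>S. f differentiable (at x)) \<and> (\<forall>v. Ck_on k S (\<lambda>x. D f x v))"

definition smooth_on :: "'a::real_normed_vector set \<Rightarrow> ('a \<Rightarrow> 'b::real_normed_vector) \<Rightarrow> bool"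
  where "smooth_on S f \<longleftrightarrow> (\<forall>k. Ck_on k S f)"


section \<open>Smooth manifolds\<close>

text \<open>
  A manifold is a topology \<open>X\<close> on its set of points together with a (not necessarily maximal)
  atlas \<open>A\<close> of charts with values in the model space \<open>'m\<close>, so that its dimension is \<open>DIM('m)\<close>.
  A chart is a pair of its domain and a coordinate map, whose values off the domain are irrelevant.
\<close>

type_synonym ('a, 'm) chart = "'a set \<times> ('a \<Rightarrow> 'm)"

definition is_chart :: "'a topology \<Rightarrow> ('a, 'm::euclidean_space) chart \<Rightarrow> bool" where
  "is_chart X c \<longleftrightarrow> openin X (fst c) \<and> open (snd c ` fst c) \<and>
     homeomorphic_map (subtopology X (fst c)) (top_of_set (snd c ` fst c)) (snd c)"

text \<open>\<open>local_rep c f\<close> is the expression of \<open>f\<close> in the coordinates of \<open>c\<close>.\<close>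

definition local_rep :: "('a, 'm) chart \<Rightarrow> ('a \<Rightarrow> 'b) \<Rightarrow> 'm \<Rightarrow> 'b" where
  "local_rep c f = f \<circ> inv_into (fst c) (snd c)"

abbreviation transition :: "('a, 'm) chart \<Rightarrow> ('a, 'm) chart \<Rightarrow> 'm \<Rightarrow> 'm" where
  "transition c d \<equiv> local_rep c (snd d)"

abbreviation overlap :: "('a, 'm) chart \<Rightarrow> ('a, 'm) chart \<Rightarrow> 'm set" where
  "overlap c d \<equiv> snd c ` (fst c \<inter> fst d)"

definition smoothly_compatible ::
    "('a, 'm::euclidean_space) chart \<Rightarrow> ('a, 'm) chart \<Rightarrow> bool" where
  "smoothly_compatible c d \<longleftrightarrow>
     smooth_on (overlap c d) (transition c d) \<and> smooth_on (overlap d c) (transition d c)"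

definition smooth_manifold ::
    "'a topology \<Rightarrow> ('a, 'm::euclidean_space) chart set \<Rightarrow> bool" where
  "smooth_manifold X A \<longleftrightarrow>
     Hausdorff_space X \<and> second_countable X \<and>
     (\<forall>c\<in>A. is_chart X c) \<and> (\<Union>c\<in>A. fst c) = topspace X \<and>
     (\<forall>c\<in>A. \<forall>d\<in>A. smoothly_compatible c d)"

text \<open>The charts of the maximal atlas containing \<open>A\<close>.\<close>

definition compatible_chart ::
    "'a topology \<Rightarrow> ('a, 'm::euclidean_space) chart set \<Rightarrow> ('a, 'm) chart \<Rightarrow> bool" where
  "compatible_chart X A c \<longleftrightarrow> is_chart X c \<and> (\<forall>d\<in>A. smoothly_compatible c d)"


section \<open>Maps from an open part of a manifold to a vector space\<close>

definition smooth_map_on ::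
    "('a, 'm::euclidean_space) chart set \<Rightarrow> 'a set \<Rightarrow> ('a \<Rightarrow> 'w::euclidean_space) \<Rightarrow> bool" where
  "smooth_map_on A U f \<longleftrightarrow> (\<forall>c\<in>A. smooth_on (snd c ` (fst c \<inter> U)) (local_rep c f))"

definition immersion_on ::
    "('a, 'm::euclidean_space) chart set \<Rightarrow> 'a set \<Rightarrow> ('a \<Rightarrow> 'w::euclidean_space) \<Rightarrow> bool" where
  "immersion_on A U f \<longleftrightarrow> smooth_map_on A U f \<and>
     (\<forall>c\<in>A. \<forall>x\<in>snd c ` (fst c \<inter> U). inj (D (local_rep c f) x))"

definition smooth_embedding_on ::
    "'a topology \<Rightarrow> ('a, 'm::euclidean_space) chart set \<Rightarrow> 'a set \<Rightarrow> ('a \<Rightarrow> 'w::euclidean_space) \<Rightarrow> bool"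
  where
  "smooth_embedding_on X A U f \<longleftrightarrow>
     immersion_on A U f \<and> embedding_map (subtopology X U) euclidean f"

definition embedded_submanifold ::
    "'w::euclidean_space set \<Rightarrow> ('w, 'm::euclidean_space) chart set \<Rightarrow> bool" where
  "embedded_submanifold M A \<longleftrightarrow>
     smooth_manifold (top_of_set M) A \<and> smooth_embedding_on (top_of_set M) A M (\<lambda>x. x)"

definition local_diffeo_on ::
    "'a topology \<Rightarrow> ('a, 'm::euclidean_space) chart set \<Rightarrow> 'a set \<Rightarrow> ('a \<Rightarrow> 'v::euclidean_space) \<Rightarrow> bool"
  where
  "local_diffeo_on X A U q \<longleftrightarrow>
     (\<forall>p\<in>U. \<exists>W. openin X W \<and> p \<in> W \<and> W \<subseteq> U \<and> open (q ` W) \<and> inj_on q W \<and>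
        smooth_map_on A W q \<and>
        (\<forall>c\<in>A. smooth_on (q ` (W \<inter> fst c)) (snd c \<circ> inv_into W q)))"


section \<open>Tensor fields and connections\<close>

text \<open>
  Tensor fields and connections are given by their components in each chart \<open>c\<close> of the atlas, at
  the points \<open>x\<close> of the coordinate image \<open>snd c ` fst c\<close>, subject to the transformation laws.
  Tangent vectors in a chart are elements of \<open>'m\<close>.
\<close>

type_synonym ('a, 'm) bilinear_field = "('a, 'm) chart \<Rightarrow> 'm \<Rightarrow> 'm \<Rightarrow> 'm \<Rightarrow> real"
type_synonym ('a, 'm) endo_field = "('a, 'm) chart \<Rightarrow> 'm \<Rightarrow> 'm \<Rightarrow> 'm"
type_synonym ('a, 'm) christoffel = "('a, 'm) chart \<Rightarrow> 'm \<Rightarrow> 'm \<Rightarrow> 'm \<Rightarrow> 'm"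

definition is_bilinear_field ::
    "('a, 'm::euclidean_space) chart set \<Rightarrow> ('a, 'm) bilinear_field \<Rightarrow> bool" where
  "is_bilinear_field A g \<longleftrightarrow>
     (\<forall>c\<in>A. (\<forall>x\<in>snd c ` fst c. bilinear (g c x)) \<and>
             (\<forall>u v. smooth_on (snd c ` fst c) (\<lambda>x. g c x u v))) \<and>
     (\<forall>c\<in>A. \<forall>d\<in>A. \<forall>x\<in>overlap c d. \<forall>u v.
        g d (transition c d x) (D (transition c d) x u) (D (transition c d) x v) = g c x u v)"

definition is_endo_field ::
    "('a, 'm::euclidean_space) chart set \<Rightarrow> ('a, 'm) endo_field \<Rightarrow> bool" where
  "is_endo_field A I \<longleftrightarrow>
     (\<forall>c\<in>A. (\<forall>x\<in>snd c ` fst c. linear (I c x)) \<and>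
             (\<forall>v. smooth_on (snd c ` fst c) (\<lambda>x. I c x v))) \<and>
     (\<forall>c\<in>A. \<forall>d\<in>A. \<forall>x\<in>overlap c d. \<forall>v.
        I d (transition c d x) (D (transition c d) x v) = D (transition c d) x (I c x v))"

text \<open>
  A connection on the tangent bundle: in each chart \<open>\<nabla>\<^sub>X Y = D Y(X) + \<Gamma>(X, Y)\<close>. The transformation
  law of \<open>\<Gamma>\<close> says that this expression does not depend on the chart; its second-derivative term
  comes from differentiating the push-forward of a coordinate-constant field.
\<close>

definition is_connection ::
    "('a, 'm::euclidean_space) chart set \<Rightarrow> ('a, 'm) christoffel \<Rightarrow> bool" where
  "is_connection A \<Gamma> \<longleftrightarrow>
     (\<forall>c\<in>A. (\<forall>x\<in>snd c ` fst c. bilinear (\<Gamma> c x)) \<and>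
             (\<forall>u v. smooth_on (snd c ` fst c) (\<lambda>x. \<Gamma> c x u v))) \<and>
     (\<forall>c\<in>A. \<forall>d\<in>A. \<forall>x\<in>overlap c d. \<forall>u v.
        D (transition c d) x (\<Gamma> c x u v) =
          D (\<lambda>y. D (transition c d) y v) x u +
          \<Gamma> d (transition c d x) (D (transition c d) x u) (D (transition c d) x v))"

text \<open>
  The differential operators below act on vector fields \<open>X, Y, Z :: 'm \<Rightarrow> 'm\<close> defined on the
  coordinate image of one chart; \<open>G\<close>, \<open>J\<close> and \<open>w\<close> are the components there of a connection, of an
  endomorphism field (a \<open>T\<close>-valued 1-form) and of a bilinear field.
\<close>

definition lie_bracket :: "('m::euclidean_space \<Rightarrow> 'm) \<Rightarrow> ('m \<Rightarrow> 'm) \<Rightarrow> 'm \<Rightarrow> 'm" where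
  "lie_bracket X Y x = D Y x (X x) - D X x (Y x)"

definition cov_deriv ::
    "('m::euclidean_space \<Rightarrow> 'm \<Rightarrow> 'm \<Rightarrow> 'm) \<Rightarrow> ('m \<Rightarrow> 'm) \<Rightarrow> ('m \<Rightarrow> 'm) \<Rightarrow> 'm \<Rightarrow> 'm" where
  "cov_deriv G X Y x = D Y x (X x) + G x (X x) (Y x)"

definition torsion ::
    "('m::euclidean_space \<Rightarrow> 'm \<Rightarrow> 'm \<Rightarrow> 'm) \<Rightarrow> ('m \<Rightarrow> 'm) \<Rightarrow> ('m \<Rightarrow> 'm) \<Rightarrow> 'm \<Rightarrow> 'm" where
  "torsion G X Y x = cov_deriv G X Y x - cov_deriv G Y X x - lie_bracket X Y x"

definition curvature ::
    "('m::euclidean_space \<Rightarrow> 'm \<Rightarrow> 'm \<Rightarrow> 'm) \<Rightarrow>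
     ('m \<Rightarrow> 'm) \<Rightarrow> ('m \<Rightarrow> 'm) \<Rightarrow> ('m \<Rightarrow> 'm) \<Rightarrow> 'm \<Rightarrow> 'm" where
  "curvature G X Y Z x =
     cov_deriv G X (cov_deriv G Y Z) x - cov_deriv G Y (cov_deriv G X Z) x
     - cov_deriv G (lie_bracket X Y) Z x"

definition cov_deriv_bilinear ::
    "('m::euclidean_space \<Rightarrow> 'm \<Rightarrow> 'm \<Rightarrow> 'm) \<Rightarrow> ('m \<Rightarrow> 'm \<Rightarrow> 'm \<Rightarrow> real) \<Rightarrow>
     ('m \<Rightarrow> 'm) \<Rightarrow> ('m \<Rightarrow> 'm) \<Rightarrow> ('m \<Rightarrow> 'm) \<Rightarrow> 'm \<Rightarrow> real" where
  "cov_deriv_bilinear G w X Y Z x =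
     D (\<lambda>y. w y (Y y) (Z y)) x (X x) - w x (cov_deriv G X Y x) (Z x) - w x (Y x) (cov_deriv G X Z x)"

text \<open>The covariant exterior derivative \<open>d\<^sub>\<nabla> : \<Omega>\<^sup>1(M,T) \<rightarrow> \<Omega>\<^sup>2(M,T)\<close>.\<close>

definition cov_ext_deriv ::
    "('m::euclidean_space \<Rightarrow> 'm \<Rightarrow> 'm \<Rightarrow> 'm) \<Rightarrow> ('m \<Rightarrow> 'm \<Rightarrow> 'm) \<Rightarrow>
     ('m \<Rightarrow> 'm) \<Rightarrow> ('m \<Rightarrow> 'm) \<Rightarrow> 'm \<Rightarrow> 'm" where
  "cov_ext_deriv G J X Y x =
     cov_deriv G X (\<lambda>y. J y (Y y)) x - cov_deriv G Y (\<lambda>y. J y (X y)) x - J x (lie_bracket X Y x)"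

definition ext_deriv2 ::
    "('m::euclidean_space \<Rightarrow> 'm \<Rightarrow> 'm \<Rightarrow> real) \<Rightarrow>
     ('m \<Rightarrow> 'm) \<Rightarrow> ('m \<Rightarrow> 'm) \<Rightarrow> ('m \<Rightarrow> 'm) \<Rightarrow> 'm \<Rightarrow> real" where
  "ext_deriv2 w X Y Z x =
     D (\<lambda>y. w y (Y y) (Z y)) x (X x) - D (\<lambda>y. w y (X y) (Z y)) x (Y x)
     + D (\<lambda>y. w y (X y) (Y y)) x (Z x)
     - w x (lie_bracket X Y x) (Z x) + w x (lie_bracket X Z x) (Y x) - w x (lie_bracket Y Z x) (X x)"

abbreviation vector_field_in :: "('a, 'm::euclidean_space) chart \<Rightarrow> ('m \<Rightarrow> 'm) \<Rightarrow> bool" where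
  "vector_field_in c X \<equiv> smooth_on (snd c ` fst c) X"

definition torsion_free ::
    "('a, 'm::euclidean_space) chart set \<Rightarrow> ('a, 'm) christoffel \<Rightarrow> bool" where
  "torsion_free A \<Gamma> \<longleftrightarrow>
     (\<forall>c\<in>A. \<forall>X Y. vector_field_in c X \<and> vector_field_in c Y \<longrightarrow>
        (\<forall>x\<in>snd c ` fst c. torsion (\<Gamma> c) X Y x = 0))"

definition flat_connection ::
    "('a, 'm::euclidean_space) chart set \<Rightarrow> ('a, 'm) christoffel \<Rightarrow> bool" where
  "flat_connection A \<Gamma> \<longleftrightarrow>
     (\<forall>c\<in>A. \<forall>X Y Z. vector_field_in c X \<and> vector_field_in c Y \<and> vector_field_in c Z \<longrightarrow>
        (\<forall>x\<in>snd c ` fst c. curvature (\<Gamma> c) X Y Z x = 0))"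

definition parallel_bilinear ::
    "('a, 'm::euclidean_space) chart set \<Rightarrow> ('a, 'm) christoffel \<Rightarrow> ('a, 'm) bilinear_field \<Rightarrow> bool"
  where
  "parallel_bilinear A \<Gamma> w \<longleftrightarrow>
     (\<forall>c\<in>A. \<forall>X Y Z. vector_field_in c X \<and> vector_field_in c Y \<and> vector_field_in c Z \<longrightarrow>
        (\<forall>x\<in>snd c ` fst c. cov_deriv_bilinear (\<Gamma> c) (w c) X Y Z x = 0))"

definition cov_closed ::
    "('a, 'm::euclidean_space) chart set \<Rightarrow> ('a, 'm) christoffel \<Rightarrow> ('a, 'm) endo_field \<Rightarrow> bool"
  where
  "cov_closed A \<Gamma> I \<longleftrightarrow>
     (\<forall>c\<in>A. \<forall>X Y. vector_field_in c X \<and> vector_field_in c Y \<longrightarrow>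
        (\<forall>x\<in>snd c ` fst c. cov_ext_deriv (\<Gamma> c) (I c) X Y x = 0))"

definition closed_2form ::
    "('a, 'm::euclidean_space) chart set \<Rightarrow> ('a, 'm) bilinear_field \<Rightarrow> bool" where
  "closed_2form A w \<longleftrightarrow>
     (\<forall>c\<in>A. \<forall>X Y Z. vector_field_in c X \<and> vector_field_in c Y \<and> vector_field_in c Z \<longrightarrow>
        (\<forall>x\<in>snd c ` fst c. ext_deriv2 (w c) X Y Z x = 0))"


section \<open>Special pseudo-Kaehler metrics\<close>

definition linear_complex_structure :: "('m::euclidean_space \<Rightarrow> 'm) \<Rightarrow> bool" where
  "linear_complex_structure J \<longleftrightarrow> linear J \<and> (\<forall>v. J (J v) = - v)"

text \<open>
  Integrability: every point has a holomorphic coordinate chart \<open>z\<close> in the given smooth structure,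
  with values in \<open>('m, J)\<close>, which is linearly isomorphic to \<open>\<complex>\<^sup>n\<close> with \<open>2 n = DIM('m)\<close>.
\<close>

definition integrable_complex_structure ::
    "'a topology \<Rightarrow> ('a, 'm::euclidean_space) chart set \<Rightarrow> ('a, 'm) endo_field \<Rightarrow> bool" where
  "integrable_complex_structure X A I \<longleftrightarrow>
     is_endo_field A I \<and>
     (\<forall>c\<in>A. \<forall>x\<in>snd c ` fst c. linear_complex_structure (I c x)) \<and>
     (\<forall>p\<in>topspace X. \<exists>z J. compatible_chart X A z \<and> p \<in> fst z \<and> linear_complex_structure J \<and>
        (\<forall>c\<in>A. \<forall>x\<in>overlap c z. \<forall>v.
           D (transition c z) x (I c x v) = J (D (transition c z) x v)))"

definition pseudo_riemannian ::
    "('a, 'm::euclidean_space) chart set \<Rightarrow> ('a, 'm) bilinear_field \<Rightarrow> bool" where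
  "pseudo_riemannian A g \<longleftrightarrow>
     is_bilinear_field A g \<and>
     (\<forall>c\<in>A. \<forall>x\<in>snd c ` fst c.
        (\<forall>u v. g c x u v = g c x v u) \<and> (\<forall>u. (\<forall>v. g c x u v = 0) \<longrightarrow> u = 0))"

definition kahler_form ::
    "('a, 'm::euclidean_space) bilinear_field \<Rightarrow> ('a, 'm) endo_field \<Rightarrow> ('a, 'm) bilinear_field" where
  "kahler_form g I c x u v = g c x (I c x u) v"

definition pseudo_kahler ::
    "'a topology \<Rightarrow> ('a, 'm::euclidean_space) chart set \<Rightarrow>
     ('a, 'm) bilinear_field \<Rightarrow> ('a, 'm) endo_field \<Rightarrow> bool" where
  "pseudo_kahler X A g I \<longleftrightarrow>
     smooth_manifold X A \<and> integrable_complex_structure X A I \<and> pseudo_riemannian A g \<and>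
     (\<forall>c\<in>A. \<forall>x\<in>snd c ` fst c. \<forall>u v. g c x (I c x u) (I c x v) = g c x u v) \<and>
     closed_2form A (kahler_form g I)"

definition special_pseudo_kahler ::
    "'a topology \<Rightarrow> ('a, 'm::euclidean_space) chart set \<Rightarrow>
     ('a, 'm) bilinear_field \<Rightarrow> ('a, 'm) endo_field \<Rightarrow> ('a, 'm) christoffel \<Rightarrow> bool" where
  "special_pseudo_kahler X A g I \<Gamma> \<longleftrightarrow>
     pseudo_kahler X A g I \<and>
     is_connection A \<Gamma> \<and> flat_connection A \<Gamma> \<and> torsion_free A \<Gamma> \<and>
     parallel_bilinear A \<Gamma> (kahler_form g I) \<and> cov_closed A \<Gamma> I"

definition special_pseudo_kahler_metric ::
    "'a topology \<Rightarrow> ('a, 'm::euclidean_space) chart set \<Rightarrow> ('a, 'm) bilinear_field \<Rightarrow> bool" where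
  "special_pseudo_kahler_metric X A g \<longleftrightarrow> (\<exists>I \<Gamma>. special_pseudo_kahler X A g I \<Gamma>)"


section \<open>Bi-Lagrangian embeddings in \<open>V \<times> V\<close>\<close>

definition symplectic_form :: "('v::euclidean_space \<Rightarrow> 'v \<Rightarrow> real) \<Rightarrow> bool" where
  "symplectic_form s \<longleftrightarrow>
     bilinear s \<and> (\<forall>u v. s u v = - s v u) \<and> (\<forall>u. (\<forall>v. s u v = 0) \<longrightarrow> u = 0)"

definition Omega1 :: "('v \<Rightarrow> 'v \<Rightarrow> real) \<Rightarrow> 'v \<times> 'v \<Rightarrow> 'v \<times> 'v \<Rightarrow> real" where
  "Omega1 s a b = s (fst a) (snd b) + s (snd a) (fst b)"

definition Omega2 :: "('v \<Rightarrow> 'v \<Rightarrow> real) \<Rightarrow> 'v \<times> 'v \<Rightarrow> 'v \<times> 'v \<Rightarrow> real" where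
  "Omega2 s a b = s (fst a) (fst b) - s (snd a) (snd b)"

definition polarization :: "('w::euclidean_space \<Rightarrow> real) \<Rightarrow> 'w \<Rightarrow> 'w \<Rightarrow> real" where
  "polarization Q a b = (Q (a + b) - Q a - Q b) / 2"

definition product_metric ::
    "('v::euclidean_space \<Rightarrow> 'v \<Rightarrow> real) \<Rightarrow> 'v \<times> 'v \<Rightarrow> 'v \<times> 'v \<Rightarrow> real" where
  "product_metric s = polarization (\<lambda>w. s (fst w) (snd w) / 2)"

text \<open>Pull-back along \<open>f\<close> of a constant bilinear form; for an inclusion, its restriction.\<close>

definition pullback ::
    "('a \<Rightarrow> 'w::euclidean_space) \<Rightarrow> ('w \<Rightarrow> 'w \<Rightarrow> real) \<Rightarrow> ('a, 'm::euclidean_space) bilinear_field" where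
  "pullback f B c x u v = B (D (local_rep c f) x u) (D (local_rep c f) x v)"

definition lagrangian_on ::
    "('a, 'm::euclidean_space) chart set \<Rightarrow> 'a set \<Rightarrow> ('a \<Rightarrow> 'v::euclidean_space \<times> 'v) \<Rightarrow>
     ('v \<times> 'v \<Rightarrow> 'v \<times> 'v \<Rightarrow> real) \<Rightarrow> bool" where
  "lagrangian_on A U f B \<longleftrightarrow> DIM('m) = DIM('v) \<and>
     (\<forall>c\<in>A. \<forall>x\<in>snd c ` (fst c \<inter> U). \<forall>u v. pullback f B c x u v = 0)"

definition bilagrangian_transversal_on ::
    "('v::euclidean_space \<Rightarrow> 'v \<Rightarrow> real) \<Rightarrow> 'a topology \<Rightarrow> ('a, 'm::euclidean_space) chart set \<Rightarrow>
     'a set \<Rightarrow> ('a \<Rightarrow> 'v \<times> 'v) \<Rightarrow> bool" where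
  "bilagrangian_transversal_on s X A U f \<longleftrightarrow>
     lagrangian_on A U f (Omega1 s) \<and> lagrangian_on A U f (Omega2 s) \<and>
     local_diffeo_on X A U (fst \<circ> f) \<and> local_diffeo_on X A U (snd \<circ> f)"

end

theory Submission
  imports Defs
begin

text \<open>
  Both directions rest on one description in coordinates. Write the two components of a map into
  \<open>V \<times> V\<close> as \<open>a\<close> and \<open>b\<close>. Transversality makes \<open>Da\<close> and \<open>Db\<close> invertible, so \<open>a\<close> is a local system of
  coordinates with values in \<open>V\<close>, and \<open>Db = Da \<circ> I\<close> defines an endomorphism field \<open>I\<close>.

  Suppose the map is bi-Lagrangian. The vanishing of \<open>Omega2\<close> says that \<open>s(Db u, Db v) = s(Da u, Da v)\<close>;
  combined with the vanishing of \<open>Omega1\<close> and the nondegeneracy of \<open>s\<close> it gives \<open>Db \<circ> I = - Da\<close>, so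
  \<open>I\<^sup>2 = -1\<close> (lemma \<open>Db_J\<close>). Let \<open>\<nabla>\<close> be the connection for which \<open>a\<close> is a flat coordinate system. It is
  the pull-back of ordinary differentiation in \<open>V\<close> (lemma \<open>D_cov_deriv\<close>), hence flat and torsion-free.
  The induced metric is \<open>g(u,v) = s(Da u, Db v) / 2\<close>, its Kaehler form is \<open>s(Da u, Da v) / 2\<close>, a form with
  constant coefficients in the coordinates \<open>a\<close> and therefore parallel, and \<open>d\<^sub>\<nabla> I = 0\<close> is the symmetry of
  the second derivative of \<open>b\<close>. Holomorphic coordinates are explicit: \<open>a - i b\<close> is a holomorphic map to
  \<open>V \<otimes> \<complex>\<close>, and followed by the complex-linear projection to the tangent space with complex structure \<open>I\<close> at one
  point it becomes a local diffeomorphism near that point (lemma \<open>holomorphic_coordinate\<close>).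

  Conversely, given a special structure, look for functions \<open>f\<close>, \<open>\<phi>\<close> and a covector field \<open>\<epsilon>\<close> with
  \<open>df = \<epsilon>\<close>, \<open>d\<phi> = \<epsilon> \<circ> I\<close> and \<open>\<nabla>\<epsilon> = 0\<close>. This is an overdetermined linear system, and its integrability
  conditions are, component by component, the vanishing of the torsion, of \<open>d\<^sub>\<nabla> I\<close> and of the curvature
  (lemma \<open>special_potentials\<close>). Solving it for a basis of initial covectors yields vector-valued \<open>f\<close>
  and \<open>\<phi>\<close> with \<open>D\<phi> = Df \<circ> I\<close>, such that \<open>f\<close> is a flat coordinate system near the given point. The parallel form \<open>\<omega>\<close> has constant
  coefficients in the coordinates \<open>f\<close>; taking twice these coefficients as \<open>s\<close>, the map \<open>(f, \<phi>)\<close> is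
  the required embedding, by the same identities read backwards.

  The analytic core is the Frobenius theorem for linear systems (theorem \<open>frobenius_linear\<close>), proved by
  Picard iteration along rays: the integrability condition makes the defect of the iterates satisfy a
  contraction estimate as well, so that the derivatives of the iterates converge with them.
\<close>

section \<open>Calculus of smooth maps\<close>

lemma D_eqI: "(f has_derivative f') (at x) \<Longrightarrow> D f x = f'"
  using frechet_derivative_at by metis

lemma D_works: "f differentiable (at x) \<Longrightarrow> (f has_derivative D f x) (at x)"
  using frechet_derivative_works by blast

lemma D_linear: "f differentiable (at x) \<Longrightarrow> linear (D f x)"
  by (rule linear_frechet_derivative)

lemma D_cong_open:
  assumes "open S" "x \<in> S" "\<And>y. y \<in> S \<Longrightarrow> f y = g y"
  shows "D f x = D g x"
proof -
  have "(f has_derivative f') (at x) \<longleftrightarrow> (g has_derivative f') (at x)" for f'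
    using assms has_derivative_transform_within_open[of f f' x UNIV S g]
      has_derivative_transform_within_open[of g f' x UNIV S f] by auto
  then show ?thesis by (simp add: frechet_derivative_def)
qed

lemma differentiable_cong_open:
  assumes "open S" "x \<in> S" "\<And>y. y \<in> S \<Longrightarrow> f y = g y" "f differentiable (at x)"
  shows "g differentiable (at x)"
  using assms has_derivative_transform_within_open[of f _ x UNIV S g]
  unfolding differentiable_def by blast

lemma Ck_on_cong:
  assumes "open S" "\<And>x. x \<in> S \<Longrightarrow> f x = g x" "Ck_on k S f"
  shows "Ck_on k S g"
  using assms(2,3)
proof (induction k arbitrary: f g)
  case 0
  then show ?case by (simp cong: continuous_on_cong)
next
  case (Suc k)
  have "Ck_on k S (\<lambda>x. D g x v)" for v
  proof (rule Suc.IH)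
    show "Ck_on k S (\<lambda>x. D f x v)" using Suc.prems by simp
    show "D f x v = D g x v" if "x \<in> S" for x
      using D_cong_open[OF assms(1) that, of f g] Suc.prems by simp
  qed
  then show ?case using Suc.prems differentiable_cong_open[OF assms(1), of _ f g] by auto
qed

lemma Ck_on_subset: "Ck_on k S f \<Longrightarrow> T \<subseteq> S \<Longrightarrow> Ck_on k T f"
  by (induction k arbitrary: f) (auto intro: continuous_on_subset)

lemma Ck_on_SucD: "Ck_on (Suc k) S f \<Longrightarrow> Ck_on k S f"
proof (induction k arbitrary: f)
  case 0
  then show ?case
    by (auto intro!: differentiable_imp_continuous_on differentiable_at_imp_differentiable_on)
next
  case (Suc k)
  then show ?case by (metis Ck_on.simps(2))
qed

lemma Ck_on_local:
  assumes "\<And>x. x \<in> S \<Longrightarrow> \<exists>T. open T \<and> x \<in> T \<and> Ck_on k T f"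
  shows "Ck_on k S f"
  using assms
proof (induction k arbitrary: f)
  case 0
  show ?case unfolding Ck_on.simps
  proof (rule continuous_at_imp_continuous_on, rule ballI)
    fix x assume "x \<in> S"
    then obtain T where "open T" "x \<in> T" "continuous_on T f" using 0 by auto
    then show "isCont f x" by (simp add: continuous_on_eq_continuous_at)
  qed
next
  case (Suc k)
  show ?case unfolding Ck_on.simps
  proof (intro conjI allI ballI)
    show "f differentiable (at x)" if "x \<in> S" for x using Suc.prems[OF that] by auto
    show "Ck_on k S (\<lambda>x. D f x v)" for v
      by (rule Suc.IH) (use Suc.prems in fastforce)
  qed
qed

lemma Ck_on_const: "Ck_on k S (\<lambda>x. c)"
  by (induction k arbitrary: c) (auto simp: frechet_derivative_const)

lemma Ck_on_linear:
  assumes "bounded_linear L" shows "Ck_on k S L"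
proof (cases k)
  case 0
  then show ?thesis using assms by (simp add: linear_continuous_on)
next
  case (Suc m)
  have "D L x = L" for x
    using assms by (intro D_eqI bounded_linear_imp_has_derivative)
  then show ?thesis using Suc assms Ck_on_const[of m S]
    by (auto simp: bounded_linear_imp_differentiable)
qed

lemma Ck_on_add:
  assumes "open S" "Ck_on k S f" "Ck_on k S g" shows "Ck_on k S (\<lambda>x. f x + g x)"
  using assms(2,3)
proof (induction k arbitrary: f g)
  case 0 then show ?case by (auto intro: continuous_intros)
next
  case (Suc k)
  have d: "f differentiable (at x)" "g differentiable (at x)" if "x \<in> S" for x
    using Suc.prems that by auto
  have "Ck_on k S (\<lambda>x. D (\<lambda>x. f x + g x) x v)" for v
  proof (rule Ck_on_cong[OF assms(1)])
    show "Ck_on k S (\<lambda>x. D f x v + D g x v)" using Suc by auto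
    show "D f x v + D g x v = D (\<lambda>x. f x + g x) x v" if "x \<in> S" for x
      using D_eqI[OF has_derivative_add[OF D_works D_works], OF d[OF that]] by simp
  qed
  then show ?case using d by auto
qed

lemma Ck_on_sum:
  assumes "open S" "\<And>i. i \<in> B \<Longrightarrow> Ck_on k S (f i)"
  shows "Ck_on k S (\<lambda>x. \<Sum>i\<in>B. f i x)"
  using assms(2) by (induction B rule: infinite_finite_induct) (auto intro: Ck_on_const Ck_on_add[OF assms(1)])

lemma (in bounded_bilinear) Ck_on_prod:
  assumes "open S" "Ck_on k S f" "Ck_on k S g" shows "Ck_on k S (\<lambda>x. prod (f x) (g x))"
  using assms(2,3)
proof (induction k arbitrary: f g)
  case 0 then show ?case by (auto intro: continuous_on)
next
  case (Suc k)
  have d: "f differentiable (at x)" "g differentiable (at x)" if "x \<in> S" for x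
    using Suc.prems that by auto
  have "Ck_on k S (\<lambda>x. D (\<lambda>x. prod (f x) (g x)) x v)" for v
  proof (rule Ck_on_cong[OF assms(1)])
    show "Ck_on k S (\<lambda>x. prod (f x) (D g x v) + prod (D f x v) (g x))"
      using Suc.prems Ck_on_SucD[OF Suc.prems(1)] Ck_on_SucD[OF Suc.prems(2)]
      by (intro Ck_on_add[OF assms(1)] Suc.IH) (auto simp del: Ck_on.simps(1))
    show "prod (f x) (D g x v) + prod (D f x v) (g x) = D (\<lambda>x. prod (f x) (g x)) x v" if "x \<in> S" for x
      using D_eqI[OF FDERIV[OF D_works D_works], OF d[OF that]] by simp
  qed
  moreover have "(\<lambda>x. prod (f x) (g x)) differentiable (at x)" if "x \<in> S" for x
    using FDERIV[OF D_works D_works, OF d[OF that]] unfolding differentiable_def by blast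
  ultimately show ?case by simp
qed

text \<open>
  Smoothness of a family of linear maps is stated by testing it on fixed vectors. Expansion in a basis
  is what transfers such statements to vectors that vary with the point.
\<close>

lemma linear_basis_sum:
  fixes L :: "'a::euclidean_space \<Rightarrow> 'b::real_vector"
  assumes "linear L" shows "L v = (\<Sum>i\<in>Basis. (v \<bullet> i) *\<^sub>R L i)"
proof -
  have "L v = L (\<Sum>i\<in>Basis. (v \<bullet> i) *\<^sub>R i)" by (simp add: euclidean_representation)
  also have "\<dots> = (\<Sum>i\<in>Basis. (v \<bullet> i) *\<^sub>R L i)"
    using assms by (simp add: linear_sum linear_cmul)
  finally show ?thesis .
qed

text \<open>
  By the chain rule and expansion in a basis, the derivative of \<open>g \<circ> f\<close> is a sum of products of
  derivatives of \<open>f\<close> with maps \<open>(D g i) \<circ> f\<close>, to which the induction hypothesis applies because \<open>D g i\<close> has one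
  derivative less.
\<close>

lemma Ck_on_compose:
  fixes f :: "'a::real_normed_vector \<Rightarrow> 'b::euclidean_space" and g :: "'b \<Rightarrow> 'c::real_normed_vector"
  assumes "open S" "f ` S \<subseteq> T" "Ck_on k S f" "Ck_on k T g"
  shows "Ck_on k S (\<lambda>x. g (f x))"
  using assms(3,4)
proof (induction k arbitrary: g)
  case 0 then show ?case using assms(2) by (auto intro: continuous_on_compose2)
next
  case (Suc k)
  have d: "f differentiable (at x)" "g differentiable (at (f x))" if "x \<in> S" for x
    using Suc.prems that assms(2) by auto
  have h: "((\<lambda>x. g (f x)) has_derivative (\<lambda>v. D g (f x) (D f x v))) (at x)" if "x \<in> S" for x
    using diff_chain_at[OF D_works D_works, OF d[OF that]] by (simp add: o_def)
  have "Ck_on k S (\<lambda>x. D (\<lambda>x. g (f x)) x v)" for v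
  proof (rule Ck_on_cong[OF assms(1)])
    have "Ck_on k S (\<lambda>x. (D f x v \<bullet> i) *\<^sub>R D g (f x) i)" for i
      using Suc.prems Ck_on_SucD[OF Suc.prems(1)]
      by (intro bounded_bilinear.Ck_on_prod[OF bounded_bilinear_scaleR] assms(1) Suc.IH
          bounded_bilinear.Ck_on_prod[OF bounded_bilinear_inner] Ck_on_const) auto
    then show "Ck_on k S (\<lambda>x. \<Sum>i\<in>Basis. (D f x v \<bullet> i) *\<^sub>R D g (f x) i)"
      by (intro Ck_on_sum assms(1))
    show "(\<Sum>i\<in>Basis. (D f x v \<bullet> i) *\<^sub>R D g (f x) i) = D (\<lambda>x. g (f x)) x v" if "x \<in> S" for x
      using D_eqI[OF h[OF that]] linear_basis_sum[OF D_linear[OF d(2)[OF that]]] by metis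
  qed
  then show ?case using h by (auto simp: differentiable_def)
qed

lemma smooth_on_differentiable: "smooth_on S f \<Longrightarrow> x \<in> S \<Longrightarrow> f differentiable (at x)"
  unfolding smooth_on_def by (metis Ck_on.simps(2))

lemma smooth_on_D: "smooth_on S f \<Longrightarrow> smooth_on S (\<lambda>x. D f x v)"
  unfolding smooth_on_def by (metis Ck_on.simps(2))

lemma smooth_on_continuous: "smooth_on S f \<Longrightarrow> continuous_on S f"
  unfolding smooth_on_def by (metis Ck_on.simps(1))

lemma smooth_on_has_derivative: "smooth_on S f \<Longrightarrow> x \<in> S \<Longrightarrow> (f has_derivative D f x) (at x)"
  using smooth_on_differentiable D_works by blast

lemma smooth_on_D_linear: "smooth_on S f \<Longrightarrow> x \<in> S \<Longrightarrow> linear (D f x)"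
  using smooth_on_differentiable D_linear by blast

lemma smooth_on_cong:
  assumes "open S" "\<And>x. x \<in> S \<Longrightarrow> f x = g x" "smooth_on S f" shows "smooth_on S g"
  using assms Ck_on_cong unfolding smooth_on_def by blast

lemma smooth_on_subset: "smooth_on S f \<Longrightarrow> T \<subseteq> S \<Longrightarrow> smooth_on T f"
  unfolding smooth_on_def using Ck_on_subset by blast

lemma smooth_on_local:
  assumes "\<And>x. x \<in> S \<Longrightarrow> \<exists>T. open T \<and> x \<in> T \<and> smooth_on T f"
  shows "smooth_on S f"
  using assms unfolding smooth_on_def by (metis Ck_on_local)

lemma smooth_on_const: "smooth_on S (\<lambda>x. c)"
  by (simp add: smooth_on_def Ck_on_const)

lemma smooth_on_linear: "bounded_linear L \<Longrightarrow> smooth_on S L"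
  by (simp add: smooth_on_def Ck_on_linear)

lemma smooth_on_id: "smooth_on S (\<lambda>x. x)"
  by (rule smooth_on_linear) (rule bounded_linear_ident)

lemma smooth_on_add: "open S \<Longrightarrow> smooth_on S f \<Longrightarrow> smooth_on S g \<Longrightarrow> smooth_on S (\<lambda>x. f x + g x)"
  by (simp add: smooth_on_def Ck_on_add)

lemma smooth_on_sum: "open S \<Longrightarrow> (\<And>i. i \<in> B \<Longrightarrow> smooth_on S (f i)) \<Longrightarrow> smooth_on S (\<lambda>x. \<Sum>i\<in>B. f i x)"
  by (simp add: smooth_on_def Ck_on_sum)

lemma (in bounded_bilinear) smooth_on_prod:
  "open S \<Longrightarrow> smooth_on S f \<Longrightarrow> smooth_on S g \<Longrightarrow> smooth_on S (\<lambda>x. prod (f x) (g x))"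
  by (simp add: smooth_on_def Ck_on_prod)

lemmas smooth_on_scaleR = bounded_bilinear.smooth_on_prod[OF bounded_bilinear_scaleR]
lemmas smooth_on_inner = bounded_bilinear.smooth_on_prod[OF bounded_bilinear_inner]

lemma smooth_on_compose:
  fixes f :: "'a::real_normed_vector \<Rightarrow> 'b::euclidean_space" and g :: "'b \<Rightarrow> 'c::real_normed_vector"
  assumes "open S" "f ` S \<subseteq> T" "smooth_on S f" "smooth_on T g"
  shows "smooth_on S (\<lambda>x. g (f x))"
  using assms Ck_on_compose unfolding smooth_on_def by blast

lemma smooth_on_linear_compose:
  fixes f :: "'a::real_normed_vector \<Rightarrow> 'b::euclidean_space"
  assumes "open S" "linear L" "smooth_on S f"
  shows "smooth_on S (\<lambda>x. L (f x))"
  using smooth_on_compose[OF assms(1) _ assms(3), of UNIV L] assms(2) smooth_on_linear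
  by (auto simp: linear_conv_bounded_linear)

lemma smooth_on_minus:
  fixes f :: "'a::real_normed_vector \<Rightarrow> 'b::euclidean_space"
  shows "open S \<Longrightarrow> smooth_on S f \<Longrightarrow> smooth_on S (\<lambda>x. - f x)"
  using smooth_on_linear_compose[of S uminus f] by (auto simp: linear_iff)

lemma smooth_on_diff:
  fixes f :: "'a::real_normed_vector \<Rightarrow> 'b::euclidean_space"
  shows "open S \<Longrightarrow> smooth_on S f \<Longrightarrow> smooth_on S g \<Longrightarrow> smooth_on S (\<lambda>x. f x - g x)"
  using smooth_on_add[OF _ _ smooth_on_minus] by fastforce

lemma smooth_on_Pair:
  fixes f :: "'a::real_normed_vector \<Rightarrow> 'b::euclidean_space" and g :: "'a \<Rightarrow> 'c::euclidean_space"
  assumes "open S" "smooth_on S f" "smooth_on S g"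
  shows "smooth_on S (\<lambda>x. (f x, g x))"
proof -
  have "smooth_on S (\<lambda>x. (f x, 0::'c))"
    by (rule smooth_on_linear_compose[where L="\<lambda>u. (u, 0)"]) (simp_all add: linear_iff assms)
  moreover have "smooth_on S (\<lambda>x. (0::'b, g x))"
    by (rule smooth_on_linear_compose[where L="\<lambda>u. (0, u)"]) (simp_all add: linear_iff assms)
  ultimately show ?thesis using smooth_on_add[OF assms(1)] by fastforce
qed

lemma smooth_on_fst: 
  fixes f :: "'a::real_normed_vector \<Rightarrow> 'b::euclidean_space \<times> 'c::euclidean_space"
  shows "open S \<Longrightarrow> smooth_on S f \<Longrightarrow> smooth_on S (\<lambda>x. fst (f x))"
  by (rule smooth_on_linear_compose[where L=fst]) (simp_all add: linear_iff)

lemma smooth_on_snd: 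
  fixes f :: "'a::real_normed_vector \<Rightarrow> 'b::euclidean_space \<times> 'c::euclidean_space"
  shows "open S \<Longrightarrow> smooth_on S f \<Longrightarrow> smooth_on S (\<lambda>x. snd (f x))"
  by (rule smooth_on_linear_compose[where L=snd]) (simp_all add: linear_iff)

lemma D_compose:
  assumes "f differentiable (at x)" "g differentiable (at (f x))"
  shows "D (\<lambda>x. g (f x)) x = (\<lambda>v. D g (f x) (D f x v))"
  using D_eqI[OF diff_chain_at[OF D_works D_works, OF assms]] by (simp add: o_def)

section \<open>Families of linear maps\<close>

text \<open>
  The components of a tensor field are smooth for constant arguments; hence they are smooth for
  arguments that are themselves smooth vector fields.
\<close>

lemma smooth_on_family_apply:
  fixes L :: "'a::real_normed_vector \<Rightarrow> 'b::euclidean_space \<Rightarrow> 'c::real_normed_vector"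
  assumes "open S" "\<And>x. x \<in> S \<Longrightarrow> linear (L x)" "\<And>v. smooth_on S (\<lambda>x. L x v)" "smooth_on S w"
  shows "smooth_on S (\<lambda>x. L x (w x))"
proof (rule smooth_on_cong[OF assms(1)])
  show "smooth_on S (\<lambda>x. \<Sum>i\<in>Basis. (w x \<bullet> i) *\<^sub>R L x i)"
    by (intro smooth_on_sum smooth_on_scaleR smooth_on_inner smooth_on_const assms)
  show "(\<Sum>i\<in>Basis. (w x \<bullet> i) *\<^sub>R L x i) = L x (w x)" if "x \<in> S" for x
    using linear_basis_sum[OF assms(2)[OF that]] by metis
qed

text \<open>
  The Leibniz rule for applying a varying linear map to a varying vector. It is used below whenever a
  tensor field is evaluated on vector fields.
\<close>

lemma has_derivative_family_apply:
  fixes L :: "'a::real_normed_vector \<Rightarrow> 'b::euclidean_space \<Rightarrow> 'c::real_normed_vector"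
  assumes S: "open S" "x \<in> S" and lin: "\<And>x. x \<in> S \<Longrightarrow> linear (L x)"
    and L: "\<And>v. (\<lambda>x. L x v) differentiable (at x)" and w: "w differentiable (at x)"
  shows "((\<lambda>x. L x (w x)) has_derivative (\<lambda>h. D (\<lambda>y. L y (w x)) x h + L x (D w x h))) (at x)"
proof -
  have 1: "((\<lambda>y. L y v) has_derivative D (\<lambda>y. L y v) x) (at x)" for v
    using D_works[OF L] .
  have E: "((\<lambda>y. L y (w x)) has_derivative (\<lambda>h. \<Sum>i\<in>Basis. (w x \<bullet> i) *\<^sub>R D (\<lambda>y. L y i) x h)) (at x)"
  proof (rule has_derivative_transform_within_open[OF _ S])
    show "((\<lambda>y. \<Sum>i\<in>Basis. (w x \<bullet> i) *\<^sub>R L y i) has_derivative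
        (\<lambda>h. \<Sum>i\<in>Basis. (w x \<bullet> i) *\<^sub>R D (\<lambda>y. L y i) x h)) (at x)"
      by (intro derivative_intros 1)
    show "(\<Sum>i\<in>Basis. (w x \<bullet> i) *\<^sub>R L y i) = L y (w x)" if "y \<in> S" for y
      by (rule linear_basis_sum[OF lin[OF that], symmetric])
  qed
  have "((\<lambda>y. \<Sum>i\<in>Basis. (w y \<bullet> i) *\<^sub>R L y i) has_derivative
        (\<lambda>h. \<Sum>i\<in>Basis. (w x \<bullet> i) *\<^sub>R D (\<lambda>y. L y i) x h + (D w x h \<bullet> i) *\<^sub>R L x i)) (at x)"
    by (intro derivative_intros 1 has_derivative_inner_left D_works w)
  also have "(\<lambda>h. \<Sum>i\<in>Basis. (w x \<bullet> i) *\<^sub>R D (\<lambda>y. L y i) x h + (D w x h \<bullet> i) *\<^sub>R L x i) =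
     (\<lambda>h. D (\<lambda>y. L y (w x)) x h + L x (D w x h))"
    unfolding D_eqI[OF E] sum.distrib by (subst linear_basis_sum[OF lin[OF S(2)]]) simp
  finally show ?thesis
    by (rule has_derivative_transform_within_open[OF _ S])
       (rule linear_basis_sum[OF lin, symmetric])
qed

lemma D_family_apply:
  fixes L :: "'a::real_normed_vector \<Rightarrow> 'b::euclidean_space \<Rightarrow> 'c::real_normed_vector"
  assumes "open S" "x \<in> S" "\<And>x. x \<in> S \<Longrightarrow> linear (L x)"
    and "\<And>v. smooth_on S (\<lambda>x. L x v)" "smooth_on S w"
  shows "D (\<lambda>x. L x (w x)) x h = D (\<lambda>y. L y (w x)) x h + L x (D w x h)"
  by (subst D_eqI[OF has_derivative_family_apply[of S x L w]])
    (use assms in \<open>auto intro: smooth_on_differentiable\<close>)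

lemma inj_linear_lower_bound:
  fixes L :: "'a::euclidean_space \<Rightarrow> 'b::real_normed_vector"
  assumes "linear L" "inj L"
  obtains c where "c > 0" "\<And>v. norm (L v) \<ge> c * norm v"
proof -
  let ?S = "sphere (0::'a) 1"
  have ne: "?S \<noteq> {}" using SOME_Basis norm_Basis by fastforce
  have "continuous_on ?S (\<lambda>v. norm (L v))"
    using assms by (intro continuous_intros linear_continuous_on) (simp add: linear_conv_bounded_linear)
  then obtain m where m: "m \<in> ?S" "\<And>v. v \<in> ?S \<Longrightarrow> norm (L m) \<le> norm (L v)"
    using continuous_attains_inf[OF compact_sphere ne] by blast
  have "m \<noteq> 0" using m by auto
  then have "L m \<noteq> 0" using assms linear_injective_0 by blast
  then have "norm (L m) > 0" by simp
  moreover have "norm (L v) \<ge> norm (L m) * norm v" for v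
  proof (cases "v = 0")
    case False
    then have "norm (L m) \<le> norm (L (v /\<^sub>R norm v))" by (intro m(2)) simp
    also have "\<dots> = norm (L v) / norm v" using assms(1) by (simp add: linear_cmul divide_inverse)
    finally show ?thesis using False by (simp add: field_simps)
  qed simp
  ultimately show ?thesis using that by blast
qed

lemma linear_inv_bij:
  assumes "linear L" "bij L" shows "linear (inv L)"
proof (rule linearI)
  have LB: "L (inv L w) = w" and BL: "inv L (L v) = v" for v w
    using assms(2) by (simp_all add: bij_is_surj surj_f_inv_f bij_is_inj)
  show "inv L (a + b) = inv L a + inv L b" for a b
    using BL[of "inv L a + inv L b"] by (simp add: linear_add[OF assms(1)] LB)
  show "inv L (r *\<^sub>R a) = r *\<^sub>R inv L a" for r a
    using BL[of "r *\<^sub>R inv L a"] by (simp add: linear_cmul[OF assms(1)] LB)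
qed

text \<open>
  Write \<open>B x\<close> for the inverse of \<open>L x\<close>. The identity \<open>B y - B x = - B y \<circ> (L y - L x) \<circ> B x\<close>, with a bound on
  \<open>B\<close> that is uniform near a point, gives first continuity and then the derivative
  \<open>h \<mapsto> - B x \<circ> D L h \<circ> B x\<close>. As this formula again contains only \<open>B\<close> and derivatives of \<open>L\<close>, the order of
  differentiability can be raised step by step.
\<close>

lemma smooth_on_inverse_family:
  fixes L :: "'a::real_normed_vector \<Rightarrow> 'b::euclidean_space \<Rightarrow> 'c::euclidean_space"
  assumes S: "open S" and lin: "\<And>x. x \<in> S \<Longrightarrow> linear (L x)" and bij: "\<And>x. x \<in> S \<Longrightarrow> bij (L x)"
    and sm: "\<And>v. smooth_on S (\<lambda>x. L x v)"
  shows "smooth_on S (\<lambda>x. inv (L x) w)"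
proof -
  let ?B = "\<lambda>x. inv (L x)"
  have LB: "L x (?B x w) = w" and BL: "?B x (L x v) = v" if "x \<in> S" for x w v
    using bij[OF that] by (simp_all add: bij_is_surj surj_f_inv_f bij_is_inj)
  have linB: "linear (?B x)" if "x \<in> S" for x
    by (rule linear_inv_bij[OF lin[OF that] bij[OF that]])
  \<comment> \<open>If \<open>L x\<close> is bounded below by \<open>c\<close>, nearby \<open>L y\<close> are bounded below by \<open>c / 2\<close>.\<close>
  have bound: "\<exists>C>0. \<forall>\<^sub>F y in at x. y \<in> S \<and> (\<forall>w. norm (?B y w) \<le> C * norm w)" if xS: "x \<in> S" for x
  proof -
    obtain c where c: "c > 0" "\<And>v. norm (L x v) \<ge> c * norm v"
      using inj_linear_lower_bound[OF lin[OF xS] bij_is_inj[OF bij[OF xS]]] by blast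
    have "((\<lambda>y. \<Sum>i\<in>Basis. norm (L y i - L x i)) \<longlongrightarrow> (\<Sum>i\<in>Basis. norm (L x i - L x i))) (at x)"
      using smooth_on_continuous[OF sm] S xS
      by (intro tendsto_intros) (auto simp: continuous_on_eq_continuous_at isCont_def)
    then have "\<forall>\<^sub>F y in at x. (\<Sum>i\<in>Basis. norm (L y i - L x i)) < c/2"
      using c by (intro order_tendstoD) auto
    moreover have "\<forall>\<^sub>F y in at x. y \<in> S" using S xS by (simp add: eventually_at_in_open')
    ultimately have "\<forall>\<^sub>F y in at x. y \<in> S \<and> (\<forall>w. norm (?B y w) \<le> 2/c * norm w)"
    proof eventually_elim
      case (elim y)
      have "c/2 * norm v \<le> norm (L y v)" for v
      proof -
        have l: "linear (\<lambda>v. L y v - L x v)" using lin elim xS by (intro linear_compose_sub) auto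
        have "norm (L y v - L x v) \<le> (\<Sum>i\<in>Basis. norm ((v \<bullet> i) *\<^sub>R (L y i - L x i)))"
          using linear_basis_sum[OF l, of v] norm_sum by metis
        also have "\<dots> \<le> (\<Sum>i\<in>Basis. norm v * norm (L y i - L x i))"
          by (intro sum_mono) (simp add: Basis_le_norm mult_right_mono)
        also have "\<dots> = norm v * (\<Sum>i\<in>Basis. norm (L y i - L x i))" by (simp add: sum_distrib_left)
        also have "\<dots> \<le> norm v * (c/2)" using elim by (intro mult_left_mono) auto
        finally have "norm (L y v - L x v) \<le> norm v * (c/2)" .
        moreover have "norm (L x v) \<le> norm (L y v) + norm (L y v - L x v)"
          by (metis norm_triangle_sub norm_minus_commute)
        ultimately show ?thesis using c(2)[of v] by (simp add: field_simps)
      qed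
      then have "c/2 * norm (?B y w) \<le> norm w" for w using LB[of y w] elim by metis
      then show ?case using elim c(1) by (simp add: field_simps)
    qed
    then show ?thesis using c(1) by (intro exI[of _ "2/c"]) auto
  qed
  have diffB: "?B y w - ?B x w = - ?B y (L y (?B x w) - L x (?B x w))" if "x \<in> S" "y \<in> S" for x y w
    using LB BL that linB by (simp add: linear_diff)
  have cont: "((\<lambda>y. ?B y w) \<longlongrightarrow> ?B x w) (at x)" if x: "x \<in> S" for x w
  proof -
    obtain C where C: "C > 0" "\<forall>\<^sub>F y in at x. y \<in> S \<and> (\<forall>w. norm (?B y w) \<le> C * norm w)"
      using bound[OF x] by blast
    have "((\<lambda>y. C * norm (L y (?B x w) - L x (?B x w))) \<longlongrightarrow> C * norm (L x (?B x w) - L x (?B x w))) (at x)"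
      using smooth_on_continuous[OF sm] S that
      by (intro tendsto_intros) (auto simp: continuous_on_eq_continuous_at isCont_def)
    then have 0: "((\<lambda>y. C * norm (L y (?B x w) - L x (?B x w))) \<longlongrightarrow> 0) (at x)" by simp
    have "((\<lambda>y. ?B y w - ?B x w) \<longlongrightarrow> 0) (at x)"
    proof (rule Lim_null_comparison[OF _ 0])
      show "\<forall>\<^sub>F y in at x. norm (?B y w - ?B x w) \<le> C * norm (L y (?B x w) - L x (?B x w))"
        using C(2)
      proof eventually_elim
        case (elim y)
        then show ?case unfolding diffB[OF x conjunct1[OF elim], of w] norm_minus_cancel by blast
      qed
    qed
    then show ?thesis by (rule LIM_zero_cancel)
  qed
  have deriv: "((\<lambda>y. ?B y w) has_derivative (\<lambda>h. - ?B x (D (\<lambda>y. L y (?B x w)) x h))) (at x)"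
    if x: "x \<in> S" for x w
  proof -
    define v where "v = ?B x w"
    define dL where "dL = D (\<lambda>y. L y v) x"
    have dL: "((\<lambda>y. L y v) has_derivative dL) (at x)"
      unfolding dL_def using smooth_on_has_derivative[OF sm x] .
    interpret dL: bounded_linear dL using dL by (rule has_derivative_bounded_linear)
    have bB: "bounded_linear (?B x)" using linB[OF x] by (simp add: linear_conv_bounded_linear)
    obtain C where C: "C > 0" "\<forall>\<^sub>F y in at x. y \<in> S \<and> (\<forall>w. norm (?B y w) \<le> C * norm w)"
      using bound[OF x] by blast
    \<comment> \<open>The error splits into \<open>R\<close>, from linearizing \<open>L\<close>, and \<open>Q\<close>, from replacing \<open>B y\<close> by \<open>B x\<close>.\<close>
    let ?n = "\<lambda>y. norm (y - x)"
    define R where "R y = L y v - L x v - dL (y - x)" for y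
    have R0: "((\<lambda>y. norm (R y) / ?n y) \<longlongrightarrow> 0) (at x)"
      using dL unfolding has_derivative_iff_norm R_def by blast
    define Q where "Q y = (\<Sum>i\<in>Basis. norm (?B x i - ?B y i))" for y
    have "(Q \<longlongrightarrow> (\<Sum>i\<in>Basis. norm (?B x i - ?B x i))) (at x)"
      unfolding Q_def by (intro tendsto_intros cont x)
    then have Q0: "(Q \<longlongrightarrow> 0) (at x)" by simp
    obtain K where K: "\<And>h. norm (dL h) \<le> norm h * K" using dL.bounded by blast
    have Qb: "norm (?B x u - ?B y u) \<le> norm u * Q y" if "y \<in> S" for y u
    proof -
      have l: "linear (\<lambda>v. ?B x v - ?B y v)" using linB x that by (intro linear_compose_sub) auto
      have "norm (?B x u - ?B y u) \<le> (\<Sum>i\<in>Basis. norm ((u \<bullet> i) *\<^sub>R (?B x i - ?B y i)))"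
        using linear_basis_sum[OF l, of u] norm_sum by metis
      also have "\<dots> \<le> (\<Sum>i\<in>Basis. norm u * norm (?B x i - ?B y i))"
        by (intro sum_mono) (simp add: Basis_le_norm mult_right_mono)
      finally show ?thesis by (simp add: Q_def sum_distrib_left)
    qed
    have lim: "((\<lambda>y. C * (norm (R y) / ?n y) + K * Q y) \<longlongrightarrow> 0) (at x)"
      using tendsto_add[OF tendsto_mult_left[OF R0, of C] tendsto_mult_left[OF Q0, of K]]
      by (simp only: mult_zero_right add_0)
    have "((\<lambda>y. norm (?B y w - ?B x w - (- ?B x (dL (y - x)))) / ?n y) \<longlongrightarrow> 0) (at x)"
    proof (rule Lim_null_comparison[OF _ lim])
      show "\<forall>\<^sub>F y in at x. norm (norm (?B y w - ?B x w - (- ?B x (dL (y - x)))) / ?n y)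
               \<le> C * (norm (R y) / ?n y) + K * Q y"
        using C(2) eventually_neq_at_within[of x x UNIV]
      proof eventually_elim
        case (elim y)
        then have y: "y \<in> S" "y \<noteq> x" by auto
        have "?B y w - ?B x w = - ?B y (R y + dL (y - x))"
          using diffB[OF x y(1), of w] by (simp add: R_def v_def)
        then have "?B y w - ?B x w - (- ?B x (dL (y - x)))
            = - ?B y (R y) + (?B x (dL (y - x)) - ?B y (dL (y - x)))"
          using linB[OF y(1)] by (simp add: linear_add)
        also have "norm \<dots> \<le> norm (?B y (R y)) + norm (?B x (dL (y - x)) - ?B y (dL (y - x)))"
          by (metis norm_minus_cancel norm_triangle_ineq)
        also have "\<dots> \<le> C * norm (R y) + (?n y * K) * Q y"
        proof (rule add_mono)
          show "norm (?B y (R y)) \<le> C * norm (R y)" using elim by auto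
          have "norm (?B x (dL (y - x)) - ?B y (dL (y - x))) \<le> norm (dL (y - x)) * Q y"
            using Qb y by blast
          also have "\<dots> \<le> (?n y * K) * Q y"
            by (intro mult_right_mono K) (simp add: Q_def sum_nonneg)
          finally show "norm (?B x (dL (y - x)) - ?B y (dL (y - x))) \<le> (?n y * K) * Q y" .
        qed
        finally show ?case using y(2) by (simp add: field_simps)
      qed
    qed
    moreover have "bounded_linear (\<lambda>h. - ?B x (dL h))"
      by (intro bounded_linear_minus bounded_linear_compose[OF bB dL.bounded_linear])
    ultimately have "((\<lambda>y. ?B y w) has_derivative (\<lambda>h. - ?B x (dL h))) (at x)"
      unfolding has_derivative_iff_norm by blast
    then show ?thesis by (simp add: dL_def v_def)
  qed
  have "Ck_on k S (\<lambda>x. ?B x w)" for k w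
  proof (induction k arbitrary: w)
    case 0
    then show ?case using deriv S by (auto simp: continuous_on_eq_continuous_at intro: has_derivative_continuous)
  next
    case (Suc k)
    \<comment> \<open>In a basis the derivative is a polynomial in components of \<open>B\<close> and of derivatives of \<open>L\<close>.\<close>
    have "Ck_on k S (\<lambda>x. D (\<lambda>y. ?B y w) x h)" for h
    proof (rule Ck_on_cong[OF S])
      let ?G = "\<lambda>x. \<Sum>j\<in>Basis. (\<Sum>i\<in>Basis. (?B x w \<bullet> i) *\<^sub>R D (\<lambda>y. L y i) x h \<bullet> j) *\<^sub>R ?B x j"
      have "Ck_on k S ?G"
        using smooth_on_D[OF sm] unfolding smooth_on_def
        by (intro Ck_on_sum S bounded_bilinear.Ck_on_prod[OF bounded_bilinear_scaleR] Suc
            bounded_bilinear.Ck_on_prod[OF bounded_bilinear_inner] Ck_on_const) auto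
      then show "Ck_on k S (\<lambda>x. (-1) *\<^sub>R ?G x)"
        by (intro bounded_bilinear.Ck_on_prod[OF bounded_bilinear_scaleR] Ck_on_const S)
      show "(-1) *\<^sub>R ?G x = D (\<lambda>y. ?B y w) x h" if x: "x \<in> S" for x
      proof -
        have 1: "((\<lambda>y. \<Sum>i\<in>Basis. (?B x w \<bullet> i) *\<^sub>R L y i) has_derivative
          (\<lambda>h. \<Sum>i\<in>Basis. (?B x w \<bullet> i) *\<^sub>R D (\<lambda>y. L y i) x h)) (at x)"
          by (intro derivative_intros smooth_on_has_derivative[OF sm x])
        have 2: "((\<lambda>y. L y (?B x w)) has_derivative
          (\<lambda>h. \<Sum>i\<in>Basis. (?B x w \<bullet> i) *\<^sub>R D (\<lambda>y. L y i) x h)) (at x)"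
          by (rule has_derivative_transform_within_open[OF 1 S x])
            (rule linear_basis_sum[OF lin, symmetric])
        show ?thesis
          unfolding D_eqI[OF deriv[OF x]] D_eqI[OF 2]
          by (subst (2) linear_basis_sum[OF linB[OF x]]) (simp add: inner_sum_left)
      qed
    qed
    then show ?case using deriv by (auto simp: differentiable_def)
  qed
  then show ?thesis by (simp add: smooth_on_def)
qed

section \<open>Smooth inverse functions\<close>

lemma continuous_on_Blinfun_D:
  fixes f :: "'a::euclidean_space \<Rightarrow> 'b::euclidean_space"
  assumes "smooth_on U f"
  shows "continuous_on U (\<lambda>x. Blinfun (D f x))"
proof (rule continuous_on_blinfun_componentwise)
  fix i :: 'a
  have "blinfun_apply (Blinfun (D f x)) i = D f x i" if "x \<in> U" for x
    using smooth_on_D_linear[OF assms that] by (simp add: bounded_linear_Blinfun_apply linear_conv_bounded_linear)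
  then show "continuous_on U (\<lambda>x. blinfun_apply (Blinfun (D f x)) i)"
    using smooth_on_continuous[OF smooth_on_D[OF assms]] by (simp cong: continuous_on_cong)
qed

text \<open>
  The inverse function theorem supplies a differentiable inverse \<open>g\<close> with \<open>D g y = inv (D f (g y))\<close>. Since
  inversion of linear maps is smooth, this equation improves the regularity of \<open>g\<close> from \<open>C\<^sup>k\<close> to
  \<open>C\<^sup>k\<^sup>+\<^sup>1\<close>.
\<close>

lemma smooth_inverse_function:
  fixes f :: "'a::euclidean_space \<Rightarrow> 'a"
  assumes U: "open U" and f: "smooth_on U f" and x0: "x0 \<in> U" and inj: "inj (D f x0)"
  obtains U' V g where "open U'" "U' \<subseteq> U" "x0 \<in> U'" "open V" "homeomorphism U' V f g"
    "smooth_on V g" "\<And>x. x \<in> U' \<Longrightarrow> bij (D f x)"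
proof -
  define f' where "f' x = Blinfun (D f x)" for x
  have f'_apply: "blinfun_apply (f' x) = D f x" if "x \<in> U" for x
    using smooth_on_D_linear[OF f that]
    by (simp add: f'_def bounded_linear_Blinfun_apply linear_conv_bounded_linear)
  have lin0: "linear (D f x0)" using smooth_on_D_linear[OF f x0] .
  have bij0: "bij (D f x0)"
    using linear_injective_imp_surjective[OF lin0 inj] inj by (simp add: bij_def)
  have "bounded_linear (inv (D f x0))"
    using linear_inv_bij[OF lin0 bij0] by (simp add: linear_conv_bounded_linear)
  then have inv: "Blinfun (inv (D f x0)) o\<^sub>L f' x0 = id_blinfun"
    using inj by (intro blinfun_eqI) (simp add: bounded_linear_Blinfun_apply f'_apply[OF x0])
  obtain U' V g g' where *: "open U'" "U' \<subseteq> U" "x0 \<in> U'" "open V" "homeomorphism U' V f g"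
    and g: "\<And>y. y \<in> V \<Longrightarrow> (g has_derivative (g' y)) (at y)"
    and g': "\<And>y. y \<in> V \<Longrightarrow> g' y = inv (blinfun_apply (f'(g y)))"
    and bij: "\<And>y. y \<in> V \<Longrightarrow> bij (blinfun_apply (f'(g y)))"
  proof (rule inverse_function_theorem[where f=f and f'=f', OF U _ _ x0 inv])
    show "(f has_derivative blinfun_apply (f' x)) (at x)" if "x \<in> U" for x
      using smooth_on_has_derivative[OF f that] f'_apply[OF that] by simp
    show "continuous_on U f'" unfolding f'_def using continuous_on_Blinfun_D[OF f] .
  qed (use that in blast)
  have gU: "g ` V = U'" using * by (simp add: homeomorphism_def)
  have bij': "bij (D f x)" if "x \<in> U'" for x
  proof -
    obtain y where "y \<in> V" "g y = x" using gU \<open>x \<in> U'\<close> by blast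
    then show ?thesis using bij[of y] f'_apply[of x] * \<open>x \<in> U'\<close> by auto
  qed
  have fU': "smooth_on U' f" using smooth_on_subset[OF f *(2)] .
  have sminv: "smooth_on U' (\<lambda>x. inv (D f x) w)" for w
    by (rule smooth_on_inverse_family[OF *(1)])
      (use smooth_on_D_linear[OF fU'] bij' smooth_on_D[OF fU'] in auto)
  have gd: "(g has_derivative inv (D f (g y))) (at y)" if "y \<in> V" for y
  proof -
    have "g y \<in> U" using gU * that by blast
    then show ?thesis using g[OF that] g'[OF that] f'_apply by simp
  qed
  have "Ck_on k V g" for k
  proof (induction k)
    case 0
    then show ?case using * by (simp add: homeomorphism_def)
  next
    case (Suc k)
    have "Ck_on k V (\<lambda>y. D g y v)" for v
    proof (rule Ck_on_cong[OF *(4)])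
      show "Ck_on k V (\<lambda>y. inv (D f (g y)) v)"
        by (rule Ck_on_compose[OF *(4) _ Suc, of U'])
          (use gU sminv in \<open>auto simp: smooth_on_def\<close>)
      show "inv (D f (g y)) v = D g y v" if "y \<in> V" for y
        using D_eqI[OF gd[OF that]] by simp
    qed
    then show ?case using gd by (auto simp: differentiable_def)
  qed
  then have "smooth_on V g" by (simp add: smooth_on_def)
  with * bij' show ?thesis using that by blast
qed

section \<open>Symmetry of second derivatives\<close>

lemma has_vector_derivative_along_line:
  assumes "f differentiable (at (q + s *\<^sub>R u))"
  shows "((\<lambda>s. f (q + s *\<^sub>R u)) has_vector_derivative D f (q + s *\<^sub>R u) u) (at s)"
proof -
  have 1: "((\<lambda>s. q + s *\<^sub>R u) has_derivative (\<lambda>h. h *\<^sub>R u)) (at s)"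
    by (auto intro!: derivative_eq_intros)
  have "((\<lambda>s. f (q + s *\<^sub>R u)) has_derivative (\<lambda>h. D f (q + s *\<^sub>R u) (h *\<^sub>R u))) (at s)"
    using has_derivative_compose[OF 1 D_works[OF assms]] .
  then show ?thesis
    using D_linear[OF assms] by (simp add: has_vector_derivative_def linear_cmul)
qed

text \<open>
  The second difference over a small parallelogram is a second derivative at an interior point, by the
  mean value theorem applied first along \<open>u\<close> and then along \<open>v\<close>. The left-hand side is symmetric in \<open>u\<close>
  and \<open>v\<close>, which is where the symmetry of second derivatives comes from.
\<close>

lemma mixed_difference_MVT:
  fixes f :: "'a::real_normed_vector \<Rightarrow> real"
  assumes f: "smooth_on S f" and t: "t > 0"
    and seg: "\<And>s r. 0 \<le> s \<Longrightarrow> s \<le> t \<Longrightarrow> 0 \<le> r \<Longrightarrow> r \<le> t \<Longrightarrow> x + s *\<^sub>R u + r *\<^sub>R v \<in> S"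
  shows "\<exists>s r. 0 < s \<and> s < t \<and> 0 < r \<and> r < t \<and>
    f (x + t *\<^sub>R u + t *\<^sub>R v) - f (x + t *\<^sub>R u) - f (x + t *\<^sub>R v) + f x
      = t * t * D (\<lambda>y. D f y u) (x + s *\<^sub>R u + r *\<^sub>R v) v"
proof -
  let ?p = "\<lambda>s. f (x + t *\<^sub>R v + s *\<^sub>R u) - f (x + s *\<^sub>R u)"
  have segt: "x + t *\<^sub>R v + s *\<^sub>R u \<in> S" "x + s *\<^sub>R u \<in> S" if "0 \<le> s" "s \<le> t" for s
    using seg[OF that, of t] seg[OF that, of 0] t by (auto simp: algebra_simps)
  have "\<exists>s>0. s < t \<and> ?p t - ?p 0 = (t - 0) * (D f (x + t *\<^sub>R v + s *\<^sub>R u) u - D f (x + s *\<^sub>R u) u)"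
  proof (rule MVT2[OF t])
    fix s assume "0 \<le> s" "s \<le> t"
    then show "(?p has_real_derivative D f (x + t *\<^sub>R v + s *\<^sub>R u) u - D f (x + s *\<^sub>R u) u) (at s)"
      unfolding has_real_derivative_iff_has_vector_derivative
      by (intro has_vector_derivative_diff has_vector_derivative_along_line
          smooth_on_differentiable[OF f] segt)
  qed
  then obtain s where s: "0 < s" "s < t"
    "?p t - ?p 0 = t * (D f (x + t *\<^sub>R v + s *\<^sub>R u) u - D f (x + s *\<^sub>R u) u)" by auto
  let ?q = "\<lambda>r. D f (x + s *\<^sub>R u + r *\<^sub>R v) u"
  have "\<exists>r>0. r < t \<and> ?q t - ?q 0 = (t - 0) * D (\<lambda>y. D f y u) (x + s *\<^sub>R u + r *\<^sub>R v) v"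
  proof (rule MVT2[OF t])
    fix r assume "0 \<le> r" "r \<le> t"
    then show "(?q has_real_derivative D (\<lambda>y. D f y u) (x + s *\<^sub>R u + r *\<^sub>R v) v) (at r)"
      unfolding has_real_derivative_iff_has_vector_derivative using s
      by (intro has_vector_derivative_along_line smooth_on_differentiable[OF smooth_on_D[OF f]] seg) auto
  qed
  then obtain r where r: "0 < r" "r < t"
    "?q t - ?q 0 = t * D (\<lambda>y. D f y u) (x + s *\<^sub>R u + r *\<^sub>R v) v" by auto
  have sw: "x + t *\<^sub>R v + s *\<^sub>R u = x + s *\<^sub>R u + t *\<^sub>R v" "x + t *\<^sub>R v + t *\<^sub>R u = x + t *\<^sub>R u + t *\<^sub>R v"
    by (simp_all add: algebra_simps)
  then have "f (x + t *\<^sub>R u + t *\<^sub>R v) - f (x + t *\<^sub>R u) - f (x + t *\<^sub>R v) + f x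
      = t * t * D (\<lambda>y. D f y u) (x + s *\<^sub>R u + r *\<^sub>R v) v"
    using s(3) r(3) unfolding sw by (simp add: mult.assoc)
  then show ?thesis using s r by blast
qed

lemma D_D_commute_real:
  fixes f :: "'a::real_normed_vector \<Rightarrow> real"
  assumes S: "open S" "x \<in> S" and f: "smooth_on S f"
  shows "D (\<lambda>y. D f y u) x v = D (\<lambda>y. D f y v) x u"
proof (rule ccontr)
  let ?A = "\<lambda>y. D (\<lambda>y. D f y u) y v" and ?B = "\<lambda>y. D (\<lambda>y. D f y v) y u"
  assume "?A x \<noteq> ?B x"
  define e where "e = \<bar>?A x - ?B x\<bar> / 2"
  have e: "e > 0" using \<open>?A x \<noteq> ?B x\<close> by (simp add: e_def)
  have "isCont ?A x" "isCont ?B x"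
    using smooth_on_continuous[OF smooth_on_D[OF smooth_on_D[OF f]]] S
    by (auto simp: continuous_on_eq_continuous_at)
  then obtain d1 d2 where d: "d1 > 0" "\<And>y. dist y x < d1 \<Longrightarrow> dist (?A y) (?A x) < e"
      "d2 > 0" "\<And>y. dist y x < d2 \<Longrightarrow> dist (?B y) (?B x) < e"
    using e unfolding continuous_at_eps_delta by metis
  obtain d3 where d3: "d3 > 0" "ball x d3 \<subseteq> S" using S open_contains_ball by blast
  define m where "m = min d1 (min d2 d3)"
  define t where "t = m / (2 * (norm u + norm v + 1))"
  have m: "m > 0" using d d3 by (simp add: m_def)
  have nn: "norm u + norm v + 1 > 0" by (smt (verit) norm_ge_zero)
  have t: "t > 0" unfolding t_def using m nn by simp
  have tm: "t * (norm u + norm v + 1) = m / 2" using nn by (simp add: t_def field_simps)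
  have near: "dist (x + s *\<^sub>R u + r *\<^sub>R v) x < m" if "0 \<le> s" "s \<le> t" "0 \<le> r" "r \<le> t" for s r
  proof -
    have "norm (s *\<^sub>R u + r *\<^sub>R v) \<le> s * norm u + r * norm v"
      using norm_triangle_ineq[of "s *\<^sub>R u" "r *\<^sub>R v"] that by simp
    also have "\<dots> \<le> t * norm u + t * norm v"
      by (intro add_mono mult_right_mono that) auto
    also have "\<dots> < m" using tm t m by (simp add: algebra_simps)
    finally show ?thesis by (simp add: dist_norm add.assoc)
  qed
  have near': "dist (x + s *\<^sub>R v + r *\<^sub>R u) x < m" if "0 \<le> s" "s \<le> t" "0 \<le> r" "r \<le> t" for s r
    using near[OF that(3,4,1,2)] by (simp add: algebra_simps)
  have inS: "y \<in> S" if "dist y x < m" for y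
    using that d3 by (auto simp: m_def dist_commute)
  obtain s r where 1: "0 < s" "s < t" "0 < r" "r < t"
    "f (x + t *\<^sub>R u + t *\<^sub>R v) - f (x + t *\<^sub>R u) - f (x + t *\<^sub>R v) + f x = t * t * ?A (x + s *\<^sub>R u + r *\<^sub>R v)"
    using mixed_difference_MVT[OF f t inS[OF near]] by blast
  obtain s' r' where 2: "0 < s'" "s' < t" "0 < r'" "r' < t"
    "f (x + t *\<^sub>R v + t *\<^sub>R u) - f (x + t *\<^sub>R v) - f (x + t *\<^sub>R u) + f x = t * t * ?B (x + s' *\<^sub>R v + r' *\<^sub>R u)"
    using mixed_difference_MVT[OF f t inS[OF near']] by blast
  have sw: "x + t *\<^sub>R v + t *\<^sub>R u = x + t *\<^sub>R u + t *\<^sub>R v" by (simp add: algebra_simps)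
  then have "t * t * ?A (x + s *\<^sub>R u + r *\<^sub>R v) = t * t * ?B (x + s' *\<^sub>R v + r' *\<^sub>R u)"
    using 1(5) 2(5) unfolding sw by linarith
  then have eq: "?A (x + s *\<^sub>R u + r *\<^sub>R v) = ?B (x + s' *\<^sub>R v + r' *\<^sub>R u)" using t by simp
  have "dist (?A (x + s *\<^sub>R u + r *\<^sub>R v)) (?A x) < e" "dist (?B (x + s' *\<^sub>R v + r' *\<^sub>R u)) (?B x) < e"
    using near[of s r] near'[of s' r'] 1 2 by (auto intro!: d simp: m_def)
  moreover have "dist (?A x) (?B x) = 2 * e" by (simp add: e_def dist_real_def)
  ultimately show False
    unfolding eq using dist_triangle3[of "?A x" "?B x" "?B (x + s' *\<^sub>R v + r' *\<^sub>R u)"] by linarith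
qed

lemma D_inner_left: "f differentiable (at x) \<Longrightarrow> D (\<lambda>y. f y \<bullet> b) x v = D f x v \<bullet> b"
  by (subst D_eqI[OF has_derivative_inner_left[OF D_works]]) auto

lemma D_D_commute:
  fixes f :: "'a::real_normed_vector \<Rightarrow> 'b::euclidean_space"
  assumes S: "open S" "x \<in> S" and f: "smooth_on S f"
  shows "D (\<lambda>y. D f y u) x v = D (\<lambda>y. D f y v) x u"
proof (rule euclidean_eqI)
  fix b :: 'b
  have 1: "D (\<lambda>y. D f y u) x v \<bullet> b = D (\<lambda>y. D (\<lambda>y. f y \<bullet> b) y u) x v" for u v
  proof -
    have "D (\<lambda>y. D f y u) x v \<bullet> b = D (\<lambda>y. D f y u \<bullet> b) x v"
      using D_inner_left[OF smooth_on_differentiable[OF smooth_on_D[OF f] S(2)]] by simp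
    also have "D (\<lambda>y. D f y u \<bullet> b) x = D (\<lambda>y. D (\<lambda>y. f y \<bullet> b) y u) x"
      by (rule D_cong_open[OF S]) (simp add: D_inner_left smooth_on_differentiable[OF f])
    finally show ?thesis .
  qed
  have "smooth_on S (\<lambda>y. f y \<bullet> b)" by (intro smooth_on_inner S f smooth_on_const)
  from D_D_commute_real[OF S this] show "D (\<lambda>y. D f y u) x v \<bullet> b = D (\<lambda>y. D f y v) x u \<bullet> b"
    by (simp add: 1)
qed

section \<open>The radial primitive of a 1-form\<close>

lemma radial_in_ball:
  fixes p :: "'a::real_normed_vector"
  assumes "x \<in> ball p r" "t \<in> {0..1}"
  shows "p + t *\<^sub>R (x - p) \<in> ball p r"
proof -
  have "norm (t *\<^sub>R (x - p)) \<le> 1 * norm (x - p)"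
    using assms(2) unfolding norm_scaleR by (intro mult_right_mono) auto
  then show ?thesis using assms(1) by (simp add: dist_norm norm_minus_commute)
qed

text \<open>
  Differentiation under the integral sign. Only one order of differentiability is carried along, as
  that is what the Picard iterates below require.
\<close>

lemma has_derivative_radial_average:
  fixes G :: "'a::euclidean_space \<Rightarrow> 'b::euclidean_space"
  assumes G: "Ck_on (Suc 0) (ball p r) G" and x: "x \<in> ball p r"
  shows "((\<lambda>x. integral {0..1} (\<lambda>t. G (p + t *\<^sub>R (x - p)))) has_derivative
          (\<lambda>h. integral {0..1} (\<lambda>t. t *\<^sub>R D G (p + t *\<^sub>R (x - p)) h))) (at x)"
    and "Ck_on (Suc 0) (ball p r) (\<lambda>x. integral {0..1} (\<lambda>t. G (p + t *\<^sub>R (x - p))))"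
proof -
  let ?B = "ball p r"
  have seg: "p + t *\<^sub>R (x - p) \<in> ?B" if "x \<in> ?B" "t \<in> {0..1}" for x t
    by (rule radial_in_ball[OF that])
  have dG: "(G has_derivative D G y) (at y)" if "y \<in> ?B" for y
    using G that by (intro D_works) simp
  define DG where "DG y = Blinfun (D G y)" for y
  have DG: "blinfun_apply (DG y) = D G y" if "y \<in> ?B" for y
    using has_derivative_bounded_linear[OF dG[OF that]] by (simp add: DG_def bounded_linear_Blinfun_apply)
  have contDG: "continuous_on ?B DG"
  proof (rule continuous_on_blinfun_componentwise)
    fix i :: 'a
    have "continuous_on ?B (\<lambda>x. D G x i)" using G by simp
    then show "continuous_on ?B (\<lambda>x. blinfun_apply (DG x) i)"
      by (rule continuous_on_eq) (simp add: DG)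
  qed
  have contG: "continuous_on ?B G" using Ck_on_SucD[OF G] by simp
  have Y: "continuous_on (?B \<times> cbox 0 (1::real)) (\<lambda>(x,t). p + t *\<^sub>R (x - p))"
    unfolding split_beta by (intro continuous_intros)
  have J: "((\<lambda>x. integral (cbox 0 1) (\<lambda>t. G (p + t *\<^sub>R (x - p)))) has_derivative
          blinfun_apply (integral (cbox 0 1) (\<lambda>t. t *\<^sub>R DG (p + t *\<^sub>R (x - p))))) (at x within ?B)"
    if x: "x \<in> ?B" for x
  proof (rule leibniz_rule[OF _ _ _ x convex_ball])
    fix x and t :: real assume xt: "x \<in> ?B" "t \<in> cbox 0 1"
    have 1: "((\<lambda>x. p + t *\<^sub>R (x - p)) has_derivative (\<lambda>h. t *\<^sub>R h)) (at x within ?B)"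
      by (auto intro!: derivative_eq_intros)
    have y: "p + t *\<^sub>R (x - p) \<in> ?B" using seg xt by simp
    have "((\<lambda>x. G (p + t *\<^sub>R (x - p))) has_derivative (\<lambda>h. D G (p + t *\<^sub>R (x - p)) (t *\<^sub>R h))) (at x within ?B)"
      using has_derivative_compose[OF 1 dG[OF y]] .
    moreover have "(\<lambda>h. D G (p + t *\<^sub>R (x - p)) (t *\<^sub>R h)) = blinfun_apply (t *\<^sub>R DG (p + t *\<^sub>R (x - p)))"
      unfolding DG[OF y, symmetric] by (auto simp: blinfun.bilinear_simps)
    ultimately show "((\<lambda>x. G (p + t *\<^sub>R (x - p))) has_derivative
        blinfun_apply (t *\<^sub>R DG (p + t *\<^sub>R (x - p)))) (at x within ?B)" by simp
  next
    fix x assume "x \<in> ?B"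
    then show "(\<lambda>t. G (p + t *\<^sub>R (x - p))) integrable_on cbox 0 1"
      using seg unfolding box_real
      by (intro integrable_continuous_real continuous_on_compose2[OF contG] continuous_intros) auto
  next
    show "continuous_on (?B \<times> cbox 0 1) (\<lambda>(x, t). t *\<^sub>R DG (p + t *\<^sub>R (x - p)))"
      unfolding split_beta using seg
      by (intro continuous_intros continuous_on_compose2[OF contDG]) auto
  qed
  have int: "(\<lambda>t. t *\<^sub>R DG (p + t *\<^sub>R (x - p))) integrable_on {0..1}" if "x \<in> ?B" for x
    using that seg
    by (intro integrable_continuous_real continuous_intros continuous_on_compose2[OF contDG]) auto
  have app: "blinfun_apply (integral {0..1} (\<lambda>t. t *\<^sub>R DG (p + t *\<^sub>R (x - p)))) =
      (\<lambda>h. integral {0..1} (\<lambda>t. t *\<^sub>R D G (p + t *\<^sub>R (x - p)) h))" if "x \<in> ?B" for x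
  proof
    fix h
    have "blinfun_apply (integral {0..1} (\<lambda>t. t *\<^sub>R DG (p + t *\<^sub>R (x - p)))) h =
      integral {0..1} (\<lambda>t. blinfun_apply (t *\<^sub>R DG (p + t *\<^sub>R (x - p))) h)"
      by (rule blinfun_apply_integral[OF int[OF that]])
    also have "\<dots> = integral {0..1} (\<lambda>t. t *\<^sub>R D G (p + t *\<^sub>R (x - p)) h)"
      by (rule integral_cong) (use seg that DG in \<open>auto simp: blinfun.bilinear_simps\<close>)
    finally show "blinfun_apply (integral {0..1} (\<lambda>t. t *\<^sub>R DG (p + t *\<^sub>R (x - p)))) h = 
      integral {0..1} (\<lambda>t. t *\<^sub>R D G (p + t *\<^sub>R (x - p)) h)" .
  qed
  have JJ: "((\<lambda>x. integral {0..1} (\<lambda>t. G (p + t *\<^sub>R (x - p)))) has_derivative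
          (\<lambda>h. integral {0..1} (\<lambda>t. t *\<^sub>R D G (p + t *\<^sub>R (x - p)) h))) (at x)" if "x \<in> ?B" for x
    using J[OF that] app[OF that] that by (simp add: at_within_open[OF _ open_ball])
  then show "((\<lambda>x. integral {0..1} (\<lambda>t. G (p + t *\<^sub>R (x - p)))) has_derivative
          (\<lambda>h. integral {0..1} (\<lambda>t. t *\<^sub>R D G (p + t *\<^sub>R (x - p)) h))) (at x)" using x .
  have "continuous_on ?B (\<lambda>x. D (\<lambda>x. integral {0..1} (\<lambda>t. G (p + t *\<^sub>R (x - p)))) x h)" for h
  proof -
    have "continuous_on ?B (\<lambda>x. integral (cbox 0 1) (\<lambda>t. t *\<^sub>R D G (p + t *\<^sub>R (x - p)) h))"
    proof (rule integral_continuous_on_param, unfold split_beta, rule continuous_on_scaleR)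
      show "continuous_on (?B \<times> cbox 0 1) (\<lambda>x. D G (p + snd x *\<^sub>R (fst x - p)) h)"
      proof (rule continuous_on_compose2[of ?B "\<lambda>x. D G x h"])
        show "continuous_on ?B (\<lambda>x. D G x h)" using G by simp
      qed (use seg in \<open>auto intro!: continuous_intros\<close>)
    qed (intro continuous_intros)
    then show ?thesis
      by (rule continuous_on_eq) (simp add: D_eqI[OF JJ])
  qed
  then show "Ck_on (Suc 0) ?B (\<lambda>x. integral {0..1} (\<lambda>t. G (p + t *\<^sub>R (x - p))))"
    unfolding Ck_on.simps using JJ differentiableI by blast
qed


text \<open>
  \<open>P\<close> is the primitive of the Poincare lemma, integrating the 1-form \<open>\<alpha>\<close> along the ray from \<open>p\<close>. The
  formula for its derivative is the homotopy formula: \<open>dP\<close> equals \<open>\<alpha>\<close> up to a radial integral of \<open>d\<alpha>\<close>. The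
  boundary term \<open>\<alpha> x h\<close> arises from integrating \<open>d/dt (t \<alpha> h)\<close> along the ray.
\<close>

lemma has_derivative_radial_primitive:
  fixes \<alpha> :: "'a::euclidean_space \<Rightarrow> 'a \<Rightarrow> 'b::euclidean_space"
  assumes lin: "\<And>x. x \<in> ball p r \<Longrightarrow> linear (\<alpha> x)"
    and \<alpha>: "\<And>h. Ck_on (Suc 0) (ball p r) (\<lambda>x. \<alpha> x h)"
  defines "P \<equiv> (\<lambda>x. integral {0..1} (\<lambda>t. \<alpha> (p + t *\<^sub>R (x - p)) (x - p)))"
  shows "Ck_on (Suc 0) (ball p r) P"
    and "x \<in> ball p r \<Longrightarrow> (P has_derivative (\<lambda>h. \<alpha> x h + integral {0..1} (\<lambda>t. t *\<^sub>R
          (D (\<lambda>y. \<alpha> y (x - p)) (p + t *\<^sub>R (x - p)) h - D (\<lambda>y. \<alpha> y h) (p + t *\<^sub>R (x - p)) (x - p))))) (at x)"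
proof -
  let ?B = "ball p r"
  note seg = radial_in_ball[of _ p r]
  define J where "J i x = integral {0..1} (\<lambda>t. \<alpha> (p + t *\<^sub>R (x - p)) i)" for i x
  have cont: "continuous_on {0..1} (\<lambda>t. \<alpha> (p + t *\<^sub>R (x - p)) h)" if "x \<in> ?B" for x h
  proof (rule continuous_on_compose2[of ?B "\<lambda>x. \<alpha> x h"])
    show "continuous_on ?B (\<lambda>x. \<alpha> x h)" using Ck_on_SucD[OF \<alpha>[of h]] by simp
  qed (use seg[OF that] in \<open>auto intro!: continuous_intros\<close>)
  have contD: "continuous_on {0..1} (\<lambda>t. D (\<lambda>y. \<alpha> y h) (p + t *\<^sub>R (x - p)) k)" if "x \<in> ?B" for x h k
  proof (rule continuous_on_compose2[of ?B "\<lambda>x. D (\<lambda>y. \<alpha> y h) x k"])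
    show "continuous_on ?B (\<lambda>x. D (\<lambda>y. \<alpha> y h) x k)" using \<alpha>[of h] by simp
  qed (use seg[OF that] in \<open>auto intro!: continuous_intros\<close>)
  have dalpha: "((\<lambda>y. \<alpha> y h) has_derivative D (\<lambda>y. \<alpha> y h) y) (at y)" if "y \<in> ?B" for y h
    using \<alpha>[of h] that by (intro D_works) simp
  have P_sum: "(\<Sum>i\<in>Basis. ((x - p) \<bullet> i) *\<^sub>R J i x) = P x" if "x \<in> ?B" for x
  proof -
    have "P x = integral {0..1} (\<lambda>t. \<Sum>i\<in>Basis. ((x - p) \<bullet> i) *\<^sub>R \<alpha> (p + t *\<^sub>R (x - p)) i)"
      unfolding P_def by (rule integral_cong) (rule linear_basis_sum[OF lin[OF seg[OF that]]])
    also have "\<dots> = (\<Sum>i\<in>Basis. ((x - p) \<bullet> i) *\<^sub>R J i x)"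
      unfolding J_def using cont[OF that]
      by (subst integral_sum) (auto intro!: integrable_continuous_real continuous_intros)
    finally show ?thesis by simp
  qed
  note J = has_derivative_radial_average[OF \<alpha>, folded J_def]
  have J2: "Ck_on (Suc 0) ?B (J i)" for i
  proof (cases "?B = {}")
    case True
    show ?thesis unfolding True by simp
  next
    case False
    then show ?thesis using J(2) by blast
  qed
  have "Ck_on (Suc 0) ?B (\<lambda>x. \<Sum>i\<in>Basis. ((x - p) \<bullet> i) *\<^sub>R J i x)"
    using smooth_on_diff[OF open_ball smooth_on_id smooth_on_const]
    unfolding smooth_on_def
    by (intro Ck_on_sum open_ball bounded_bilinear.Ck_on_prod[OF bounded_bilinear_scaleR]
       bounded_bilinear.Ck_on_prod[OF bounded_bilinear_inner] Ck_on_const J2) blast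
  then show "Ck_on (Suc 0) ?B P"
    by (rule Ck_on_cong[OF open_ball, rotated]) (rule P_sum)
  assume x: "x \<in> ?B"
  have "((\<lambda>x. \<Sum>i\<in>Basis. ((x - p) \<bullet> i) *\<^sub>R J i x) has_derivative
    (\<lambda>h. \<Sum>i\<in>Basis. ((x - p) \<bullet> i) *\<^sub>R integral {0..1} (\<lambda>t. t *\<^sub>R D (\<lambda>y. \<alpha> y i) (p + t *\<^sub>R (x - p)) h)
          + (h \<bullet> i) *\<^sub>R J i x)) (at x)"
    using J(1)[OF x] by (auto intro!: derivative_eq_intros)
  then have 1: "(P has_derivative
    (\<lambda>h. \<Sum>i\<in>Basis. ((x - p) \<bullet> i) *\<^sub>R integral {0..1} (\<lambda>t. t *\<^sub>R D (\<lambda>y. \<alpha> y i) (p + t *\<^sub>R (x - p)) h)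
          + (h \<bullet> i) *\<^sub>R J i x)) (at x)"
    by (rule has_derivative_transform_within_open[OF _ open_ball x]) (rule P_sum)
  have 2: "(\<Sum>i\<in>Basis. ((x - p) \<bullet> i) *\<^sub>R integral {0..1} (\<lambda>t. t *\<^sub>R D (\<lambda>y. \<alpha> y i) (p + t *\<^sub>R (x - p)) h)
          + (h \<bullet> i) *\<^sub>R J i x) =
    \<alpha> x h + integral {0..1} (\<lambda>t. t *\<^sub>R
          (D (\<lambda>y. \<alpha> y (x - p)) (p + t *\<^sub>R (x - p)) h - D (\<lambda>y. \<alpha> y h) (p + t *\<^sub>R (x - p)) (x - p)))"
    for h
  proof -
    let ?y = "\<lambda>t. p + t *\<^sub>R (x - p)"
    have D1: "D (\<lambda>y. \<alpha> y k) (?y t) h = (\<Sum>i\<in>Basis. (k \<bullet> i) *\<^sub>R D (\<lambda>y. \<alpha> y i) (?y t) h)" if "t \<in> {0..1}" for t k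
    proof -
      have "((\<lambda>y. \<Sum>i\<in>Basis. (k \<bullet> i) *\<^sub>R \<alpha> y i) has_derivative
         (\<lambda>h. \<Sum>i\<in>Basis. (k \<bullet> i) *\<^sub>R D (\<lambda>y. \<alpha> y i) (?y t) h)) (at (?y t))"
        by (intro derivative_intros dalpha seg[OF x that])
      then have "((\<lambda>y. \<alpha> y k) has_derivative
         (\<lambda>h. \<Sum>i\<in>Basis. (k \<bullet> i) *\<^sub>R D (\<lambda>y. \<alpha> y i) (?y t) h)) (at (?y t))"
        by (rule has_derivative_transform_within_open[OF _ open_ball seg[OF x that]])
          (rule linear_basis_sum[OF lin, symmetric])
      then show ?thesis by (simp add: D_eqI)
    qed
    have "(\<Sum>i\<in>Basis. ((x - p) \<bullet> i) *\<^sub>R integral {0..1} (\<lambda>t. t *\<^sub>R D (\<lambda>y. \<alpha> y i) (?y t) h)) =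
      integral {0..1} (\<lambda>t. \<Sum>i\<in>Basis. ((x - p) \<bullet> i) *\<^sub>R t *\<^sub>R D (\<lambda>y. \<alpha> y i) (?y t) h)"
      unfolding integral_cmul[symmetric]
      by (rule integral_sum[symmetric])
        (auto intro!: integrable_continuous_real continuous_intros contD[OF x])
    also have "\<dots> = integral {0..1} (\<lambda>t. t *\<^sub>R D (\<lambda>y. \<alpha> y (x - p)) (?y t) h)"
      by (rule integral_cong) (simp only: D1[of _ "x - p"] scaleR_sum_right scaleR_left_commute)
    finally have A: "(\<Sum>i\<in>Basis. ((x - p) \<bullet> i) *\<^sub>R integral {0..1} (\<lambda>t. t *\<^sub>R D (\<lambda>y. \<alpha> y i) (?y t) h)) =
      integral {0..1} (\<lambda>t. t *\<^sub>R D (\<lambda>y. \<alpha> y (x - p)) (?y t) h)" .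
    have "(\<Sum>i\<in>Basis. (h \<bullet> i) *\<^sub>R J i x) = integral {0..1} (\<lambda>t. \<Sum>i\<in>Basis. (h \<bullet> i) *\<^sub>R \<alpha> (?y t) i)"
      unfolding J_def using cont[OF x]
      by (subst integral_sum) (auto intro!: integrable_continuous_real continuous_intros)
    also have "\<dots> = integral {0..1} (\<lambda>t. \<alpha> (?y t) h)"
      by (rule integral_cong) (rule linear_basis_sum[OF lin[OF seg[OF x]], symmetric])
    finally have B: "(\<Sum>i\<in>Basis. (h \<bullet> i) *\<^sub>R J i x) = integral {0..1} (\<lambda>t. \<alpha> (?y t) h)" .
    have "((\<lambda>t. t *\<^sub>R D (\<lambda>y. \<alpha> y h) (?y t) (x - p) + \<alpha> (?y t) h) has_integral
       (1 *\<^sub>R \<alpha> (?y 1) h - 0 *\<^sub>R \<alpha> (?y 0) h)) {0..1}"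
    proof (rule fundamental_theorem_of_calculus)
      fix t :: real assume t: "t \<in> {0..1}"
      have dif: "(\<lambda>y. \<alpha> y h) differentiable at (?y t)"
        using dalpha[OF seg[OF x t]] differentiable_def by blast
      have 3: "((\<lambda>t. \<alpha> (?y t) h) has_vector_derivative D (\<lambda>y. \<alpha> y h) (?y t) (x - p)) (at t within {0..1})"
        using has_vector_derivative_along_line[OF dif] by (rule has_vector_derivative_at_within)
      show "((\<lambda>t. t *\<^sub>R \<alpha> (?y t) h) has_vector_derivative
         t *\<^sub>R D (\<lambda>y. \<alpha> y h) (?y t) (x - p) + \<alpha> (?y t) h) (at t within {0..1})"
        using has_vector_derivative_scaleR[OF DERIV_ident 3] by simp
    qed simp
    then have "integral {0..1} (\<lambda>t. t *\<^sub>R D (\<lambda>y. \<alpha> y h) (?y t) (x - p) + \<alpha> (?y t) h) = \<alpha> x h"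
      by (simp add: integral_unique)
    moreover have "integral {0..1} (\<lambda>t. t *\<^sub>R D (\<lambda>y. \<alpha> y h) (?y t) (x - p) + \<alpha> (?y t) h) =
      integral {0..1} (\<lambda>t. t *\<^sub>R D (\<lambda>y. \<alpha> y h) (?y t) (x - p)) + integral {0..1} (\<lambda>t. \<alpha> (?y t) h)"
      using cont[OF x] contD[OF x]
      by (intro integral_add integrable_continuous_real continuous_intros)
    moreover have "integral {0..1} (\<lambda>t. t *\<^sub>R (D (\<lambda>y. \<alpha> y (x - p)) (?y t) h - D (\<lambda>y. \<alpha> y h) (?y t) (x - p)))
      = integral {0..1} (\<lambda>t. t *\<^sub>R D (\<lambda>y. \<alpha> y (x - p)) (?y t) h)
        - integral {0..1} (\<lambda>t. t *\<^sub>R D (\<lambda>y. \<alpha> y h) (?y t) (x - p))"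
      by (rule trans[OF integral_cong integral_diff], rule scaleR_diff_right)
        (intro integrable_continuous_real continuous_intros contD[OF x])+
    ultimately show ?thesis unfolding sum.distrib A B by (simp add: algebra_simps)
  qed
  show "(P has_derivative (\<lambda>h. \<alpha> x h + integral {0..1} (\<lambda>t. t *\<^sub>R
          (D (\<lambda>y. \<alpha> y (x - p)) (p + t *\<^sub>R (x - p)) h - D (\<lambda>y. \<alpha> y h) (p + t *\<^sub>R (x - p)) (x - p))))) (at x)"
    using 1 unfolding 2 .
qed


section \<open>The Frobenius theorem for linear systems\<close>

lemma bilinear_expand:
  fixes B :: "'a::euclidean_space \<Rightarrow> 'w::euclidean_space \<Rightarrow> 'c::real_vector"
  assumes "\<And>w. linear (\<lambda>h. B h w)" "\<And>h. linear (B h)"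
  shows "B h w = (\<Sum>i\<in>Basis. \<Sum>j\<in>Basis. ((h \<bullet> i) * (w \<bullet> j)) *\<^sub>R B i j)"
  by (subst linear_basis_sum[OF assms(1)], subst linear_basis_sum[OF assms(2)])
    (simp add: scaleR_sum_right)

lemma compact_bilinear_bound:
  fixes A :: "'a::euclidean_space \<Rightarrow> 'b::euclidean_space \<Rightarrow> 'w::euclidean_space \<Rightarrow> 'c::real_normed_vector"
  assumes C: "compact C"
    and linh: "\<And>x w. x \<in> C \<Longrightarrow> linear (\<lambda>h. A x h w)"
    and linw: "\<And>x h. x \<in> C \<Longrightarrow> linear (A x h)"
    and cont: "\<And>h w. continuous_on C (\<lambda>x. A x h w)"
  obtains K where "K > 0" "\<And>x h w. x \<in> C \<Longrightarrow> norm (A x h w) \<le> K * norm h * norm w"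
proof -
  let ?s = "\<lambda>x. \<Sum>i\<in>Basis. \<Sum>j\<in>Basis. norm (A x i j)"
  have "bounded (?s ` C)"
    by (intro compact_imp_bounded compact_continuous_image C continuous_on_sum continuous_on_norm cont)
  then obtain K where K: "K > 0" "\<And>x. x \<in> C \<Longrightarrow> norm (?s x) \<le> K"
    unfolding bounded_pos by blast
  have "norm (A x h w) \<le> K * norm h * norm w" if x: "x \<in> C" for x h w
  proof -
    have "norm (A x h w) = norm (\<Sum>i\<in>Basis. \<Sum>j\<in>Basis. ((h \<bullet> i) * (w \<bullet> j)) *\<^sub>R A x i j)"
      by (subst bilinear_expand[OF linh[OF x] linw[OF x]]) simp
    also have "\<dots> \<le> (\<Sum>i\<in>Basis. \<Sum>j\<in>Basis. norm (((h \<bullet> i) * (w \<bullet> j)) *\<^sub>R A x i j))"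
      by (intro order_trans[OF norm_sum] sum_mono norm_sum)
    also have "\<dots> \<le> (\<Sum>i\<in>Basis. \<Sum>j\<in>Basis. (norm h * norm w) * norm (A x i j))"
      by (intro sum_mono) (auto simp: abs_mult Basis_le_norm intro!: mult_right_mono mult_mono)
    also have "\<dots> = ?s x * (norm h * norm w)" by (simp add: sum_distrib_left mult.commute)
    also have "\<dots> \<le> K * (norm h * norm w)" using K(2)[OF x] by (intro mult_right_mono) auto
    finally show ?thesis by (simp add: mult.assoc)
  qed
  then show ?thesis using K(1) that by blast
qed

text \<open>
  The system is \<open>DF h = A h F\<close>, and \<open>compat\<close> is the symmetry in \<open>h\<close>, \<open>k\<close> of the second derivative that it
  prescribes. Let \<open>e\<^sub>n\<close> be the Picard iterates along rays from \<open>p\<close>, so \<open>e\<^sub>n\<^sub>+\<^sub>1\<close> is \<open>w\<^sub>0\<close> plus the radial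
  primitive of the 1-form \<open>A e\<^sub>n\<close>, and let \<open>\<rho>\<^sub>n = De\<^sub>n - A e\<^sub>n\<close> be their defect. By the homotopy formula
  \<open>De\<^sub>n\<^sub>+\<^sub>1 - A e\<^sub>n\<close> is a radial integral of \<open>d(A e\<^sub>n)\<close>, and \<open>compat\<close> cancels from it everything except terms
  linear in \<open>\<rho>\<^sub>n\<close>. On a small ball both \<open>e\<^sub>n\<^sub>+\<^sub>1 - e\<^sub>n\<close> and \<open>\<rho>\<^sub>n\<close> therefore decay geometrically, so
  \<open>e\<^sub>n\<close> converges together with its derivatives to a solution. The radius depends on \<open>A\<close> only, so it
  serves all initial values.
\<close>

theorem frobenius_linear:
  fixes A :: "'a::euclidean_space \<Rightarrow> 'a \<Rightarrow> 'w::euclidean_space \<Rightarrow> 'w"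
  assumes S: "open S" "p \<in> S"
    and linh: "\<And>x w. x \<in> S \<Longrightarrow> linear (\<lambda>h. A x h w)"
    and linw: "\<And>x h. x \<in> S \<Longrightarrow> linear (A x h)"
    and sm: "\<And>h w. smooth_on S (\<lambda>x. A x h w)"
    and compat: "\<And>x h k w. x \<in> S \<Longrightarrow>
      D (\<lambda>y. A y h w) x k + A x h (A x k w) = D (\<lambda>y. A y k w) x h + A x k (A x h w)"
  obtains r where "r > 0" "ball p r \<subseteq> S"
    "\<And>w0. \<exists>F. F p = w0 \<and> smooth_on (ball p r) F \<and>
        (\<forall>x\<in>ball p r. (F has_derivative (\<lambda>h. A x h (F x))) (at x))"
proof -
  obtain r0 where r0: "r0 > 0" "cball p r0 \<subseteq> S" using S open_contains_cball by blast
  obtain K where K: "K > 0" "\<And>x h w. x \<in> cball p r0 \<Longrightarrow> norm (A x h w) \<le> K * norm h * norm w"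
  proof (rule compact_bilinear_bound[of "cball p r0" A])
    show "continuous_on (cball p r0) (\<lambda>x. A x h w)" for h w
      using smooth_on_continuous[OF sm] r0 continuous_on_subset by blast
  qed (use r0 linh linw in auto)
  \<comment> \<open>\<open>K * r \<le> 1/4\<close> makes the iteration contract by \<open>1/4\<close> and leaves the defect a factor \<open>1/2\<close>.\<close>
  define r where "r = min r0 (1 / (4 * K))"
  have r: "r > 0" "r \<le> r0" "K * r \<le> 1/4" using r0 K(1) by (auto simp: r_def min_def field_simps)
  let ?B = "ball p r"
  have BS: "?B \<subseteq> S" using r r0 by (auto intro: order_trans)
  have AK: "norm (A x h w) \<le> K * norm h * norm w" if "x \<in> ?B" for x h w
    using K(2)[of x] that r by auto
  have kr: "norm (x - p) \<le> r" if "x \<in> ?B" for x using that by (simp add: dist_norm norm_minus_commute)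
  note seg = radial_in_ball[of _ p r]
  have smB: "smooth_on ?B (\<lambda>x. A x h w)" for h w using smooth_on_subset[OF sm BS] .
  have CkA: "Ck_on k ?B (\<lambda>x. A x h (e x))" if "Ck_on k ?B e" for k e h
  proof (rule Ck_on_cong[OF open_ball])
    show "Ck_on k ?B (\<lambda>x. \<Sum>j\<in>Basis. (e x \<bullet> j) *\<^sub>R A x h j)"
      using smB that unfolding smooth_on_def
      by (intro Ck_on_sum open_ball bounded_bilinear.Ck_on_prod[OF bounded_bilinear_scaleR]
        bounded_bilinear.Ck_on_prod[OF bounded_bilinear_inner] Ck_on_const) auto
    show "(\<Sum>j\<in>Basis. (e x \<bullet> j) *\<^sub>R A x h j) = A x h (e x)" if "x \<in> ?B" for x
      using linear_basis_sum[OF linw, of x h "e x"] that BS by auto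
  qed
  have sol: "\<exists>F. F p = w0 \<and> smooth_on ?B F \<and> (\<forall>x\<in>?B. (F has_derivative (\<lambda>h. A x h (F x))) (at x))" for w0
  proof -
    define M where "M = norm w0"
    have M: "M \<ge> 0" by (simp add: M_def)
    define P where "P e x = integral {0..1} (\<lambda>t. A (p + t *\<^sub>R (x - p)) (x - p) (e (p + t *\<^sub>R (x - p))))"
      for e :: "'a \<Rightarrow> 'w" and x
    define e where "e n = ((\<lambda>e x. w0 + P e x) ^^ n) (\<lambda>x. w0)" for n
    have e0: "e 0 = (\<lambda>x. w0)" and eS: "e (Suc n) = (\<lambda>x. w0 + P (e n) x)" for n
      by (simp_all add: e_def)
    have e1: "Ck_on (Suc 0) ?B (e n)" for n
    proof (induction n)
      case 0 then show ?case unfolding e0 by (rule Ck_on_const)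
    next
      case (Suc n)
      have "Ck_on (Suc 0) ?B (P (e n))" unfolding P_def
        by (rule has_derivative_radial_primitive(1)[where \<alpha>="\<lambda>y h. A y h (e n y)"])
          (use linh BS CkA[OF Suc] in auto)
      then show ?case unfolding eS by (intro Ck_on_add open_ball Ck_on_const)
    qed
    have ed: "(e n has_derivative D (e n) x) (at x)" if "x \<in> ?B" for x n
      using e1[of n] that by (intro D_works) simp
    have ce: "continuous_on {0..1} (\<lambda>t. A (p + t *\<^sub>R (x - p)) h (f (p + t *\<^sub>R (x - p))))"
      if "x \<in> ?B" "continuous_on ?B f" for x h and f :: "'a \<Rightarrow> 'w"
    proof (rule continuous_on_compose2[of ?B "\<lambda>y. A y h (f y)"])
      show "continuous_on ?B (\<lambda>y. A y h (f y))" using CkA[of 0 f] that by simp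
    qed (use seg[OF that(1)] in \<open>auto intro!: continuous_intros\<close>)
    have ec: "continuous_on ?B (e n)" for n using Ck_on_SucD[OF e1[of n]] by simp
    have delta: "norm (e (Suc n) x - e n x) \<le> M * (1/4)^n" if "x \<in> ?B" for n x
      using that
    proof (induction n arbitrary: x)
      case 0
      have "norm (P (e 0) x) \<le> M * (1 - 0)" unfolding P_def
      proof (rule integral_bound)
        fix t :: real assume t: "t \<in> {0..1}"
        have "norm (A (p + t *\<^sub>R (x - p)) (x - p) w0) \<le> K * norm (x - p) * norm w0"
          using AK[OF seg[OF 0 t]] .
        also have "\<dots> \<le> K * r * norm w0" using kr[OF 0] K(1) by (intro mult_right_mono mult_left_mono) auto
        also have "\<dots> \<le> 1 * M" unfolding M_def using r by (intro mult_right_mono) auto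
        finally show "norm (A (p + t *\<^sub>R (x - p)) (x - p) (e 0 (p + t *\<^sub>R (x - p)))) \<le> M" by (simp add: e0)
      qed (use ce[OF 0 ec] in auto)
      then show ?case by (simp add: eS e0)
    next
      case (Suc n)
      have "e (Suc (Suc n)) x - e (Suc n) x = P (e (Suc n)) x - P (e n) x" by (simp add: eS)
      also have "\<dots> = integral {0..1} (\<lambda>t. A (p + t *\<^sub>R (x - p)) (x - p)
            (e (Suc n) (p + t *\<^sub>R (x - p)) - e n (p + t *\<^sub>R (x - p))))"
        unfolding P_def
          integral_diff[OF integrable_continuous_real[OF ce[OF Suc.prems ec]]
            integrable_continuous_real[OF ce[OF Suc.prems ec]], symmetric]
        by (rule integral_cong) (use seg[OF Suc.prems] BS linw in \<open>auto simp: linear_diff subset_eq\<close>)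
      also have "norm \<dots> \<le> (M * (1/4)^Suc n) * (1 - 0)"
      proof (rule integral_bound)
        fix t :: real assume t: "t \<in> {0..1}"
        let ?y = "p + t *\<^sub>R (x - p)"
        have "norm (A ?y (x - p) (e (Suc n) ?y - e n ?y)) \<le> K * norm (x - p) * norm (e (Suc n) ?y - e n ?y)"
          using AK[OF seg[OF Suc.prems t]] .
        also have "\<dots> \<le> (1/4) * (M * (1/4)^n)"
        proof (rule mult_mono)
          have "K * norm (x - p) \<le> K * r" using kr[OF Suc.prems] K(1) by simp
          then show "K * norm (x - p) \<le> 1/4" using r by simp
        qed (use Suc.IH[OF seg[OF Suc.prems t]] K in auto)
        finally show "norm (A ?y (x - p) (e (Suc n) ?y - e n ?y)) \<le> M * (1/4)^Suc n" by simp
      qed (use ce[OF Suc.prems continuous_on_diff[OF ec ec]] in auto)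
      finally show ?case by simp
    qed
    \<comment> \<open>The bracketed differences are the defect \<open>\<rho>\<^sub>n\<close>; \<open>compat\<close> removes all other terms.\<close>
    have step: "D (e (Suc n)) x h = A x h (e n x) + integral {0..1} (\<lambda>t. t *\<^sub>R
       (A (p + t *\<^sub>R (x - p)) (x - p) (D (e n) (p + t *\<^sub>R (x - p)) h - A (p + t *\<^sub>R (x - p)) h (e n (p + t *\<^sub>R (x - p))))
       - A (p + t *\<^sub>R (x - p)) h (D (e n) (p + t *\<^sub>R (x - p)) (x - p)
            - A (p + t *\<^sub>R (x - p)) (x - p) (e n (p + t *\<^sub>R (x - p))))))" if x: "x \<in> ?B" for n x h
    proof -
      have "(P (e n) has_derivative (\<lambda>h. A x h (e n x) + integral {0..1} (\<lambda>t. t *\<^sub>R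
          (D (\<lambda>y. A y (x - p) (e n y)) (p + t *\<^sub>R (x - p)) h
            - D (\<lambda>y. A y h (e n y)) (p + t *\<^sub>R (x - p)) (x - p))))) (at x)"
        unfolding P_def
        by (rule has_derivative_radial_primitive(2)[where \<alpha>="\<lambda>y h. A y h (e n y)", OF _ _ x])
          (use linh BS CkA[OF e1] in auto)
      from has_derivative_add[OF has_derivative_const this, of w0]
      have "D (e (Suc n)) x h = A x h (e n x) + integral {0..1} (\<lambda>t. t *\<^sub>R
          (D (\<lambda>y. A y (x - p) (e n y)) (p + t *\<^sub>R (x - p)) h
            - D (\<lambda>y. A y h (e n y)) (p + t *\<^sub>R (x - p)) (x - p)))"
        unfolding eS by (simp add: D_eqI)
      also have "integral {0..1} (\<lambda>t. t *\<^sub>R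
          (D (\<lambda>y. A y (x - p) (e n y)) (p + t *\<^sub>R (x - p)) h
            - D (\<lambda>y. A y h (e n y)) (p + t *\<^sub>R (x - p)) (x - p)))
       = integral {0..1} (\<lambda>t. t *\<^sub>R
       (A (p + t *\<^sub>R (x - p)) (x - p) (D (e n) (p + t *\<^sub>R (x - p)) h - A (p + t *\<^sub>R (x - p)) h (e n (p + t *\<^sub>R (x - p))))
       - A (p + t *\<^sub>R (x - p)) h (D (e n) (p + t *\<^sub>R (x - p)) (x - p)
            - A (p + t *\<^sub>R (x - p)) (x - p) (e n (p + t *\<^sub>R (x - p))))))"
      proof (rule integral_cong)
        fix t :: real assume t: "t \<in> {0..1}"
        define y where "y = p + t *\<^sub>R (x - p)"
        have y: "y \<in> ?B" "y \<in> S" using seg[OF x t] BS by (auto simp: y_def)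
        have DA: "D (\<lambda>y. A y k (e n y)) y v = D (\<lambda>z. A z k (e n y)) y v + A y k (D (e n) y v)" for k v
        proof -
          have "((\<lambda>x. A x k (e n x)) has_derivative
              (\<lambda>v. D (\<lambda>z. A z k (e n y)) y v + A y k (D (e n) y v))) (at y)"
            by (rule has_derivative_family_apply[OF open_ball y(1)])
              (use linw BS smooth_on_differentiable[OF smB y(1)] differentiableI[OF ed[OF y(1)]] in auto)
          then show ?thesis by (simp add: D_eqI)
        qed
        show "t *\<^sub>R (D (\<lambda>y. A y (x - p) (e n y)) (p + t *\<^sub>R (x - p)) h
            - D (\<lambda>y. A y h (e n y)) (p + t *\<^sub>R (x - p)) (x - p)) = t *\<^sub>R
       (A (p + t *\<^sub>R (x - p)) (x - p) (D (e n) (p + t *\<^sub>R (x - p)) h - A (p + t *\<^sub>R (x - p)) h (e n (p + t *\<^sub>R (x - p))))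
       - A (p + t *\<^sub>R (x - p)) h (D (e n) (p + t *\<^sub>R (x - p)) (x - p)
            - A (p + t *\<^sub>R (x - p)) (x - p) (e n (p + t *\<^sub>R (x - p)))))"
          unfolding y_def[symmetric] DA
          by (rule arg_cong[where f="scaleR t"])
            (use compat[OF y(2), of "x - p" "e n y" h] linw[OF y(2)] in
              \<open>simp add: linear_diff algebra_simps\<close>)
      qed
      finally show ?thesis .
    qed
    \<comment> \<open>With this \<open>C\<close> the source term \<open>K M / 4\<^sup>n\<close> is at most a quarter of the bound, so that a defect factor
      \<open>1/2 + 1/4 = 3/4\<close> per step is sustained.\<close>
    define C where "C = 4 * K * M"
    have C: "C \<ge> 0" using M K by (simp add: C_def)
    have rho: "norm (D (e n) x h - A x h (e n x)) \<le> C * (3/4)^n * norm h" if "x \<in> ?B" for n x h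
      using that
    proof (induction n arbitrary: x h)
      case 0
      have "D (e 0) x h = 0" by (simp add: e0 frechet_derivative_const)
      moreover have "norm (A x h w0) \<le> K * norm h * M" using AK[OF 0] by (simp add: M_def)
      moreover have "K * norm h * M \<le> C * norm h" using K(1) M by (simp add: C_def)
      ultimately show ?case by (simp add: e0)
    next
      case (Suc n)
      let ?y = "\<lambda>t. p + t *\<^sub>R (x - p)"
      let ?R = "C * (3/4)^n"
      let ?\<rho> = "\<lambda>y h. D (e n) y h - A y h (e n y)"
      have R: "?R \<ge> 0" using C by simp
      have cr: "continuous_on ?B (\<lambda>y. ?\<rho> y h)" for h
        using e1[of n] CkA[of 0 "e n" h] ec by (intro continuous_on_diff) auto
      have "norm (integral {0..1} (\<lambda>t. t *\<^sub>R (A (?y t) (x - p) (?\<rho> (?y t) h) - A (?y t) h (?\<rho> (?y t) (x - p)))))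
         \<le> (?R / 2 * norm h) * (1 - 0)"
      proof (rule integral_bound)
        show "continuous_on {0..1} (\<lambda>t. t *\<^sub>R (A (?y t) (x - p) (?\<rho> (?y t) h) - A (?y t) h (?\<rho> (?y t) (x - p))))"
          by (intro continuous_on_scaleR continuous_on_diff continuous_on_id ce[OF Suc.prems cr])
        fix t :: real assume t: "t \<in> {0..1}"
        have y: "?y t \<in> ?B" using seg[OF Suc.prems t] .
        have "norm (t *\<^sub>R (A (?y t) (x - p) (?\<rho> (?y t) h) - A (?y t) h (?\<rho> (?y t) (x - p)))) \<le>
          1 * norm (A (?y t) (x - p) (?\<rho> (?y t) h) - A (?y t) h (?\<rho> (?y t) (x - p)))"
          unfolding norm_scaleR using t by (intro mult_right_mono) auto
        also have "\<dots> \<le> norm (A (?y t) (x - p) (?\<rho> (?y t) h)) + norm (A (?y t) h (?\<rho> (?y t) (x - p)))"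
          using norm_triangle_ineq4 by simp
        also have "\<dots> \<le> (K * r) * ?R * norm h + (K * r) * ?R * norm h"
        proof (rule add_mono)
          have "norm (A (?y t) (x - p) (?\<rho> (?y t) h)) \<le> K * norm (x - p) * norm (?\<rho> (?y t) h)"
            using AK[OF y] .
          also have "\<dots> \<le> (K * r) * (?R * norm h)"
            using K(1) r(1) kr[OF Suc.prems] by (intro mult_mono Suc.IH[OF y]) auto
          finally show "norm (A (?y t) (x - p) (?\<rho> (?y t) h)) \<le> (K * r) * ?R * norm h" by (simp add: mult.assoc)
          have "norm (A (?y t) h (?\<rho> (?y t) (x - p))) \<le> K * norm h * norm (?\<rho> (?y t) (x - p))"
            using AK[OF y] .
          also have "\<dots> \<le> K * norm h * (?R * r)"
            using K(1) Suc.IH[OF y, of "x - p"] mult_left_mono[OF kr[OF Suc.prems] R]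
            by (intro mult_left_mono) auto
          finally show "norm (A (?y t) h (?\<rho> (?y t) (x - p))) \<le> (K * r) * ?R * norm h"
            by (simp add: algebra_simps)
        qed
        also have "\<dots> = 2 * (K * r) * (?R * norm h)" by simp
        also have "\<dots> \<le> 2 * (1/4) * (?R * norm h)"
          using r(3) R by (intro mult_right_mono) auto
        finally show "norm (t *\<^sub>R (A (?y t) (x - p) (?\<rho> (?y t) h) - A (?y t) h (?\<rho> (?y t) (x - p)))) \<le> ?R / 2 * norm h"
          by simp
      qed simp
      then have 1: "norm (D (e (Suc n)) x h - A x h (e n x)) \<le> ?R / 2 * norm h"
        by (simp add: step[OF Suc.prems])
      have "A x h (e n x) - A x h (e (Suc n) x) = A x h (e n x - e (Suc n) x)"
        using linw[of x h] Suc.prems BS by (auto simp: linear_diff)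
      then have "norm (A x h (e n x) - A x h (e (Suc n) x)) \<le> K * norm h * norm (e n x - e (Suc n) x)"
        using AK[OF Suc.prems, of h] by simp
      also have "\<dots> \<le> K * norm h * (M * (1/4)^n)"
        using delta[OF Suc.prems, of n] K(1) by (intro mult_left_mono) (auto simp: norm_minus_commute)
      also have "\<dots> = C / 4 * (1/4)^n * norm h" by (simp add: C_def)
      also have "\<dots> \<le> C / 4 * (3/4)^n * norm h"
        using C by (intro mult_right_mono mult_left_mono power_mono) auto
      finally have 2: "norm (A x h (e n x) - A x h (e (Suc n) x)) \<le> C / 4 * (3/4)^n * norm h" .
      have "norm (D (e (Suc n)) x h - A x h (e (Suc n) x)) \<le>
          norm (D (e (Suc n)) x h - A x h (e n x)) + norm (A x h (e n x) - A x h (e (Suc n) x))"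
        using norm_triangle_ineq[of "D (e (Suc n)) x h - A x h (e n x)" "A x h (e n x) - A x h (e (Suc n) x)"]
        by simp
      then have "norm (D (e (Suc n)) x h - A x h (e (Suc n) x)) \<le> ?R / 2 * norm h + C / 4 * (3/4)^n * norm h"
        using 1 2 by linarith
      also have "\<dots> = C * (3/4)^Suc n * norm h" by (simp add: field_simps)
      finally show ?case .
    qed
    have tele: "norm (e (n + j) x - e n x) \<le> 2 * M * ((1/4)^n - (1/4)^(n+j))" if x: "x \<in> ?B" for x n j
    proof (induction j)
      case (Suc j)
      have "norm (e (n + Suc j) x - e n x) \<le> norm (e (Suc (n + j)) x - e (n + j) x) + norm (e (n + j) x - e n x)"
        using norm_triangle_ineq[of "e (Suc (n + j)) x - e (n + j) x" "e (n + j) x - e n x"] by simp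
      also have "\<dots> \<le> M * (1/4)^(n + j) + 2 * M * ((1/4)^n - (1/4)^(n+j))"
        using delta[OF x] Suc by (intro add_mono)
      also have "\<dots> \<le> 2 * M * ((1/4)^n - (1/4)^(n + Suc j))"
        using mult_nonneg_nonneg[OF M, of "(1/4)^(n+j)"] by (simp add: algebra_simps)
      finally show ?case .
    qed simp
    have tele': "norm (e m x - e n x) \<le> 2 * M * (1/4)^n" if "x \<in> ?B" "n \<le> m" for x n m
    proof -
      have "norm (e m x - e n x) \<le> 2 * M * ((1/4)^n - (1/4)^m)" using tele[OF that(1), of n "m - n"] that by simp
      also have "\<dots> \<le> 2 * M * (1/4)^n" using M by (intro mult_left_mono) auto
      finally show ?thesis .
    qed
    have pw: "(\<lambda>n. c * (1/4::real)^n) \<longlonglongrightarrow> 0" "(\<lambda>n. c * (3/4::real)^n) \<longlonglongrightarrow> 0" for c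
      using tendsto_mult_left[OF LIMSEQ_realpow_zero[of "1/4::real"], of c]
        tendsto_mult_left[OF LIMSEQ_realpow_zero[of "3/4::real"], of c] by simp_all
    have "\<exists>l. (\<lambda>n. e n x) \<longlonglongrightarrow> l" if x: "x \<in> ?B" for x
    proof -
      have "Cauchy (\<lambda>n. e n x)"
      proof (rule CauchyI')
        fix \<epsilon> :: real assume "\<epsilon> > 0"
        then have "\<forall>\<^sub>F N in sequentially. 2 * M * (1/4)^N < \<epsilon>/2"
          by (intro order_tendstoD(2)[OF pw(1)]) auto
        then obtain N where N: "2 * M * (1/4)^N < \<epsilon>/2"
          using eventually_happens by fastforce
        have "dist (e m x) (e n x) < \<epsilon>" if "m \<ge> N" "n > m" for m n
        proof -
          have "norm (e m x - e N x) < \<epsilon>/2" "norm (e n x - e N x) < \<epsilon>/2"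
            using tele'[OF x, of N m] tele'[OF x, of N n] that N by linarith+
          then show ?thesis using dist_triangle2[of "e m x" "e n x" "e N x"] by (simp add: dist_norm)
        qed
        then show "\<exists>M. \<forall>m\<ge>M. \<forall>n>m. dist (e m x) (e n x) < \<epsilon>" by blast
      qed
      then show ?thesis by (simp add: Cauchy_convergent_iff convergent_def)
    qed
    then obtain E where E: "\<And>x. x \<in> ?B \<Longrightarrow> (\<lambda>n. e n x) \<longlonglongrightarrow> E x" by metis
    have Eb: "norm (e n x - E x) \<le> 2 * M * (1/4)^n" if x: "x \<in> ?B" for x n
    proof -
      have "(\<lambda>m. norm (e m x - e n x)) \<longlonglongrightarrow> norm (E x - e n x)"
        by (intro tendsto_intros E x)
      then have "norm (E x - e n x) \<le> 2 * M * (1/4)^n"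
        by (rule tendsto_upperbound) (use tele'[OF x] eventually_sequentially in auto)
      then show ?thesis by (simp add: norm_minus_commute)
    qed
    have pB: "p \<in> ?B" using r by simp
    have "\<exists>g. \<forall>x\<in>?B. (\<lambda>n. e n x) \<longlonglongrightarrow> g x \<and> (g has_derivative (\<lambda>h. A x h (E x))) (at x within ?B)"
    proof (rule has_derivative_sequence[where f=e and f'="\<lambda>n x. D (e n) x", OF convex_ball _ _ pB E[OF pB]])
      show "(e n has_derivative D (e n) x) (at x within ?B)" if "x \<in> ?B" for n x
        using ed[OF that] has_derivative_at_withinI by blast
      fix \<epsilon> :: real assume eps: "\<epsilon> > 0"
      have "(\<lambda>n. C * (3/4)^n + K * (2 * M) * (1/4)^n) \<longlonglongrightarrow> 0 + 0" by (intro tendsto_add pw)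
      then have "\<forall>\<^sub>F n in sequentially. C * (3/4)^n + K * (2 * M) * (1/4)^n < \<epsilon>"
        using eps by (intro order_tendstoD) auto
      then show "\<forall>\<^sub>F n in sequentially. \<forall>x\<in>?B. \<forall>h. norm (D (e n) x h - A x h (E x)) \<le> \<epsilon> * norm h"
      proof eventually_elim
        case (elim n)
        show ?case
        proof (intro ballI allI)
          fix x h assume x: "x \<in> ?B"
          have "A x h (e n x) - A x h (E x) = A x h (e n x - E x)"
            using linw[of x h] x BS by (auto simp: linear_diff)
          then have "norm (A x h (e n x) - A x h (E x)) \<le> K * norm h * norm (e n x - E x)"
            using AK[OF x, of h] by simp
          also have "\<dots> \<le> K * norm h * (2 * M * (1/4)^n)"
            using Eb[OF x] K(1) by (intro mult_left_mono) auto
          finally have "norm (A x h (e n x) - A x h (E x)) \<le> K * norm h * (2 * M * (1/4)^n)" .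
          then have "norm (D (e n) x h - A x h (E x)) \<le> C * (3/4)^n * norm h + K * norm h * (2 * M * (1/4)^n)"
            using rho[OF x, of n h] norm_triangle_ineq[of "D (e n) x h - A x h (e n x)" "A x h (e n x) - A x h (E x)"]
            by simp
          also have "\<dots> = (C * (3/4)^n + K * (2 * M) * (1/4)^n) * norm h" by (simp add: algebra_simps)
          also have "\<dots> \<le> \<epsilon> * norm h" using elim by (intro mult_right_mono) auto
          finally show "norm (D (e n) x h - A x h (E x)) \<le> \<epsilon> * norm h" .
        qed
      qed
    qed
    then obtain g where g: "\<And>x. x \<in> ?B \<Longrightarrow> (\<lambda>n. e n x) \<longlonglongrightarrow> g x"
      "\<And>x. x \<in> ?B \<Longrightarrow> (g has_derivative (\<lambda>h. A x h (E x))) (at x within ?B)" by blast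
    have gE: "g x = E x" if "x \<in> ?B" for x using LIMSEQ_unique[OF g(1) E] that by blast
    have gd: "(g has_derivative (\<lambda>h. A x h (g x))) (at x)" if "x \<in> ?B" for x
      using g(2)[OF that] gE[OF that] that by (simp add: at_within_open[OF _ open_ball])
    have "e n p = w0" for n
    proof (cases n)
      case (Suc m)
      have "P (e m) p = integral {0..1} (\<lambda>t::real. 0)"
        unfolding P_def by (rule integral_cong) (use linear_0[OF linh[OF S(2)]] in simp)
      then show ?thesis unfolding Suc eS by simp
    qed (simp add: e0)
    then have gp: "g p = w0" using g(1)[OF pB] by (simp add: LIMSEQ_const_iff)
    \<comment> \<open>The equation \<open>D g h = A h g\<close> raises the regularity of \<open>g\<close> by one order at a time.\<close>
    have "Ck_on k ?B g" for k
    proof (induction k)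
      case 0
      show ?case using has_derivative_continuous[OF gd] by (auto simp: continuous_on_eq_continuous_at)
    next
      case (Suc k)
      have "Ck_on k ?B (\<lambda>x. D g x v)" for v
        by (rule Ck_on_cong[OF open_ball _ CkA[OF Suc, of v]]) (simp add: D_eqI[OF gd])
      then show ?case unfolding Ck_on.simps using gd differentiableI by blast
    qed
    then have "smooth_on ?B g" by (simp add: smooth_on_def)
    then show ?thesis using gp gd by blast
  qed
  show ?thesis using that[OF r(1) BS sol] .
qed

section \<open>Charts and coordinate changes\<close>

lemma chart_inj: "is_chart X c \<Longrightarrow> inj_on (snd c) (fst c)"
  unfolding is_chart_def
  using homeomorphic_imp_injective_map topspace_subtopology_subset openin_subset by metis

lemma chart_subset: "is_chart X c \<Longrightarrow> fst c \<subseteq> topspace X"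
  unfolding is_chart_def using openin_subset by blast

lemma chart_open_image:
  assumes "is_chart X c" "openin X U"
  shows "open (snd c ` (fst c \<inter> U))"
proof -
  have "open_map (subtopology X (fst c)) (top_of_set (snd c ` fst c)) (snd c)"
    using assms(1) homeomorphic_imp_open_map unfolding is_chart_def by blast
  moreover have "openin (subtopology X (fst c)) (fst c \<inter> U)"
    using assms(2) by (simp add: openin_subtopology_Int2)
  ultimately have "openin (top_of_set (snd c ` fst c)) (snd c ` (fst c \<inter> U))"
    unfolding open_map_def by blast
  then show ?thesis using assms(1) openin_open_eq unfolding is_chart_def by blast
qed

lemma chart_open_range: "is_chart X c \<Longrightarrow> open (snd c ` fst c)"
  unfolding is_chart_def by blast

lemma chart_open_vimage:
  assumes "is_chart X c" "open T"
  shows "openin X {q \<in> fst c. snd c q \<in> T}"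
proof -
  have "continuous_map (subtopology X (fst c)) (top_of_set (snd c ` fst c)) (snd c)"
    using assms(1) homeomorphic_imp_continuous_map unfolding is_chart_def by blast
  then have "openin (subtopology X (fst c)) {q \<in> topspace (subtopology X (fst c)). snd c q \<in> T \<inter> snd c ` fst c}"
    by (rule openin_continuous_map_preimage) (use assms(2) in \<open>auto simp: openin_open\<close>)
  moreover have "{q \<in> topspace (subtopology X (fst c)). snd c q \<in> T \<inter> snd c ` fst c} = {q \<in> fst c. snd c q \<in> T}"
    using chart_subset[OF assms(1)] by auto
  ultimately have "openin (subtopology X (fst c)) {q \<in> fst c. snd c q \<in> T}" by (simp only:)
  moreover have "openin X (fst c)" using assms(1) unfolding is_chart_def by blast
  ultimately show ?thesis using openin_trans_full by blast
qed

lemma local_rep_apply: "is_chart X c \<Longrightarrow> q \<in> fst c \<Longrightarrow> local_rep c f (snd c q) = f q"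
  by (simp add: local_rep_def inv_into_f_f[OF chart_inj])

lemma smooth_manifold_chart: "smooth_manifold X A \<Longrightarrow> c \<in> A \<Longrightarrow> is_chart X c"
  unfolding smooth_manifold_def by blast

lemma smooth_manifold_compatible: "smooth_manifold X A \<Longrightarrow> c \<in> A \<Longrightarrow> d \<in> A \<Longrightarrow> smoothly_compatible c d"
  unfolding smooth_manifold_def by blast

lemma overlap_open: "is_chart X c \<Longrightarrow> is_chart X d \<Longrightarrow> open (overlap c d)"
  using chart_open_image unfolding is_chart_def[of X d] by blast

lemma transition_in: "is_chart X c \<Longrightarrow> x \<in> overlap c d \<Longrightarrow> transition c d x \<in> overlap d c"
  by (auto simp: local_rep_apply)

lemma local_rep_transition:
  assumes "is_chart X c" "is_chart X d" "x \<in> overlap c d"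
  shows "local_rep d f (transition c d x) = local_rep c f x"
  using assms by (auto simp: local_rep_apply)

lemma transition_smooth: "smoothly_compatible c d \<Longrightarrow> smooth_on (overlap c d) (transition c d)"
  unfolding smoothly_compatible_def by blast

lemma D_transition_bij:
  assumes "is_chart X c" "is_chart X d" "smoothly_compatible c d" "x \<in> overlap c d"
  shows "bij (D (transition c d) x)"
proof -
  let ?\<tau> = "transition c d" and ?\<sigma> = "transition d c"
  have inv: "D (transition d c) (transition c d x) (D (transition c d) x v) = v"
    if c: "is_chart X c" "is_chart X d" "smoothly_compatible c d" "x \<in> overlap c d"
    for c d :: "('a, 'b) chart" and x v
  proof -
    have s: "smooth_on (overlap c d) (transition c d)" "smooth_on (overlap d c) (transition d c)"
      using c unfolding smoothly_compatible_def by auto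
    have "D (\<lambda>x. transition d c (transition c d x)) x = D (\<lambda>x. x) x"
      by (rule D_cong_open[OF overlap_open[OF c(1,2)] c(4)]) (use c in \<open>auto simp: local_rep_apply\<close>)
    then have "D (\<lambda>x. transition d c (transition c d x)) x v = v" by (simp add: frechet_derivative_ident)
    then show ?thesis
      using D_compose[OF smooth_on_differentiable[OF s(1) c(4)]
          smooth_on_differentiable[OF s(2) transition_in[OF c(1,4)]]] by simp
  qed
  have "smoothly_compatible d c" using assms(3) unfolding smoothly_compatible_def by blast
  from inv[OF assms(2,1) this transition_in[OF assms(1,4)]]
  have "D ?\<tau> x (D ?\<sigma> (?\<tau> x) w) = w" for w
    using local_rep_transition[OF assms(1,2,4), of "snd c"] local_rep_apply[OF assms(1), of _ "snd c"] assms(4) by auto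
  with inv[OF assms] show ?thesis
    by (intro o_bij[of "D ?\<sigma> (?\<tau> x)"]) (auto simp: fun_eq_iff)
qed

lemma D_local_rep_transition:
  assumes c: "is_chart X c" "is_chart X d" "smoothly_compatible c d" "x \<in> overlap c d"
    and f: "local_rep d f differentiable at (transition c d x)"
  shows "D (local_rep c f) x v = D (local_rep d f) (transition c d x) (D (transition c d) x v)"
    and "local_rep c f differentiable at x"
proof -
  have eq: "local_rep d f (transition c d y) = local_rep c f y" if "y \<in> overlap c d" for y
    using local_rep_transition[OF c(1,2) that] .
  have dif: "transition c d differentiable at x"
    using smooth_on_differentiable[OF transition_smooth[OF c(3)] c(4)] .
  have "D (\<lambda>y. local_rep d f (transition c d y)) x = D (local_rep c f) x"
    by (rule D_cong_open[OF overlap_open[OF c(1,2)] c(4) eq])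
  then show "D (local_rep c f) x v = D (local_rep d f) (transition c d x) (D (transition c d) x v)"
    using fun_cong[OF D_compose[OF dif f], of v] by simp
  show "local_rep c f differentiable at x"
    by (rule differentiable_cong_open[OF overlap_open[OF c(1,2)] c(4) eq])
      (auto intro!: differentiable_compose[OF f dif] )
qed

definition reparametrize :: "('a, 'm::euclidean_space) chart \<Rightarrow> 'm set \<Rightarrow> ('m \<Rightarrow> 'm) \<Rightarrow> ('a, 'm) chart" where
  "reparametrize c T \<zeta> = ({q \<in> fst c. snd c q \<in> T}, \<zeta> \<circ> snd c)"

text \<open>
  A local diffeomorphism of the model space turns a chart of the atlas into a chart of the maximal
  atlas. All new charts below, holomorphic and flat ones, arise in this way.
\<close>

lemma compatible_chart_reparametrize:
  assumes M: "smooth_manifold X A" and c: "c \<in> A" and T: "open T" "T \<subseteq> snd c ` fst c"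
    and V: "open V" and hom: "homeomorphism T V \<zeta> h"
    and \<zeta>: "smooth_on T \<zeta>" and h: "smooth_on V h"
  shows "compatible_chart X A (reparametrize c T \<zeta>)"
    and "d \<in> A \<Longrightarrow> x \<in> overlap d (reparametrize c T \<zeta>) \<Longrightarrow>
      x \<in> overlap d c \<and> transition d c x \<in> T \<and>
      D (transition d (reparametrize c T \<zeta>)) x v = D \<zeta> (transition d c x) (D (transition d c) x v)"
proof -
  let ?U = "{q \<in> fst c. snd c q \<in> T}"
  let ?z = "reparametrize c T \<zeta>"
  have ch: "is_chart X c" using smooth_manifold_chart[OF M c] .
  have z: "fst ?z = ?U" "snd ?z = \<zeta> \<circ> snd c" by (auto simp: reparametrize_def)
  have scU: "snd c ` ?U = T" using T(2) by auto
  have img: "snd ?z ` fst ?z = V" using hom unfolding z image_comp[symmetric] scU by (simp add: homeomorphism_def)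
  have Uo: "openin X ?U" using chart_open_vimage[OF ch T(1)] .
  have "homeomorphic_map (subtopology X ?U) (top_of_set T) (snd c)"
  proof -
    have "homeomorphic_map (subtopology X (fst c)) (top_of_set (snd c ` fst c)) (snd c)"
      using ch by (simp add: is_chart_def)
    from homeomorphic_map_subtopologies[OF this, of ?U T]
    have "homeomorphic_map (subtopology (subtopology X (fst c)) ?U) (subtopology (top_of_set (snd c ` fst c)) T) (snd c)"
      using T(2) chart_subset[OF ch] by auto
    moreover have "subtopology (subtopology X (fst c)) ?U = subtopology X ?U"
      by (simp add: subtopology_subtopology Int_absorb1 Collect_restrict)
    moreover have "subtopology (top_of_set (snd c ` fst c)) T = top_of_set T"
      using T(2) by (simp add: subtopology_subtopology Int_absorb1)
    ultimately show ?thesis by simp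
  qed
  moreover have "homeomorphic_map (top_of_set T) (top_of_set V) \<zeta>"
    unfolding homeomorphic_map_maps homeomorphic_maps_def
    using hom by (intro exI[of _ h]) (auto simp: homeomorphism_def continuous_map_in_subtopology)
  ultimately have hz: "homeomorphic_map (subtopology X ?U) (top_of_set V) (\<zeta> \<circ> snd c)"
    by (rule homeomorphic_map_compose)
  then have zch: "is_chart X ?z" unfolding is_chart_def img unfolding z using Uo V by auto
  have ov: "x \<in> overlap d c \<and> transition d c x \<in> T \<and> transition d ?z x = \<zeta> (transition d c x)"
    if "is_chart X d" "x \<in> overlap d ?z" for d x
    using that by (auto simp: z local_rep_apply)
  have ovo: "open (overlap d ?z)" if "is_chart X d" for d using overlap_open[OF that zch] .
  have comp: "smoothly_compatible ?z d" if d: "d \<in> A" for d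
    unfolding smoothly_compatible_def
  proof
    have dch: "is_chart X d" using smooth_manifold_chart[OF M d] .
    have sc: "smoothly_compatible d c" "smoothly_compatible c d"
      using smooth_manifold_compatible[OF M] c d by auto
    show "smooth_on (overlap d ?z) (transition d ?z)"
    proof (rule smooth_on_cong[OF ovo[OF dch]])
      show "smooth_on (overlap d ?z) (\<lambda>x. \<zeta> (transition d c x))"
        by (rule smooth_on_compose[OF ovo[OF dch] _ smooth_on_subset[OF transition_smooth[OF sc(1)]] \<zeta>])
          (use ov[OF dch] in auto)
    qed (use ov[OF dch] in auto)
    have sub: "overlap ?z d \<subseteq> V" using img by blast
    have hin: "h x \<in> overlap c d \<and> transition c d (h x) = transition ?z d x" if xz: "x \<in> overlap ?z d" for x
    proof -
      obtain q where q: "q \<in> fst c" "snd c q \<in> T" "q \<in> fst d" "x = \<zeta> (snd c q)" using xz by (auto simp: z)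
      then have "h x = snd c q" using hom by (simp add: homeomorphism_def)
      moreover have "transition ?z d x = snd d q"
        using local_rep_apply[OF zch, of q "snd d"] q by (simp add: z)
      ultimately show ?thesis using q ch by (auto simp: local_rep_apply)
    qed
    show "smooth_on (overlap ?z d) (transition ?z d)"
    proof (rule smooth_on_cong[OF overlap_open[OF zch dch]])
      show "smooth_on (overlap ?z d) (\<lambda>x. transition c d (h x))"
        by (rule smooth_on_compose[OF overlap_open[OF zch dch] _ smooth_on_subset[OF h sub] transition_smooth[OF sc(2)]])
          (use hin in auto)
    qed (use hin in auto)
  qed
  show "compatible_chart X A ?z" using zch comp by (simp add: compatible_chart_def)
  assume d: "d \<in> A" and x: "x \<in> overlap d ?z"
  have dch: "is_chart X d" using smooth_manifold_chart[OF M d] .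
  have xt: "x \<in> overlap d c" "transition d c x \<in> T" using ov[OF dch x] by auto
  have "D (transition d ?z) x = D (\<lambda>y. \<zeta> (transition d c y)) x"
    by (rule D_cong_open[OF ovo[OF dch] x]) (use ov[OF dch] in auto)
  moreover have "D (\<lambda>y. \<zeta> (transition d c y)) x = (\<lambda>v. D \<zeta> (transition d c x) (D (transition d c) x v))"
    by (rule D_compose[OF smooth_on_differentiable smooth_on_differentiable])
      (use xt \<zeta> transition_smooth[OF smooth_manifold_compatible[OF M d c]] in auto)
  ultimately show "x \<in> overlap d c \<and> transition d c x \<in> T \<and>
      D (transition d ?z) x v = D \<zeta> (transition d c x) (D (transition d c) x v)"
    using xt by simp
qed

lemma compatible_chart_local_diffeo:
  assumes "smooth_manifold X A" "compatible_chart X A z"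
  shows "local_diffeo_on X A (fst z) (snd z)"
proof -
  have z: "is_chart X z" "\<And>d. d \<in> A \<Longrightarrow> smoothly_compatible z d"
    using assms(2) by (auto simp: compatible_chart_def)
  have "smooth_map_on A (fst z) (snd z)"
    using z(2) by (auto simp: smooth_map_on_def smoothly_compatible_def)
  moreover have "smooth_on (snd z ` (fst z \<inter> fst d)) (snd d \<circ> inv_into (fst z) (snd z))" if "d \<in> A" for d
    using z(2)[OF that] by (auto simp: smoothly_compatible_def local_rep_def)
  ultimately show ?thesis
    using z(1) chart_inj[OF z(1)] unfolding local_diffeo_on_def is_chart_def by blast
qed

text \<open>
  The local inverse of \<open>q\<close> is smooth in coordinates, so the chain rule exhibits a left inverse of the
  derivative.
\<close>

lemma D_local_diffeo_inj:
  assumes M: "smooth_manifold X A" and c: "c \<in> A" and q: "local_diffeo_on X A (topspace X) q"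
  shows "smooth_on (snd c ` fst c) (local_rep c q)"
    and "x \<in> snd c ` fst c \<Longrightarrow> inj (D (local_rep c q) x)"
proof -
  have ch: "is_chart X c" using smooth_manifold_chart[OF M c] .
  have loc: "\<exists>T. open T \<and> x \<in> T \<and> smooth_on T (local_rep c q) \<and> inj (D (local_rep c q) x)"
    if x: "x \<in> snd c ` fst c" for x
  proof -
    obtain p where p: "p \<in> fst c" "x = snd c p" using x by blast
    then have "p \<in> topspace X" using chart_subset[OF ch] by blast
    then obtain W where W: "openin X W" "p \<in> W" "inj_on q W" "smooth_map_on A W q"
      "smooth_on (q ` (W \<inter> fst c)) (snd c \<circ> inv_into W q)"
      using q c unfolding local_diffeo_on_def by metis
    let ?T = "snd c ` (fst c \<inter> W)"
    have T: "open ?T" "x \<in> ?T" using chart_open_image[OF ch W(1)] p W(2) by auto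
    have sm: "smooth_on ?T (local_rep c q)" using W(4) c by (simp add: smooth_map_on_def)
    let ?k = "snd c \<circ> inv_into W q"
    have "D (\<lambda>x. ?k (local_rep c q x)) x = D (\<lambda>x. x) x"
      by (rule D_cong_open[OF T]) (use W(3) in \<open>auto simp: local_rep_apply[OF ch] inv_into_f_f\<close>)
    then have "D (\<lambda>x. ?k (local_rep c q x)) x = id" by (simp add: frechet_derivative_ident id_def)
    moreover have "local_rep c q x \<in> q ` (W \<inter> fst c)" using p W(2) by (simp add: local_rep_apply[OF ch])
    ultimately have "D ?k (local_rep c q x) (D (local_rep c q) x v) = v" for v
      using D_compose[OF smooth_on_differentiable[OF sm T(2)] smooth_on_differentiable[OF W(5)]] by (metis id_apply)
    then have "inj (D (local_rep c q) x)" by (metis injI)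
    then show ?thesis using T sm by blast
  qed
  show "smooth_on (snd c ` fst c) (local_rep c q)" by (rule smooth_on_local) (use loc in blast)
  show "x \<in> snd c ` fst c \<Longrightarrow> inj (D (local_rep c q) x)" using loc by blast
qed

lemma linear_inj_bij_DIM:
  fixes L :: "'a::euclidean_space \<Rightarrow> 'b::euclidean_space"
  assumes "linear L" "inj L" "DIM('a) = DIM('b)"
  shows "bij L"
proof -
  have "dim (range L) = DIM('b)" using dim_image_eq[OF assms(1), of UNIV] assms(2,3) by simp
  then have "span (range L) = UNIV" by (simp add: dim_eq_full)
  moreover have "span (range L) = range L"
    using linear_subspace_image[OF assms(1) subspace_UNIV] by (simp add: span_eq_iff)
  ultimately show ?thesis using assms(2) by (simp add: bij_def)
qed

section \<open>Connections with given flat coordinates\<close>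

text \<open>
  The endomorphism field \<open>I\<close> determined by \<open>Db = Da \<circ> I\<close>.
\<close>

definition induced_endo :: "('m::euclidean_space \<Rightarrow> 'v::euclidean_space) \<Rightarrow> ('m \<Rightarrow> 'v) \<Rightarrow> 'm \<Rightarrow> 'm \<Rightarrow> 'm" where
  "induced_endo a b x v = inv (D a x) (D b x v)"

text \<open>
  The connection coefficients for which the components of \<open>a\<close> are affine functions:
  \<open>Da (\<Gamma>(u,v))\<close> is the second derivative of \<open>a\<close> along \<open>u\<close> and \<open>v\<close>.
\<close>

definition flat_christoffel :: "('m::euclidean_space \<Rightarrow> 'v::euclidean_space) \<Rightarrow> 'm \<Rightarrow> 'm \<Rightarrow> 'm \<Rightarrow> 'm" where
  "flat_christoffel a x u v = inv (D a x) (D (\<lambda>y. D a y v) x u)"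

text \<open>
  Torsion-freeness replaces the Lie brackets in the invariant formula for the exterior derivative by
  covariant derivatives, and parallelism expands the directional derivatives. All terms then cancel in
  pairs by skew-symmetry.
\<close>

lemma closed_2form_of_parallel:
  assumes sub: "\<And>c x. c \<in> A \<Longrightarrow> x \<in> snd c ` fst c \<Longrightarrow> bilinear (w c x)"
    and skew: "\<And>c x u v. c \<in> A \<Longrightarrow> x \<in> snd c ` fst c \<Longrightarrow> w c x u v = - w c x v u"
    and tors: "torsion_free A \<Gamma>" and par: "parallel_bilinear A \<Gamma> w"
  shows "closed_2form A w"
  unfolding closed_2form_def
proof (intro ballI allI impI)
  fix c X Y Z x
  assume c: "c \<in> A" and "vector_field_in c X \<and> vector_field_in c Y \<and> vector_field_in c Z" and x: "x \<in> snd c ` fst c"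
  then have vf: "vector_field_in c X" "vector_field_in c Y" "vector_field_in c Z" by auto
  let ?N = "\<lambda>X Y. cov_deriv (\<Gamma> c) X Y x"
  have T: "lie_bracket P Q x = ?N P Q - ?N Q P" if "vector_field_in c P" "vector_field_in c Q" for P Q
  proof -
    have "torsion (\<Gamma> c) P Q x = 0"
      using tors that c x unfolding torsion_free_def by blast
    then show ?thesis unfolding torsion_def by (simp add: algebra_simps)
  qed
  have P: "D (\<lambda>y. w c y (Q y) (R y)) x (P x) = w c x (?N P Q) (R x) + w c x (Q x) (?N P R)"
    if "vector_field_in c P" "vector_field_in c Q" "vector_field_in c R" for P Q R
  proof -
    have "cov_deriv_bilinear (\<Gamma> c) (w c) P Q R x = 0"
      using par that c x unfolding parallel_bilinear_def by blast
    then show ?thesis unfolding cov_deriv_bilinear_def by (simp add: algebra_simps)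
  qed
  note b = sub[OF c x]
  show "ext_deriv2 (w c) X Y Z x = 0"
    unfolding ext_deriv2_def
    unfolding P[OF vf(1,2,3)] P[OF vf(2,1,3)] P[OF vf(3,1,2)] T[OF vf(1,2)] T[OF vf(1,3)] T[OF vf(2,3)]
      bilinear_lsub[OF b]
    using skew[OF c x, of "X x" "?N Y Z"] skew[OF c x, of "X x" "?N Z Y"] skew[OF c x, of "Y x" "?N X Z"]
     skew[OF c x, of "Y x" "?N Z X"] by simp
qed

text \<open>
  A map \<open>a\<close> that is a local system of coordinates with values in a vector space. Pushing vector fields forward by \<open>Da\<close> turns them into functions with
  values in a fixed vector space, where covariant differentiation becomes differentiation.
\<close>

locale flat_coordinates =
  fixes S :: "'m::euclidean_space set" and a :: "'m \<Rightarrow> 'v::euclidean_space"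
  assumes S: "open S" and a: "smooth_on S a" and bij: "\<And>x. x \<in> S \<Longrightarrow> bij (D a x)"
begin

lemma linear_Da: "x \<in> S \<Longrightarrow> linear (D a x)" using smooth_on_D_linear[OF a] .

lemma D_inv: "x \<in> S \<Longrightarrow> D a x (inv (D a x) w) = w"
  by (rule surj_f_inv_f[OF bij_is_surj[OF bij]])

lemma D_eq_iff: "x \<in> S \<Longrightarrow> D a x u = D a x v \<longleftrightarrow> u = v"
  by (rule inj_eq[OF bij_is_inj[OF bij]])

lemma linear_inv: "x \<in> S \<Longrightarrow> linear (inv (D a x))"
  by (rule linear_inv_bij[OF linear_Da bij])

lemma smooth_inv: assumes "smooth_on S w" shows "smooth_on S (\<lambda>x. inv (D a x) (w x))"
  by (rule smooth_on_family_apply[OF S linear_inv smooth_on_inverse_family[OF S linear_Da bij smooth_on_D[OF a]] assms])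

lemma christoffel_linear2: "x \<in> S \<Longrightarrow> linear (flat_christoffel a x u)"
proof -
  assume x: "x \<in> S"
  have "linear (\<lambda>v. D (\<lambda>y. D a y v) x u)"
  proof (rule linearI)
    show "D (\<lambda>y. D a y (v + w)) x u = D (\<lambda>y. D a y v) x u + D (\<lambda>y. D a y w) x u" for v w
    proof -
      have "D (\<lambda>y. D a y (v + w)) x = D (\<lambda>y. D a y v + D a y w) x"
        by (rule D_cong_open[OF S x]) (simp add: linear_add[OF linear_Da])
      also have "\<dots> = (\<lambda>u. D (\<lambda>y. D a y v) x u + D (\<lambda>y. D a y w) x u)"
        by (intro D_eqI has_derivative_add smooth_on_has_derivative[OF smooth_on_D[OF a] x])
      finally show ?thesis by simp
    qed
    show "D (\<lambda>y. D a y (r *\<^sub>R v)) x u = r *\<^sub>R D (\<lambda>y. D a y v) x u" for r v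
    proof -
      have "D (\<lambda>y. D a y (r *\<^sub>R v)) x = D (\<lambda>y. r *\<^sub>R D a y v) x"
        by (rule D_cong_open[OF S x]) (simp add: linear_cmul[OF linear_Da])
      also have "\<dots> = (\<lambda>u. r *\<^sub>R D (\<lambda>y. D a y v) x u)"
        by (intro D_eqI has_derivative_scaleR_right smooth_on_has_derivative[OF smooth_on_D[OF a] x])
      finally show ?thesis by simp
    qed
  qed
  from linear_compose[OF this linear_inv[OF x]] show ?thesis
    by (simp add: flat_christoffel_def[abs_def] o_def)
qed

lemma christoffel_bilinear: "x \<in> S \<Longrightarrow> bilinear (flat_christoffel a x)"
  unfolding bilinear_def
proof (intro conjI allI)
  assume x: "x \<in> S"
  show "linear (flat_christoffel a x u)" for u using christoffel_linear2[OF x] .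
  show "linear (\<lambda>u. flat_christoffel a x u v)" for v
    using linear_compose[OF smooth_on_D_linear[OF smooth_on_D[OF a] x] linear_inv[OF x]]
    by (simp add: flat_christoffel_def[abs_def] o_def)
qed

lemma christoffel_smooth: "smooth_on S (\<lambda>x. flat_christoffel a x u v)"
  unfolding flat_christoffel_def by (intro smooth_inv smooth_on_D a)

lemma D_christoffel: "x \<in> S \<Longrightarrow> D a x (flat_christoffel a x u v) = D (\<lambda>y. D a y v) x u"
  unfolding flat_christoffel_def by (rule D_inv)

lemma smooth_push: "smooth_on S Y \<Longrightarrow> smooth_on S (\<lambda>y. D a y (Y y))"
  by (rule smooth_on_family_apply[OF S linear_Da smooth_on_D[OF a]])

lemma D_push: "x \<in> S \<Longrightarrow> smooth_on S Y \<Longrightarrow>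
    D (\<lambda>y. D a y (Y y)) x h = D (\<lambda>y. D a y (Y x)) x h + D a x (D Y x h)"
  by (rule D_family_apply[OF S _ linear_Da smooth_on_D[OF a]])

text \<open>
  The connection is the pull-back of the trivial connection of \<open>V\<close>. Torsion and curvature therefore
  vanish because second derivatives of \<open>a\<close>, and of the pushed-forward fields, are symmetric.
\<close>

lemma D_cov_deriv:
  assumes "x \<in> S" "smooth_on S Y"
  shows "D a x (cov_deriv (flat_christoffel a) X Y x) = D (\<lambda>y. D a y (Y y)) x (X x)"
  unfolding cov_deriv_def linear_add[OF linear_Da[OF assms(1)]] D_christoffel[OF assms(1)] D_push[OF assms]
  by simp

lemma smooth_cov_deriv:
  assumes "smooth_on S X" "smooth_on S Y"
  shows "smooth_on S (cov_deriv (flat_christoffel a) X Y)"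
proof (rule smooth_on_cong[OF S])
  show "smooth_on S (\<lambda>x. inv (D a x) (D (\<lambda>y. D a y (Y y)) x (X x)))"
    by (rule smooth_inv, rule smooth_on_family_apply[OF S smooth_on_D_linear[OF smooth_push[OF assms(2)]]
          smooth_on_D[OF smooth_push[OF assms(2)]] assms(1)])
  show "inv (D a x) (D (\<lambda>y. D a y (Y y)) x (X x)) = cov_deriv (flat_christoffel a) X Y x" if "x \<in> S" for x
    using D_cov_deriv[OF that assms(2), of X] D_eq_iff[OF that]
      by (simp add: D_inv[OF that] flip: D_eq_iff[OF that])
qed

text \<open>
  Mixed directional derivatives of a function along two fields differ by the derivative along their
  bracket. With \<open>f = a\<close> this yields the vanishing of the torsion, with the push-forward of a field that of
  the curvature, and with \<open>f = b\<close> the equation \<open>d\<^sub>\<nabla> I = 0\<close>.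
\<close>

lemma D_lie_bracket:
  fixes f :: "'m \<Rightarrow> 'c::euclidean_space"
  assumes "x \<in> S" "smooth_on S X" "smooth_on S Y" "smooth_on S f"
  shows "D (\<lambda>y. D f y (Y y)) x (X x) - D (\<lambda>y. D f y (X y)) x (Y x) = D f x (lie_bracket X Y x)"
proof -
  have *: "D (\<lambda>y. D f y (P y)) x h = D (\<lambda>y. D f y (P x)) x h + D f x (D P x h)" if "smooth_on S P" for P h
    by (rule D_family_apply[OF S assms(1)]) (use assms(4) that smooth_on_D_linear smooth_on_D in auto)
  show ?thesis
    unfolding *[OF assms(2)] *[OF assms(3)] lie_bracket_def
      linear_diff[OF smooth_on_D_linear[OF assms(4,1)]]
    using D_D_commute[OF S assms(1,4), of "Y x" "X x"] by simp
qed

lemma torsion_zero: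
  assumes "x \<in> S" "smooth_on S X" "smooth_on S Y"
  shows "torsion (flat_christoffel a) X Y x = 0"
proof -
  have "D a x (torsion (flat_christoffel a) X Y x) = D a x 0"
    unfolding torsion_def linear_diff[OF linear_Da[OF assms(1)]] D_cov_deriv[OF assms(1,2)] D_cov_deriv[OF assms(1,3)]
      D_lie_bracket[OF assms a] by (simp add: linear_0[OF linear_Da[OF assms(1)]])
  then show ?thesis using D_eq_iff[OF assms(1)] by blast
qed

lemma curvature_zero:
  assumes x: "x \<in> S" and X: "smooth_on S X" and Y: "smooth_on S Y" and Z: "smooth_on S Z"
  shows "curvature (flat_christoffel a) X Y Z x = 0"
proof -
  let ?Z = "\<lambda>y. D a y (Z y)"
  let ?N = "cov_deriv (flat_christoffel a)"
  have NN: "D a x (?N P (?N Q Z) x) = D (\<lambda>y. D ?Z y (Q y)) x (P x)"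
    if "smooth_on S P" "smooth_on S Q" for P Q
  proof -
    have "D a x (?N P (?N Q Z) x) = D (\<lambda>y. D a y (?N Q Z y)) x (P x)"
      by (rule D_cov_deriv[OF x smooth_cov_deriv[OF that(2) Z]])
    also have "D (\<lambda>y. D a y (?N Q Z y)) x = D (\<lambda>y. D ?Z y (Q y)) x"
      by (rule D_cong_open[OF S x]) (rule D_cov_deriv[OF _ Z])
    finally show ?thesis .
  qed
  have "D a x (curvature (flat_christoffel a) X Y Z x) = D a x 0"
    unfolding curvature_def linear_diff[OF linear_Da[OF x]] NN[OF X Y] NN[OF Y X] D_cov_deriv[OF x Z]
      D_lie_bracket[OF x X Y smooth_push[OF Z]] by (simp add: linear_0[OF linear_Da[OF x]])
  then show ?thesis using D_eq_iff[OF x] by blast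
qed

lemma cov_deriv_constant_form:
  assumes x: "x \<in> S" and Y: "smooth_on S Y" and Z: "smooth_on S Z"
    and s: "bilinear s" and w: "\<And>y u v. y \<in> S \<Longrightarrow> w y u v = s (D a y u) (D a y v)"
  shows "cov_deriv_bilinear (flat_christoffel a) w X Y Z x = 0"
proof -
  have bb: "bounded_bilinear s" using s bilinear_conv_bounded_bilinear by blast
  have "D (\<lambda>y. w y (Y y) (Z y)) x = D (\<lambda>y. s (D a y (Y y)) (D a y (Z y))) x"
    by (rule D_cong_open[OF S x]) (simp add: w)
  also have "\<dots> = (\<lambda>h. s (D a x (Y x)) (D (\<lambda>y. D a y (Z y)) x h) + s (D (\<lambda>y. D a y (Y y)) x h) (D a x (Z x)))"
    by (intro D_eqI bounded_bilinear.FDERIV[OF bb] smooth_on_has_derivative[OF smooth_push x] Y Z)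
  finally show ?thesis
    unfolding cov_deriv_bilinear_def w[OF x] D_cov_deriv[OF x Y] D_cov_deriv[OF x Z] by simp
qed

end

section \<open>The special structure of a bi-Lagrangian submanifold\<close>

text \<open>
  The local picture of a bi-Lagrangian submanifold: its two components are given by \<open>a\<close> and \<open>b\<close>,
  and the hypotheses \<open>L1\<close> and \<open>L2\<close> say that \<open>Omega1\<close> and \<open>Omega2\<close> restrict to zero.
\<close>

locale bilagrangian_chart = flat_coordinates S a
  for S :: "'m::euclidean_space set" and a :: "'m \<Rightarrow> 'v::euclidean_space" +
  fixes b :: "'m \<Rightarrow> 'v" and s :: "'v \<Rightarrow> 'v \<Rightarrow> real"
  assumes s: "symplectic_form s"
    and b: "smooth_on S b" and bijb: "\<And>x. x \<in> S \<Longrightarrow> bij (D b x)"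
    and L1: "\<And>x u v. x \<in> S \<Longrightarrow> s (D a x u) (D b x v) + s (D b x u) (D a x v) = 0"
    and L2: "\<And>x u v. x \<in> S \<Longrightarrow> s (D a x u) (D a x v) = s (D b x u) (D b x v)"
begin

abbreviation "J \<equiv> induced_endo a b"

lemma s_bilinear: "bilinear s" and s_skew: "s u v = - s v u" and s_nondegenerate: "(\<And>v. s u v = 0) \<Longrightarrow> u = 0"
  using s unfolding symplectic_form_def by blast+

lemma linear_Db: "x \<in> S \<Longrightarrow> linear (D b x)" using smooth_on_D_linear[OF b] .

lemma D_J: "x \<in> S \<Longrightarrow> D a x (J x v) = D b x v"
  unfolding induced_endo_def by (rule D_inv)

text \<open>
  By \<open>L2\<close> and then \<open>L1\<close>, \<open>s(Db (J v), Db w) = s(Db v, Da w) = - s(Da v, Db w)\<close> for all \<open>w\<close>; as \<open>Db\<close> is onto and \<open>s\<close> is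
  nondegenerate, \<open>Db (J v) = - Da v\<close>. This is where \<open>J\<^sup>2 = -1\<close> comes from.
\<close>

lemma Db_J: assumes "x \<in> S" shows "D b x (J x v) = - D a x v"
proof -
  have "s (D b x (J x v) + D a x v) (D b x w) = 0" for w
    using L2[OF assms, of "J x v" w] L1[OF assms, of v w] D_J[OF assms] by (simp add: bilinear_ladd[OF s_bilinear])
  moreover have "surj (D b x)" using bijb[OF assms] bij_is_surj by blast
  ultimately have "s (D b x (J x v) + D a x v) w = 0" for w by (metis surjD)
  then have "D b x (J x v) + D a x v = 0" by (rule s_nondegenerate)
  then show ?thesis by (simp add: eq_neg_iff_add_eq_0)
qed

lemma linear_J: "x \<in> S \<Longrightarrow> linear (J x)"
  using linear_compose[OF linear_Db linear_inv] by (simp add: induced_endo_def[abs_def] o_def)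

lemma J_J: "x \<in> S \<Longrightarrow> J x (J x v) = - v"
  using D_J[of x "J x v"] Db_J[of x v] D_eq_iff[of x "J x (J x v)" "- v"] linear_neg[OF linear_Da] by simp

lemma smooth_J: "smooth_on S Y \<Longrightarrow> smooth_on S (\<lambda>x. J x (Y x))"
  unfolding induced_endo_def
  by (rule smooth_inv, rule smooth_on_family_apply[OF S linear_Db smooth_on_D[OF b]])

lemma cov_ext_deriv_J:
  assumes "x \<in> S" "smooth_on S X" "smooth_on S Y"
  shows "cov_ext_deriv (flat_christoffel a) J X Y x = 0"
proof -
  have "D a x (cov_deriv (flat_christoffel a) P (\<lambda>y. J y (Q y)) x) = D (\<lambda>y. D b y (Q y)) x (P x)"
    if "smooth_on S Q" for P Q
  proof -
    have "D (\<lambda>y. D a y (J y (Q y))) x = D (\<lambda>y. D b y (Q y)) x"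
      by (rule D_cong_open[OF S assms(1)]) (rule D_J)
    then show ?thesis using D_cov_deriv[OF assms(1) smooth_J[OF that], of P] by simp
  qed
  then have "D a x (cov_ext_deriv (flat_christoffel a) J X Y x) = D a x 0"
    unfolding cov_ext_deriv_def linear_diff[OF linear_Da[OF assms(1)]] D_J[OF assms(1)]
    using D_lie_bracket[OF assms b] assms by (simp add: linear_0[OF linear_Da[OF assms(1)]])
  then show ?thesis using D_eq_iff[OF assms(1)] by blast
qed

lemma metric_eq: assumes "x \<in> S"
  shows "product_metric s (D a x u, D b x u) (D a x v, D b x v) = s (D a x u) (D b x v) / 2"
proof -
  have "s (D a x v) (D b x u) = s (D a x u) (D b x v)"
    using s_skew[of "D a x v" "D b x u"] L1[OF assms, of u v] by simp
  then show ?thesis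
    by (simp add: product_metric_def polarization_def bilinear_ladd[OF s_bilinear] bilinear_radd[OF s_bilinear] field_simps)
qed

text \<open>
  Since \<open>Da \<circ> J = Db\<close> and \<open>Db \<circ> J = - Da\<close>, the map \<open>a - i b\<close> is holomorphic for \<open>J\<close>. The coordinate \<open>\<zeta>\<close> is
  its image under the complex-linear map \<open>V \<otimes> \<complex> \<rightarrow> (T, J x0)\<close> extending the inverse of \<open>D a x0\<close>, with
  \<open>i\<close> acting as \<open>J x0\<close>. At \<open>x0\<close> its derivative is \<open>1 - (J x0)\<^sup>2 = 2\<close>, so it is a local diffeomorphism there.
\<close>

lemma holomorphic_coordinate:
  assumes x0: "x0 \<in> S"
  obtains T V \<zeta> h where "open T" "T \<subseteq> S" "x0 \<in> T" "open V" "homeomorphism T V \<zeta> h"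
    "smooth_on T \<zeta>" "smooth_on V h"
    "\<And>x v. x \<in> T \<Longrightarrow> D \<zeta> x (J x v) = J x0 (D \<zeta> x v)"
proof -
  define L where "L = inv (D a x0)"
  define \<zeta> where "\<zeta> x = L (a x) - J x0 (L (b x))" for x
  have L: "linear L" unfolding L_def by (rule linear_inv[OF x0])
  have JL: "linear (\<lambda>w. J x0 (L w))" using linear_compose[OF L linear_J[OF x0]] by (simp add: o_def)
  have sm: "smooth_on S \<zeta>" unfolding \<zeta>_def
    by (intro smooth_on_diff smooth_on_linear_compose[OF S L] smooth_on_linear_compose[OF S JL] a b S)
  have D\<zeta>: "D \<zeta> x v = L (D a x v) - J x0 (L (D b x v))" if "x \<in> S" for x v
  proof -
    have "(\<zeta> has_derivative (\<lambda>v. L (D a x v) - J x0 (L (D b x v)))) (at x)"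
      unfolding \<zeta>_def using L JL linear_conv_bounded_linear
      by (intro has_derivative_diff bounded_linear.has_derivative[of L] bounded_linear.has_derivative[of "\<lambda>w. J x0 (L w)"]
         smooth_on_has_derivative[OF a that] smooth_on_has_derivative[OF b that]) blast+
    then show ?thesis by (simp add: D_eqI)
  qed
  have hol: "D \<zeta> x (J x v) = J x0 (D \<zeta> x v)" if "x \<in> S" for x v
    using that x0 by (simp add: D\<zeta> D_J Db_J linear_diff[OF linear_J[OF x0]] J_J linear_neg[OF L] linear_neg[OF linear_J[OF x0]])
  have "D \<zeta> x0 v = 2 *\<^sub>R v" for v
  proof -
    have "L (D a x0 v) = v" unfolding L_def by (rule inv_f_f[OF bij_is_inj[OF bij[OF x0]]])
    moreover have "L (D b x0 v) = J x0 v" by (simp add: L_def induced_endo_def)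
    ultimately show ?thesis using x0 by (simp add: D\<zeta> J_J scaleR_2)
  qed
  then have "inj (D \<zeta> x0)" by (auto intro: injI)
  from smooth_inverse_function[OF S sm x0 this]
  obtain T V h where "open T" "T \<subseteq> S" "x0 \<in> T" "open V" "homeomorphism T V \<zeta> h" "smooth_on V h" by metis
  then show ?thesis using that[of T V \<zeta> h] hol smooth_on_subset[OF sm] by blast
qed

end

text \<open>
  The coordinate expressions \<open>a c\<close> and \<open>b c\<close> come from globally defined maps, so \<open>D (a c) = D (a d) \<circ> D \<tau>\<close> for a
  coordinate change \<open>\<tau>\<close>, and likewise for \<open>b\<close>. This makes the locally defined \<open>I\<close> and \<open>\<Gamma>\<close> transform as an
  endomorphism field and as a connection. It is stated for a bi-Lagrangian map of an arbitrary
  manifold; a submanifold is the case of its inclusion.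
\<close>

lemma bilagrangian_imp_special_pseudo_kahler:
  fixes s :: "'v::euclidean_space \<Rightarrow> 'v \<Rightarrow> real" and A :: "('a, 'm::euclidean_space) chart set"
    and f :: "'a \<Rightarrow> 'v \<times> 'v"
  assumes M: "smooth_manifold X A" and s: "symplectic_form s"
    and bl: "bilagrangian_transversal_on s X A (topspace X) f"
  shows "special_pseudo_kahler_metric X A (pullback f (product_metric s))"
proof -
  define a where "a c = local_rep c (fst \<circ> f)" for c :: "('a,'m) chart"
  define b where "b c = local_rep c (snd \<circ> f)" for c :: "('a,'m) chart"
  define I where "I c = induced_endo (a c) (b c)" for c
  define \<Gamma> where "\<Gamma> c = flat_christoffel (a c)" for c
  define g where "g = (pullback f (product_metric s) :: ('a,'m) bilinear_field)"
  have dims: "DIM('m) = DIM('v)"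
    and lag: "lagrangian_on A (topspace X) f (Omega1 s)" "lagrangian_on A (topspace X) f (Omega2 s)"
    and ld: "local_diffeo_on X A (topspace X) (fst \<circ> f)" "local_diffeo_on X A (topspace X) (snd \<circ> f)"
    using bl unfolding bilagrangian_transversal_on_def lagrangian_on_def by blast+
  have ch: "is_chart X c" if "c \<in> A" for c using smooth_manifold_chart[OF M that] .
  have sma: "smooth_on (snd c ` fst c) (a c)" and smb: "smooth_on (snd c ` fst c) (b c)" if "c \<in> A" for c
    using D_local_diffeo_inj(1)[OF M that] ld unfolding a_def b_def by auto
  have bija: "bij (D (a c) x)" and bijb: "bij (D (b c) x)" if "c \<in> A" "x \<in> snd c ` fst c" for c x
    using D_local_diffeo_inj(2)[OF M that(1) _ that(2)] ld dims
      smooth_on_D_linear[OF sma[OF that(1)] that(2)] smooth_on_D_linear[OF smb[OF that(1)] that(2)]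
    unfolding a_def b_def by (auto intro: linear_inj_bij_DIM)
  have Df: "D (local_rep c f) x v = (D (a c) x v, D (b c) x v)" if "c \<in> A" "x \<in> snd c ` fst c" for c x v
  proof -
    have "local_rep c f = (\<lambda>x. (a c x, b c x))" by (auto simp: a_def b_def local_rep_def)
    then show ?thesis
      using D_eqI[OF has_derivative_Pair[OF smooth_on_has_derivative[OF sma[OF that(1)] that(2)]
          smooth_on_has_derivative[OF smb[OF that(1)] that(2)]]] by simp
  qed
  have bc: "bilagrangian_chart (snd c ` fst c) (a c) (b c) s" if c: "c \<in> A" for c
  proof
    show "open (snd c ` fst c)" using chart_open_range[OF ch[OF c]] .
    fix x u v assume x: "x \<in> snd c ` fst c"
    then have x': "x \<in> snd c ` (fst c \<inter> topspace X)" using chart_subset[OF ch[OF c]] by blast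
    have "pullback f (Omega1 s) c x u v = 0" "pullback f (Omega2 s) c x u v = 0"
      using lag c x' unfolding lagrangian_on_def by blast+
    then show "s (D (a c) x u) (D (b c) x v) + s (D (b c) x u) (D (a c) x v) = 0"
      "s (D (a c) x u) (D (a c) x v) = s (D (b c) x u) (D (b c) x v)"
      by (simp_all add: pullback_def Omega1_def Omega2_def Df[OF c x])
  qed (use c sma smb bija bijb s in auto)
  have geq: "g c x u v = s (D (a c) x u) (D (b c) x v) / 2" if c: "c \<in> A" "x \<in> snd c ` fst c" for c x u v
    unfolding g_def pullback_def Df[OF c] by (rule bilagrangian_chart.metric_eq[OF bc[OF c(1)] c(2)])
  have bil: "bilinear s" using s by (simp add: symplectic_form_def)
  have skew: "s u v = - s v u" for u v using s unfolding symplectic_form_def by blast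
  have nondeg: "u = 0" if "\<And>v. s u v = 0" for u using s that unfolding symplectic_form_def by blast
  \<comment> \<open>In the coordinates \<open>a\<close> the Kaehler form is the constant form \<open>s2\<close>.\<close>
  define s2 where "s2 u v = s u v / 2" for u v
  have bil2: "bilinear s2" using bil unfolding s2_def bilinear_def linear_iff
    by (simp add: add_divide_distrib)
  have bb2: "bounded_bilinear s2" using bil2 bilinear_conv_bounded_bilinear by blast
  have weq: "kahler_form g I c x u v = s2 (D (a c) x u) (D (a c) x v)"
    if c: "c \<in> A" "x \<in> snd c ` fst c" for c x u v
  proof -
    interpret bilagrangian_chart "snd c ` fst c" "a c" "b c" s by (rule bc[OF c(1)])
    show ?thesis unfolding kahler_form_def geq[OF c] I_def s2_def using D_J[OF c(2)] L2[OF c(2)] by simp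
  qed
  have tr: "D (a c) x v = D (a d) (transition c d x) (D (transition c d) x v)"
      "D (b c) x v = D (b d) (transition c d x) (D (transition c d) x v)"
      "transition c d x \<in> snd d ` fst d" "x \<in> snd c ` fst c"
    if c: "c \<in> A" "d \<in> A" and x: "x \<in> overlap c d" for c d x v
  proof -
    show t: "transition c d x \<in> snd d ` fst d" using transition_in[OF ch[OF c(1)] x] by blast
    show "x \<in> snd c ` fst c" using x by blast
    note * = D_local_rep_transition(1)[OF ch[OF c(1)] ch[OF c(2)] smooth_manifold_compatible[OF M c] x]
    show "D (a c) x v = D (a d) (transition c d x) (D (transition c d) x v)"
      using *[OF smooth_on_differentiable[OF sma[OF c(2)] t, unfolded a_def]] by (simp add: a_def)
    show "D (b c) x v = D (b d) (transition c d x) (D (transition c d) x v)"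
      using *[OF smooth_on_differentiable[OF smb[OF c(2)] t, unfolded b_def]] by (simp add: b_def)
  qed
  have gfield: "is_bilinear_field A g"
    unfolding is_bilinear_field_def
  proof (intro conjI ballI allI)
    fix c assume c: "c \<in> A"
    interpret bilagrangian_chart "snd c ` fst c" "a c" "b c" s by (rule bc[OF c])
    show "bilinear (g c x)" if x: "x \<in> snd c ` fst c" for x
      unfolding bilinear_def geq[OF c x, abs_def]
      using linear_Da[OF x] linear_Db[OF x] by (simp add: linear_iff bilinear_ladd[OF bil] bilinear_radd[OF bil]
          bilinear_lmul[OF bil] bilinear_rmul[OF bil] add_divide_distrib)
    fix u v
    show "smooth_on (snd c ` fst c) (\<lambda>x. g c x u v)"
    proof (rule smooth_on_cong[OF S])
      show "smooth_on (snd c ` fst c) (\<lambda>x. s2 (D (a c) x u) (D (b c) x v))"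
        by (intro bounded_bilinear.smooth_on_prod[OF bb2] S smooth_on_D a b)
    qed (simp add: geq[OF c] s2_def)
  next
    fix c d x u v assume "c \<in> A" "d \<in> A" "x \<in> overlap c d"
    then show "g d (transition c d x) (D (transition c d) x u) (D (transition c d) x v) = g c x u v"
      using tr[of c d x] by (simp add: geq)
  qed
  have Ifield: "is_endo_field A I"
    unfolding is_endo_field_def
  proof (intro conjI ballI allI)
    fix c assume c: "c \<in> A"
    interpret bilagrangian_chart "snd c ` fst c" "a c" "b c" s by (rule bc[OF c])
    show "linear (I c x)" if "x \<in> snd c ` fst c" for x unfolding I_def by (rule linear_J[OF that])
    show "smooth_on (snd c ` fst c) (\<lambda>x. I c x v)" for v unfolding I_def by (rule smooth_J[OF smooth_on_const])
  next
    fix c d x v assume c: "c \<in> A" "d \<in> A" and x: "x \<in> overlap c d"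
    interpret c: bilagrangian_chart "snd c ` fst c" "a c" "b c" s by (rule bc[OF c(1)])
    interpret d: bilagrangian_chart "snd d ` fst d" "a d" "b d" s by (rule bc[OF c(2)])
    note t = tr[OF c x]
    have "D (a d) (transition c d x) (I d (transition c d x) (D (transition c d) x v))
      = D (a d) (transition c d x) (D (transition c d) x (I c x v))"
      unfolding t(1)[symmetric] I_def c.D_J[OF t(4)] d.D_J[OF t(3)] t(2)[symmetric] ..
    then show "I d (transition c d x) (D (transition c d) x v) = D (transition c d) x (I c x v)"
      unfolding d.D_eq_iff[OF t(3)] .
  qed
  have conn: "is_connection A \<Gamma>"
    unfolding is_connection_def
  proof (intro conjI ballI allI)
    fix c assume c: "c \<in> A"
    interpret bilagrangian_chart "snd c ` fst c" "a c" "b c" s by (rule bc[OF c])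
    show "bilinear (\<Gamma> c x)" if "x \<in> snd c ` fst c" for x unfolding \<Gamma>_def by (rule christoffel_bilinear[OF that])
    show "smooth_on (snd c ` fst c) (\<lambda>x. \<Gamma> c x u v)" for u v unfolding \<Gamma>_def by (rule christoffel_smooth)
  next
    fix c d x u v assume c: "c \<in> A" "d \<in> A" and x: "x \<in> overlap c d"
    interpret c: bilagrangian_chart "snd c ` fst c" "a c" "b c" s by (rule bc[OF c(1)])
    interpret d: bilagrangian_chart "snd d ` fst d" "a d" "b d" s by (rule bc[OF c(2)])
    let ?\<tau> = "transition c d" and ?O = "overlap c d"
    note t = tr[OF c x]
    have O: "open ?O" using overlap_open[OF ch ch] c by blast
    have \<tau>: "smooth_on ?O ?\<tau>" using transition_smooth[OF smooth_manifold_compatible[OF M c]] .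
    \<comment> \<open>The second derivative of \<open>a c = a d \<circ> \<tau>\<close> produces the inhomogeneous term of the transformation law.\<close>
    have E1: "D (\<lambda>y. D (a c) y v) x = D (\<lambda>y. D (a d) (?\<tau> y) (D ?\<tau> y v)) x"
      by (rule D_cong_open[OF O x]) (use tr[OF c] in auto)
    have E2: "D (\<lambda>y. D (a d) (?\<tau> y) (D ?\<tau> y v)) x u =
      D (\<lambda>y. D (a d) (?\<tau> y) (D ?\<tau> x v)) x u + D (a d) (?\<tau> x) (D (\<lambda>y. D ?\<tau> y v) x u)"
    proof (rule D_family_apply[OF O x])
      show "linear (D (a d) (?\<tau> y))" if "y \<in> ?O" for y using d.linear_Da[OF tr(3)[OF c that]] .
      show "smooth_on ?O (\<lambda>y. D (a d) (?\<tau> y) w)" for w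
        by (rule smooth_on_compose[OF O _ \<tau> smooth_on_D[OF d.a]]) (use tr(3)[OF c] in auto)
      show "smooth_on ?O (\<lambda>y. D ?\<tau> y v)" using smooth_on_D[OF \<tau>] .
    qed
    have E3: "D (\<lambda>y. D (a d) (?\<tau> y) (D ?\<tau> x v)) x u = D (\<lambda>y. D (a d) y (D ?\<tau> x v)) (?\<tau> x) (D ?\<tau> x u)"
      by (rule fun_cong[OF D_compose[OF smooth_on_differentiable[OF \<tau> x]
          smooth_on_differentiable[OF smooth_on_D[OF d.a] t(3)]]])
    have 2: "D (\<lambda>y. D (a c) y v) x u = D (\<lambda>y. D (a d) y (D ?\<tau> x v)) (?\<tau> x) (D ?\<tau> x u)
       + D (a d) (?\<tau> x) (D (\<lambda>y. D ?\<tau> y v) x u)"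
      unfolding E1 E2 E3 ..
    have "D (a d) (?\<tau> x) (D ?\<tau> x (\<Gamma> c x u v)) = D (a d) (?\<tau> x) (D (\<lambda>y. D ?\<tau> y v) x u +
          \<Gamma> d (?\<tau> x) (D ?\<tau> x u) (D ?\<tau> x v))"
      unfolding t(1)[symmetric] \<Gamma>_def c.D_christoffel[OF t(4)] linear_add[OF d.linear_Da[OF t(3)]] d.D_christoffel[OF t(3)] 2
      by simp
    then show "D ?\<tau> x (\<Gamma> c x u v) = D (\<lambda>y. D ?\<tau> y v) x u + \<Gamma> d (?\<tau> x) (D ?\<tau> x u) (D ?\<tau> x v)"
      unfolding d.D_eq_iff[OF t(3)] .
  qed
  have fc: "flat_coordinates (snd c ` fst c) (a c)" if "c \<in> A" for c
    using bilagrangian_chart.axioms(1)[OF bc[OF that]] .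
  have tors: "torsion_free A \<Gamma>"
    unfolding torsion_free_def \<Gamma>_def using flat_coordinates.torsion_zero[OF fc] by blast
  have flat: "flat_connection A \<Gamma>"
    unfolding flat_connection_def \<Gamma>_def using flat_coordinates.curvature_zero[OF fc] by blast
  have closed: "cov_closed A \<Gamma> I"
    unfolding cov_closed_def \<Gamma>_def I_def using bilagrangian_chart.cov_ext_deriv_J[OF bc] by blast
  have par: "parallel_bilinear A \<Gamma> (kahler_form g I)"
    unfolding parallel_bilinear_def \<Gamma>_def
  proof (intro ballI allI impI)
    fix c Y1 Y2 Y3 x assume c: "c \<in> A" and v: "vector_field_in c Y1 \<and> vector_field_in c Y2 \<and> vector_field_in c Y3"
      and x: "x \<in> snd c ` fst c"
    interpret bilagrangian_chart "snd c ` fst c" "a c" "b c" s by (rule bc[OF c])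
    show "cov_deriv_bilinear (flat_christoffel (a c)) (kahler_form g I c) Y1 Y2 Y3 x = 0"
      by (rule cov_deriv_constant_form[OF x _ _ bil2 weq[OF c]]) (use v in auto)
  qed
  have closedw: "closed_2form A (kahler_form g I)"
  proof (rule closed_2form_of_parallel[OF _ _ tors par])
    fix c x assume c: "c \<in> A" "x \<in> snd c ` fst c"
    interpret bilagrangian_chart "snd c ` fst c" "a c" "b c" s by (rule bc[OF c(1)])
    show "bilinear (kahler_form g I c x)"
      unfolding bilinear_def weq[OF c, abs_def]
      using linear_Da[OF c(2)] by (simp add: linear_iff bilinear_ladd[OF bil2] bilinear_radd[OF bil2]
          bilinear_lmul[OF bil2] bilinear_rmul[OF bil2])
    show "kahler_form g I c x u v = - kahler_form g I c x v u" for u v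
      unfolding weq[OF c] s2_def using skew[of "D (a c) x u"] by simp
  qed
  have integrable: "integrable_complex_structure X A I"
    unfolding integrable_complex_structure_def
  proof (intro conjI ballI Ifield)
    show "linear_complex_structure (I c x)" if c: "c \<in> A" "x \<in> snd c ` fst c" for c x
    proof -
      interpret bilagrangian_chart "snd c ` fst c" "a c" "b c" s by (rule bc[OF c(1)])
      show ?thesis using linear_J[OF c(2)] J_J[OF c(2)] by (simp add: I_def linear_complex_structure_def)
    qed
    fix p assume "p \<in> topspace X"
    then obtain c where c: "c \<in> A" "p \<in> fst c" using M unfolding smooth_manifold_def by blast
    interpret c: bilagrangian_chart "snd c ` fst c" "a c" "b c" s by (rule bc[OF c(1)])
    let ?J = "I c (snd c p)"
    have x0: "snd c p \<in> snd c ` fst c" using c(2) by blast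
    obtain T V \<zeta> h where T: "open T" "T \<subseteq> snd c ` fst c" "snd c p \<in> T" and V: "open V" "homeomorphism T V \<zeta> h"
      "smooth_on T \<zeta>" "smooth_on V h" and hol: "\<And>x v. x \<in> T \<Longrightarrow> D \<zeta> x (I c x v) = ?J (D \<zeta> x v)"
      using c.holomorphic_coordinate[OF x0] unfolding I_def by metis
    note z = compatible_chart_reparametrize[OF M c(1) T(1,2) V]
    let ?z = "reparametrize c T \<zeta>"
    have "D (transition d ?z) x (I d x v) = ?J (D (transition d ?z) x v)"
      if d: "d \<in> A" and x: "x \<in> overlap d ?z" for d x v
    proof -
      have xc: "x \<in> overlap d c" "transition d c x \<in> T" using z(2)[OF d x] by auto
      have "D (transition d c) x (I d x v) = I c (transition d c x) (D (transition d c) x v)"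
        using Ifield d c(1) xc(1) unfolding is_endo_field_def by metis
      then show ?thesis using z(2)[OF d x] hol[OF xc(2)] by simp
    qed
    moreover have "linear_complex_structure ?J"
      using c.linear_J[OF x0] c.J_J[OF x0] by (simp add: I_def linear_complex_structure_def)
    moreover have "p \<in> fst ?z" using c(2) T(3) by (simp add: reparametrize_def)
    ultimately show "\<exists>z J. compatible_chart X A z \<and> p \<in> fst z \<and> linear_complex_structure J \<and>
        (\<forall>d\<in>A. \<forall>x\<in>overlap d z. \<forall>v. D (transition d z) x (I d x v) = J (D (transition d z) x v))"
      using z(1) by blast
  qed
  have pr: "pseudo_riemannian A g"
    unfolding pseudo_riemannian_def
  proof (intro conjI ballI allI gfield impI)
    fix c x u assume c: "c \<in> A" "x \<in> snd c ` fst c"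
    interpret bilagrangian_chart "snd c ` fst c" "a c" "b c" s by (rule bc[OF c(1)])
    show "g c x u v = g c x v u" for v
      unfolding geq[OF c] using L1[OF c(2), of u v] skew[of "D (b c) x u"] by simp
    assume "\<forall>v. g c x u v = 0"
    then have "s (D (a c) x u) (D (b c) x v) = 0" for v unfolding geq[OF c] by simp
    then have "s (D (a c) x u) w = 0" for w
      using surj_f_inv_f[OF bij_is_surj[OF bijb[OF c(2)]]] by metis
    then have "D (a c) x u = D (a c) x 0" using nondeg linear_0[OF linear_Da[OF c(2)]] by simp
    then show "u = 0" using D_eq_iff[OF c(2)] by blast
  qed
  have herm: "g c x (I c x u) (I c x v) = g c x u v" if c: "c \<in> A" "x \<in> snd c ` fst c" for c x u v
  proof -
    interpret bilagrangian_chart "snd c ` fst c" "a c" "b c" s by (rule bc[OF c(1)])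
    show ?thesis unfolding geq[OF c] I_def D_J[OF c(2)] Db_J[OF c(2)]
      using L1[OF c(2), of u v] by (simp add: bilinear_rneg[OF bil])
  qed
  have "special_pseudo_kahler X A g I \<Gamma>"
    unfolding special_pseudo_kahler_def pseudo_kahler_def
    using M integrable pr herm closedw conn flat tors par closed by blast
  then show ?thesis unfolding special_pseudo_kahler_metric_def g_def by blast
qed

section \<open>Bi-Lagrangian embeddings from special structures\<close>

text \<open>
  The system for \<open>(f, \<phi>, \<epsilon>)\<close> reads \<open>df(h) = \<epsilon>(h)\<close>, \<open>d\<phi>(h) = \<epsilon>(I h)\<close>, \<open>d\<epsilon>(h) = \<epsilon>(\<Gamma>(h, _))\<close>, with covectors represented
  by inner products. The three components of its integrability condition are the hypotheses \<open>sym\<close>,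
  \<open>closed\<close> and \<open>flat\<close>. The solutions whose covector at \<open>x0\<close> runs through the standard basis are the
  components of \<open>f\<close> and \<open>\<phi>\<close>.
\<close>

lemma special_potentials:
  fixes G :: "'n::euclidean_space \<Rightarrow> 'n \<Rightarrow> 'n \<Rightarrow> 'n" and I :: "'n \<Rightarrow> 'n \<Rightarrow> 'n"
  assumes S: "open S" "x0 \<in> S"
    and G: "\<And>x. x \<in> S \<Longrightarrow> bilinear (G x)" "\<And>u v. smooth_on S (\<lambda>x. G x u v)"
    and I: "\<And>x. x \<in> S \<Longrightarrow> linear (I x)" "\<And>v. smooth_on S (\<lambda>x. I x v)"
    and sym: "\<And>x u v. x \<in> S \<Longrightarrow> G x u v = G x v u"
    and flat: "\<And>x h k v. x \<in> S \<Longrightarrow>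
      D (\<lambda>y. G y k v) x h + G x h (G x k v) = D (\<lambda>y. G y h v) x k + G x k (G x h v)"
    and closed: "\<And>x h k. x \<in> S \<Longrightarrow>
      D (\<lambda>y. I y k) x h + G x h (I x k) = D (\<lambda>y. I y h) x k + G x k (I x h)"
  obtains r f \<phi> where "r > 0" "ball x0 r \<subseteq> S" "smooth_on (ball x0 r) f" "smooth_on (ball x0 r) \<phi>"
    "\<And>v. D f x0 v = v" "\<And>x h. x \<in> ball x0 r \<Longrightarrow> D \<phi> x h = D f x (I x h)"
    "\<And>x h v. x \<in> ball x0 r \<Longrightarrow> D (\<lambda>y. D f y v) x h = D f x (G x h v)"
proof -
  \<comment> \<open>\<open>T x h\<close> is the adjoint of \<open>G x h\<close>, so that covectors move by \<open>T\<close> when vectors move by \<open>G\<close>.\<close>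
  define T where "T x h e = (\<Sum>i\<in>Basis. (e \<bullet> G x h i) *\<^sub>R i)" for x h e :: 'n
  define A where "A x h w = (snd (snd w) \<bullet> h, snd (snd w) \<bullet> I x h, T x h (snd (snd w)))"
    for x h :: 'n and w :: "real \<times> real \<times> 'n"
  have linG: "linear (G x h)" "linear (\<lambda>h. G x h v)" if "x \<in> S" for x h v
    using G(1)[OF that] by (auto simp: bilinear_def)
  have T: "T x h e \<bullet> v = e \<bullet> G x h v" if "x \<in> S" for x h e v
  proof -
    have "e \<bullet> G x h v = e \<bullet> (\<Sum>i\<in>Basis. (v \<bullet> i) *\<^sub>R G x h i)"
      using linear_basis_sum[OF linG(1)[OF that]] by metis
    then show ?thesis by (simp add: T_def inner_sum_left inner_sum_right inner_commute mult.commute)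
  qed
  obtain r where r: "r > 0" "ball x0 r \<subseteq> S"
    and sol: "\<And>w0. \<exists>F. F x0 = w0 \<and> smooth_on (ball x0 r) F \<and>
        (\<forall>x\<in>ball x0 r. (F has_derivative (\<lambda>h. A x h (F x))) (at x))"
  proof (rule frobenius_linear[of S x0 A])
    show "linear (\<lambda>h. A x h w)" if "x \<in> S" for x w
      using linG(2)[OF that] I(1)[OF that]
      by (simp add: linear_iff A_def T_def inner_add_right scaleR_add_left sum.distrib scaleR_sum_right)
    show "linear (A x h)" if "x \<in> S" for x h
      by (simp add: linear_iff A_def T_def inner_add_left scaleR_add_left sum.distrib scaleR_sum_right)
    show "smooth_on S (\<lambda>x. A x h w)" for h w
      unfolding A_def T_def
      by (intro smooth_on_Pair S smooth_on_const smooth_on_inner I smooth_on_sum smooth_on_scaleR G)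
    fix x h k w assume x: "x \<in> S"
    define e where "e = snd (snd (w :: real \<times> real \<times> 'n))"
    have DA: "D (\<lambda>y. A y h w) x k = (0, e \<bullet> D (\<lambda>y. I y h) x k, \<Sum>i\<in>Basis. (e \<bullet> D (\<lambda>y. G y h i) x k) *\<^sub>R i)"
      for h k
    proof -
      have "((\<lambda>y. A y h w) has_derivative
        (\<lambda>k. (0, e \<bullet> D (\<lambda>y. I y h) x k, \<Sum>i\<in>Basis. (e \<bullet> D (\<lambda>y. G y h i) x k) *\<^sub>R i))) (at x)"
        unfolding A_def T_def e_def[symmetric]
        by (intro has_derivative_Pair has_derivative_const has_derivative_sum has_derivative_scaleR_left
          has_derivative_inner_right smooth_on_has_derivative[OF I(2) x] smooth_on_has_derivative[OF G(2) x])
      then show ?thesis by (simp add: D_eqI)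
    qed
    have TT: "T x h (T x k e) = (\<Sum>i\<in>Basis. (e \<bullet> G x k (G x h i)) *\<^sub>R i)" for h k
      by (subst T_def) (simp add: T[OF x])
    have "D (\<lambda>y. A y h w) x k + A x h (A x k w) = (e \<bullet> G x k h, e \<bullet> (D (\<lambda>y. I y h) x k + G x k (I x h)),
      \<Sum>i\<in>Basis. (e \<bullet> (D (\<lambda>y. G y h i) x k + G x k (G x h i))) *\<^sub>R i)" for h k
      unfolding DA by (simp add: A_def T[OF x] TT e_def[symmetric] inner_add_right scaleR_add_left sum.distrib)
    then show "D (\<lambda>y. A y h w) x k + A x h (A x k w) = D (\<lambda>y. A y k w) x h + A x k (A x h w)"
      using sym[OF x, of h k] closed[OF x, of h k] by (simp add: flat[OF x, of k _ h])
  qed (use S in auto)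
  obtain F where F0: "\<And>b. F b x0 = (0, 0, b)" and Fs: "\<And>b. smooth_on (ball x0 r) (F b)"
    and Fd: "\<And>b x. x \<in> ball x0 r \<Longrightarrow> (F b has_derivative (\<lambda>h. A x h (F b x))) (at x)"
  proof -
    have "\<forall>b. \<exists>F. F x0 = (0, 0, b) \<and> smooth_on (ball x0 r) F \<and>
        (\<forall>x\<in>ball x0 r. (F has_derivative (\<lambda>h. A x h (F x))) (at x))"
      using sol by blast
    from choice[OF this] show ?thesis using that by blast
  qed
  define e where "e b x = snd (snd (F b x))" for b x
  define f where "f x = (\<Sum>b\<in>Basis. fst (F b x) *\<^sub>R b)" for x
  define \<phi> where "\<phi> x = (\<Sum>b\<in>Basis. fst (snd (F b x)) *\<^sub>R b)" for x
  have fs: "smooth_on (ball x0 r) f" "smooth_on (ball x0 r) \<phi>"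
    unfolding f_def \<phi>_def
    by (intro smooth_on_sum open_ball smooth_on_scaleR smooth_on_const smooth_on_fst smooth_on_snd Fs)+
  have Df: "D f x h = (\<Sum>b\<in>Basis. (e b x \<bullet> h) *\<^sub>R b)" if x: "x \<in> ball x0 r" for x h
  proof -
    have "(f has_derivative (\<lambda>h. \<Sum>b\<in>Basis. fst (A x h (F b x)) *\<^sub>R b)) (at x)"
      unfolding f_def by (intro has_derivative_sum has_derivative_scaleR_left has_derivative_fst Fd x)
    then show ?thesis by (simp add: D_eqI A_def e_def)
  qed
  have D\<phi>: "D \<phi> x h = (\<Sum>b\<in>Basis. (e b x \<bullet> I x h) *\<^sub>R b)" if x: "x \<in> ball x0 r" for x h
  proof -
    have "(\<phi> has_derivative (\<lambda>h. \<Sum>b\<in>Basis. fst (snd (A x h (F b x))) *\<^sub>R b)) (at x)"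
      unfolding \<phi>_def by (intro has_derivative_sum has_derivative_scaleR_left has_derivative_fst has_derivative_snd Fd x)
    then show ?thesis by (simp add: D_eqI A_def e_def)
  qed
  have D2f: "D (\<lambda>y. D f y v) x h = D f x (G x h v)" if x: "x \<in> ball x0 r" for x h v
  proof -
    have "D (\<lambda>y. D f y v) x = D (\<lambda>y. \<Sum>b\<in>Basis. (e b y \<bullet> v) *\<^sub>R b) x"
      by (rule D_cong_open[OF open_ball x]) (rule Df)
    also have "\<dots> = (\<lambda>h. \<Sum>b\<in>Basis. (snd (snd (A x h (F b x))) \<bullet> v) *\<^sub>R b)"
      unfolding e_def
      by (intro D_eqI has_derivative_sum has_derivative_scaleR_left has_derivative_inner_left has_derivative_snd Fd x)
    finally show ?thesis using x r(2) by (auto simp: Df A_def T e_def subset_eq)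
  qed
  have "D f x0 v = v" for v
    using r(1) euclidean_representation[of v] by (simp add: Df e_def F0 inner_commute)
  then show ?thesis using that[OF r fs] Df D\<phi> D2f by simp
qed

text \<open>
  The fields \<open>inv (D a x) p\<close> with \<open>p\<close> fixed are parallel, so a parallel form has zero derivative, hence is
  constant, when evaluated on two of them.
\<close>

lemma (in flat_coordinates) parallel_form_constant:
  assumes S': "convex S" "x0 \<in> S" and x: "x \<in> S"
    and w: "\<And>x. x \<in> S \<Longrightarrow> bilinear (w x)" "\<And>u v. smooth_on S (\<lambda>x. w x u v)"
    and par: "\<And>x h u v. x \<in> S \<Longrightarrow>
      D (\<lambda>y. w y u v) x h = w x (flat_christoffel a x h u) v + w x u (flat_christoffel a x h v)"
  shows "(w x (inv (D a x) p) (inv (D a x) q) :: real) = w x0 (inv (D a x0) p) (inv (D a x0) q)"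
proof -
  define Y where "Y p y = inv (D a y) p" for p y
  have Ys: "smooth_on S (Y p)" for p unfolding Y_def by (rule smooth_inv[OF smooth_on_const])
  have DY: "D (Y p) x h = - flat_christoffel a x h (Y p x)" if x: "x \<in> S" for x p h
  proof -
    have "D (\<lambda>y. D a y (Y p y)) x = D (\<lambda>y. p) x"
      by (rule D_cong_open[OF S x]) (simp add: Y_def D_inv)
    then have "D (\<lambda>y. D a y (Y p y)) x h = 0" by (simp add: frechet_derivative_const)
    then have "D a x (D (Y p) x h + flat_christoffel a x h (Y p x)) = D a x 0"
      using D_push[OF x Ys, of p h] D_christoffel[OF x, of h "Y p x"]
      by (simp add: linear_add[OF linear_Da[OF x]] linear_0[OF linear_Da[OF x]] add.commute)
    then show ?thesis using D_eq_iff[OF x] by (simp add: eq_neg_iff_add_eq_0)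
  qed
  have linw: "linear (\<lambda>u. w x u v)" "linear (w x u)" if "x \<in> S" for x u v
    using w(1)[OF that] by (auto simp: bilinear_def)
  have smw: "smooth_on S (\<lambda>x. w x u (Y q x))" for u
    by (rule smooth_on_family_apply[OF S linw(2) w(2) Ys])
  have "((\<lambda>y. w y (Y p y) (Y q y)) has_derivative (\<lambda>h. 0)) (at x within S)" if x: "x \<in> S" for x
  proof -
    have "smooth_on S (\<lambda>y. w y (Y p y) (Y q y))"
      by (rule smooth_on_family_apply[OF S linw(1) smw Ys])
    from smooth_on_has_derivative[OF this x]
    have "((\<lambda>y. w y (Y p y) (Y q y)) has_derivative D (\<lambda>y. w y (Y p y) (Y q y)) x) (at x)" .
    moreover have "D (\<lambda>y. w y (Y p y) (Y q y)) x = (\<lambda>h. 0)"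
    proof
      fix h
      have "D (\<lambda>y. w y (Y p y) (Y q y)) x h = D (\<lambda>y. w y (Y p x) (Y q y)) x h + w x (D (Y p) x h) (Y q x)"
        by (rule D_family_apply[OF S x linw(1) smw Ys])
      moreover have "D (\<lambda>y. w y (Y p x) (Y q y)) x h = D (\<lambda>y. w y (Y p x) (Y q x)) x h + w x (Y p x) (D (Y q) x h)"
        by (rule D_family_apply[OF S x linw(2) w(2) Ys])
      ultimately show "D (\<lambda>y. w y (Y p y) (Y q y)) x h = 0"
        by (simp add: par[OF x] DY[OF x] bilinear_lneg[OF w(1)[OF x]] bilinear_rneg[OF w(1)[OF x]])
    qed
    ultimately show ?thesis by (simp add: has_derivative_at_withinI)
  qed
  then obtain k where "\<And>x. x \<in> S \<Longrightarrow> w x (Y p x) (Y q x) = k"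
    using has_derivative_zero_constant[OF S'(1), of "\<lambda>y. w y (Y p y) (Y q y)"] by blast
  then show ?thesis using x S'(2) by (simp add: Y_def)
qed

text \<open>
  The inverse function theorem chooses its own neighbourhoods. This lemma shrinks those for \<open>f\<close> and \<open>\<phi>\<close> to a
  common ball, which is convex as the preceding lemma asks.
\<close>

lemma homeomorphism_smooth_restrict:
  fixes f :: "'a::euclidean_space \<Rightarrow> 'a"
  assumes hom: "homeomorphism T V f h" and V: "open V" and h: "smooth_on V h" and B: "B \<subseteq> T" "open B"
  shows "open (f ` B)" "homeomorphism B (f ` B) f h" "smooth_on (f ` B) h"
proof -
  have fB: "f ` B \<subseteq> V" using hom B by (auto simp: homeomorphism_def)
  have "f ` B = {y \<in> V. h y \<in> B}"
    using hom B unfolding homeomorphism_def by force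
  moreover have "open {y \<in> V. h y \<in> B}"
    using continuous_open_preimage[OF smooth_on_continuous[OF h] V B(2)] by (simp add: vimage_def Int_def)
  ultimately show "open (f ` B)" by simp
  show "homeomorphism B (f ` B) f h" by (rule homeomorphism_of_subsets[OF hom B(1) fB refl])
  show "smooth_on (f ` B) h" using smooth_on_subset[OF h fB] .
qed

text \<open>
  If the coordinates of a chart can be recovered continuously from \<open>F\<close>, then \<open>\<pi>\<close> followed by the inverse
  of the chart is a continuous left inverse of \<open>F\<close>.
\<close>

lemma embedding_map_of_chart:
  assumes z: "is_chart X z" and F: "continuous_map (subtopology X (fst z)) euclidean F"
    and \<pi>: "continuous_on UNIV \<pi>" "\<And>q. \<pi> (F q) = snd z q"
  shows "embedding_map (subtopology X (fst z)) euclidean F"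
proof -
  let ?X = "subtopology X (fst z)"
  have top: "topspace ?X = fst z" using chart_subset[OF z] by auto
  obtain k where k: "homeomorphic_maps ?X (top_of_set (snd z ` fst z)) (snd z) k"
    using z unfolding is_chart_def homeomorphic_map_maps by blast
  have "homeomorphic_maps ?X (top_of_set (F ` fst z)) F (k \<circ> \<pi>)"
    unfolding homeomorphic_maps_def
  proof (intro conjI ballI)
    show "continuous_map ?X (top_of_set (F ` fst z)) F"
      using F top by (simp add: continuous_map_in_subtopology image_subset_iff_funcset[symmetric])
    have "continuous_map (top_of_set (F ` fst z)) (top_of_set (snd z ` fst z)) \<pi>"
      using \<pi> continuous_on_subset[OF \<pi>(1)] by (auto simp: continuous_map_in_subtopology)
    then show "continuous_map (top_of_set (F ` fst z)) ?X (k \<circ> \<pi>)"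
      using k continuous_map_compose unfolding homeomorphic_maps_def by blast
    have inv: "(k \<circ> \<pi>) (F q) = q" if "q \<in> fst z" for q
      using that k \<pi>(2) top unfolding homeomorphic_maps_def by auto
    then show "(k \<circ> \<pi>) (F q) = q" if "q \<in> topspace ?X" for q using that top by simp
    show "F ((k \<circ> \<pi>) y) = y" if "y \<in> topspace (top_of_set (F ` fst z))" for y
      using that inv by auto
  qed
  then show ?thesis unfolding embedding_map_def top homeomorphic_map_maps by blast
qed


text \<open>
  With \<open>s = 2 \<omega>\<close> in flat coordinates, \<open>s(Df u, Df v) = 2 \<omega>(u, v)\<close> and \<open>D\<phi> = Df \<circ> I\<close>. So \<open>Omega2\<close> restricts to
  \<open>2 \<omega>(u, v) - 2 \<omega>(I u, I v)\<close> and \<open>Omega1\<close> to \<open>2 \<omega>(u, I v) + 2 \<omega>(I u, v)\<close>, both zero because \<open>g\<close> and hence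
  \<open>\<omega>\<close> is invariant under \<open>I\<close>, and the induced metric is \<open>\<omega>(u, I v) = g(u, v)\<close>.
\<close>

lemma special_pseudo_kahler_imp_bilagrangian:
  fixes X :: "'a topology" and A :: "('a, 'n::euclidean_space) chart set"
  assumes spk: "special_pseudo_kahler X A g I \<Gamma>" and p: "p \<in> topspace X"
  obtains U and s :: "'n \<Rightarrow> 'n \<Rightarrow> real" and F where
    "openin X U" "p \<in> U" "symplectic_form s" "smooth_embedding_on X A U F"
    "bilagrangian_transversal_on s X A U F"
    "\<And>c x u v. c \<in> A \<Longrightarrow> x \<in> snd c ` (fst c \<inter> U) \<Longrightarrow> g c x u v = pullback F (product_metric s) c x u v"
proof -
  have M: "smooth_manifold X A" and intg: "integrable_complex_structure X A I" and pr: "pseudo_riemannian A g"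
    and herm: "\<And>c x u v. c \<in> A \<Longrightarrow> x \<in> snd c ` fst c \<Longrightarrow> g c x (I c x u) (I c x v) = g c x u v"
    and conn: "is_connection A \<Gamma>" and flatA: "flat_connection A \<Gamma>" and torsA: "torsion_free A \<Gamma>"
    and parA: "parallel_bilinear A \<Gamma> (kahler_form g I)" and closedA: "cov_closed A \<Gamma> I"
    using spk unfolding special_pseudo_kahler_def pseudo_kahler_def by auto
  obtain c where c: "c \<in> A" "p \<in> fst c" using M p unfolding smooth_manifold_def by blast
  have ch: "is_chart X d" if "d \<in> A" for d using smooth_manifold_chart[OF M that] .
  define S where "S = snd c ` fst c"
  define x0 where "x0 = snd c p"
  define G where "G = \<Gamma> c"
  define J where "J = I c"
  define w where "w = kahler_form g I c"
  have S: "open S" "x0 \<in> S" using chart_open_range[OF ch[OF c(1)]] c(2) by (auto simp: S_def x0_def)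
  have G: "\<And>x. x \<in> S \<Longrightarrow> bilinear (G x)" "\<And>u v. smooth_on S (\<lambda>x. G x u v)"
    using conn c(1) unfolding is_connection_def S_def G_def by blast+
  have J: "\<And>x. x \<in> S \<Longrightarrow> linear (J x)" "\<And>v. smooth_on S (\<lambda>x. J x v)"
    and JJ: "\<And>x v. x \<in> S \<Longrightarrow> J x (J x v) = - v"
    using intg c(1) unfolding integrable_complex_structure_def is_endo_field_def linear_complex_structure_def S_def J_def
    by blast+
  have g: "\<And>x. x \<in> S \<Longrightarrow> bilinear (g c x)" "\<And>u v. smooth_on S (\<lambda>x. g c x u v)"
    and gsym: "\<And>x u v. x \<in> S \<Longrightarrow> g c x u v = g c x v u"
    and gnd: "\<And>x u. x \<in> S \<Longrightarrow> (\<And>v. g c x u v = 0) \<Longrightarrow> u = 0"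
    and gtr: "\<And>d x u v. d \<in> A \<Longrightarrow> x \<in> overlap d c \<Longrightarrow>
        g c (transition d c x) (D (transition d c) x u) (D (transition d c) x v) = g d x u v"
    using pr c(1) unfolding pseudo_riemannian_def is_bilinear_field_def S_def by blast+
  have gJ: "g c x (J x u) (J x v) = g c x u v" if "x \<in> S" for x u v
    using herm c(1) that unfolding S_def J_def by blast
  have w_eq: "w x u v = g c x (J x u) v" for x u v by (simp add: w_def kahler_form_def J_def)
  have wJ: "w x u (J x v) = g c x u v" if "x \<in> S" for x u v using gJ[OF that] by (simp add: w_eq)
  have w_skew: "w x u v = - w x v u" if x: "x \<in> S" for x u v
  proof -
    have "w x u v = - g c x (J x u) (J x (J x v))" by (simp add: w_eq JJ[OF x] bilinear_rneg[OF g(1)[OF x]])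
    also have "\<dots> = - w x v u" unfolding gJ[OF x] by (simp add: w_eq gsym[OF x])
    finally show ?thesis .
  qed
  have w_bil: "bilinear (w x)" if x: "x \<in> S" for x
    using g(1)[OF x] J(1)[OF x] unfolding bilinear_def linear_iff by (simp add: w_eq)
  have w_smooth: "smooth_on S (\<lambda>x. w x u v)" for u v
    unfolding w_eq
    by (rule smooth_on_family_apply[of S "\<lambda>x a. g c x a v" "\<lambda>x. J x u", OF S(1) _ g(2) J(2)])
      (use g(1) in \<open>simp add: bilinear_def\<close>)
  \<comment> \<open>Coordinate-constant fields commute, which reduces the invariant conditions to equations on components.\<close>
  have [simp]: "lie_bracket (\<lambda>_. u) (\<lambda>_. v) = (\<lambda>_. 0::'n)" for u v :: 'n
    by (rule ext) (simp add: lie_bracket_def frechet_derivative_const)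
  have cd: "cov_deriv G (\<lambda>_. u) Y = (\<lambda>x. D Y x u + G x u (Y x))" for u Y
    by (rule ext) (simp add: cov_deriv_def)
  have G0: "G x 0 v = 0" if "x \<in> S" for x v using bilinear_lzero[OF G(1)[OF that]] .
  have sym: "G x u v = G x v u" if x: "x \<in> S" for x u v
  proof -
    have "torsion G (\<lambda>_. u) (\<lambda>_. v) x = 0"
      using torsA c(1) x smooth_on_const unfolding torsion_free_def G_def S_def by blast
    then show ?thesis by (simp add: torsion_def cd frechet_derivative_const)
  qed
  have D0: "D f x (0::'n) = 0" if "smooth_on S f" "x \<in> S" for f :: "'n \<Rightarrow> 'n" and x
    using linear_0[OF smooth_on_D_linear[OF that]] .
  have flat: "D (\<lambda>y. G y k v) x h + G x h (G x k v) = D (\<lambda>y. G y h v) x k + G x k (G x h v)"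
    if x: "x \<in> S" for x h k v
  proof -
    have "curvature G (\<lambda>_. h) (\<lambda>_. k) (\<lambda>_. v) x = 0"
      using flatA c(1) x smooth_on_const unfolding flat_connection_def G_def S_def by blast
    then show ?thesis by (simp add: curvature_def cd frechet_derivative_const G0[OF x])
  qed
  have closed: "D (\<lambda>y. J y k) x h + G x h (J x k) = D (\<lambda>y. J y h) x k + G x k (J x h)"
    if x: "x \<in> S" for x h k
  proof -
    have "cov_ext_deriv G J (\<lambda>_. h) (\<lambda>_. k) x = 0"
      using closedA c(1) x smooth_on_const unfolding cov_closed_def G_def S_def J_def by blast
    then show ?thesis by (simp add: cov_ext_deriv_def cd linear_0[OF J(1)[OF x]])
  qed
  have par: "D (\<lambda>y. w y u v) x h = w x (G x h u) v + w x u (G x h v)" if x: "x \<in> S" for x h u v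
  proof -
    have "cov_deriv_bilinear G w (\<lambda>_. h) (\<lambda>_. u) (\<lambda>_. v) x = 0"
      using parA c(1) x smooth_on_const unfolding parallel_bilinear_def G_def S_def w_def by blast
    then show ?thesis by (simp add: cov_deriv_bilinear_def cd frechet_derivative_const)
  qed
  obtain r f \<phi> where r: "r > 0" "ball x0 r \<subseteq> S" and fs: "smooth_on (ball x0 r) f" "smooth_on (ball x0 r) \<phi>"
    and f0: "\<And>v. D f x0 v = v" and D\<phi>: "\<And>x h. x \<in> ball x0 r \<Longrightarrow> D \<phi> x h = D f x (J x h)"
    and D2f: "\<And>x h v. x \<in> ball x0 r \<Longrightarrow> D (\<lambda>y. D f y v) x h = D f x (G x h v)"
    by (rule special_potentials[OF S G J sym flat closed]) (assumption | rule that)+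
  have x0: "x0 \<in> ball x0 r" using r by simp
  have "inj (D f x0)" by (rule injI) (simp add: f0)
  from smooth_inverse_function[OF open_ball fs(1) x0 this]
  obtain T1 V1 h1 where T1: "open T1" "T1 \<subseteq> ball x0 r" "x0 \<in> T1" "open V1" "homeomorphism T1 V1 f h1" "smooth_on V1 h1"
    and bij1: "\<And>x. x \<in> T1 \<Longrightarrow> bij (D f x)" by metis
  have "inj (D \<phi> x0)"
  proof (rule injI)
    fix u v assume "D \<phi> x0 u = D \<phi> x0 v"
    then have "J x0 (J x0 u) = J x0 (J x0 v)" by (simp add: D\<phi>[OF x0] f0)
    then show "u = v" by (simp add: JJ[OF S(2)])
  qed
  from smooth_inverse_function[OF open_ball fs(2) x0 this]
  obtain T2 V2 h2 where T2: "open T2" "T2 \<subseteq> ball x0 r" "x0 \<in> T2" "open V2" "homeomorphism T2 V2 \<phi> h2" "smooth_on V2 h2"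
    by metis
  have "open (T1 \<inter> T2)" "x0 \<in> T1 \<inter> T2" using T1 T2 by auto
  then obtain \<rho> where \<rho>: "\<rho> > 0" "ball x0 \<rho> \<subseteq> T1 \<inter> T2" using open_contains_ball by blast
  define T where "T = ball x0 \<rho>"
  have T: "open T" "convex T" "x0 \<in> T" "T \<subseteq> T1" "T \<subseteq> T2" "T \<subseteq> ball x0 r" "T \<subseteq> S"
    using \<rho> T1 r by (auto simp: T_def)
  have Tc: "T \<subseteq> snd c ` fst c" using T(7) by (simp add: S_def)
  have fT: "smooth_on T f" "smooth_on T \<phi>" using smooth_on_subset T(6) fs by blast+
  interpret F: flat_coordinates T f by standard (use T bij1 fT in auto)
  have Gf: "flat_christoffel f x u v = G x u v" if x: "x \<in> T" for x u v
    using F.D_christoffel[OF x, of u v] D2f[of x v u] x T(6) F.D_eq_iff[OF x] by auto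
  have w_const: "w x u v = w x0 (D f x u) (D f x v)" if x: "x \<in> T" for x u v
  proof -
    have 0: "inv (D f x0) q = q" for q using F.D_inv[OF T(3), of q] by (simp add: f0)
    have 1: "inv (D f x) (D f x q) = q" for q using F.D_inv[OF x, of "D f x q"] F.D_eq_iff[OF x] by blast
    have "w x (inv (D f x) (D f x u)) (inv (D f x) (D f x v))
        = w x0 (inv (D f x0) (D f x u)) (inv (D f x0) (D f x v))"
    proof (rule F.parallel_form_constant[OF T(2,3) x])
      show "bilinear (w y)" if "y \<in> T" for y using w_bil that T(7) by blast
      show "smooth_on T (\<lambda>x. w x u v)" for u v using smooth_on_subset[OF w_smooth T(7)] .
      show "D (\<lambda>y. w y u v) y h = w y (flat_christoffel f y h u) v + w y u (flat_christoffel f y h v)"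
        if "y \<in> T" for y h u v
        using par[of y u v h] that T(7) by (auto simp: Gf[OF that])
    qed
    then show ?thesis by (simp add: 0 1)
  qed
  define s where "s u v = 2 * w x0 u v" for u v
  have s_eq: "s (D f x u) (D f x v) = 2 * w x u v" if "x \<in> T" for x u v
    unfolding s_def w_const[OF that] ..
  have symp: "symplectic_form s"
    unfolding symplectic_form_def
  proof (intro conjI allI impI)
    show "bilinear s" using w_bil[OF S(2)] unfolding bilinear_def linear_iff s_def by (simp add: algebra_simps)
    show "s u v = - s v u" for u v using w_skew[OF S(2), of u v] by (simp add: s_def)
    fix u assume "\<forall>v. s u v = 0"
    then have "g c x0 u v = 0" for v using wJ[OF S(2), of u v] by (simp add: s_def)
    then show "u = 0" by (rule gnd[OF S(2)])
  qed
  \<comment> \<open>\<open>f\<close> and \<open>\<phi>\<close> are both charts on \<open>U\<close>, which gives transversality to the two projections.\<close>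
  note h1 = homeomorphism_smooth_restrict[OF T1(5,4,6) T(4,1)]
  note h2 = homeomorphism_smooth_restrict[OF T2(5,4,6) T(5,1)]
  define z1 where "z1 = reparametrize c T f"
  define z2 where "z2 = reparametrize c T \<phi>"
  note z1 = compatible_chart_reparametrize[OF M c(1) T(1) Tc h1(1,2) fT(1) h1(3), folded z1_def]
  note z2 = compatible_chart_reparametrize[OF M c(1) T(1) Tc h2(1,2) fT(2) h2(3), folded z2_def]
  define U where "U = {q \<in> fst c. snd c q \<in> T}"
  define F where "F q = (f (snd c q), \<phi> (snd c q))" for q
  have zU: "fst z1 = U" "fst z2 = U" by (simp_all add: z1_def z2_def reparametrize_def U_def)
  have zF: "fst \<circ> F = snd z1" "snd \<circ> F = snd z2" by (auto simp: z1_def z2_def reparametrize_def F_def)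
  have Uo: "openin X U" unfolding U_def using chart_open_vimage[OF ch[OF c(1)] T(1)] .
  have pU: "p \<in> U" using c(2) T(3) by (simp add: U_def x0_def)
  have repF: "local_rep d F = (\<lambda>x. (transition d z1 x, transition d z2 x))" for d :: "('a, 'n) chart"
    unfolding local_rep_def zF[symmetric] by auto
  have sm: "smooth_on (snd d ` (fst d \<inter> U)) (transition d z1)" "smooth_on (snd d ` (fst d \<inter> U)) (transition d z2)"
    if "d \<in> A" for d
    using z1(1) z2(1) that unfolding compatible_chart_def smoothly_compatible_def zU by blast+
  have tau: "x \<in> overlap d c" "transition d c x \<in> T" and
    DF: "D (local_rep d F) x v = (D f (transition d c x) (D (transition d c) x v),
           D f (transition d c x) (J (transition d c x) (D (transition d c) x v)))"
    if d: "d \<in> A" and x: "x \<in> snd d ` (fst d \<inter> U)" for d x v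
  proof -
    have x': "x \<in> overlap d z1" "x \<in> overlap d z2" using x by (simp_all add: zU)
    show t: "x \<in> overlap d c" "transition d c x \<in> T" using z1(2)[OF d x'(1)] by auto
    have "D (local_rep d F) x v = (D (transition d z1) x v, D (transition d z2) x v)"
      unfolding repF using D_eqI[OF has_derivative_Pair[OF
        smooth_on_has_derivative[OF sm(1)[OF d] x] smooth_on_has_derivative[OF sm(2)[OF d] x]]] by simp
    then show "D (local_rep d F) x v = (D f (transition d c x) (D (transition d c) x v),
           D f (transition d c x) (J (transition d c x) (D (transition d c) x v)))"
      using z1(2)[OF d x'(1)] z2(2)[OF d x'(2)] D\<phi>[of "transition d c x"] t(2) T(6) by auto
  qed
  have lag: "lagrangian_on A U F (Omega1 s)" "lagrangian_on A U F (Omega2 s)"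
  proof -
    have "Omega1 s (D (local_rep d F) x u) (D (local_rep d F) x v) = 0"
      "Omega2 s (D (local_rep d F) x u) (D (local_rep d F) x v) = 0"
      if d: "d \<in> A" and x: "x \<in> snd d ` (fst d \<inter> U)" for d x u v
    proof -
      note t = tau[OF d x]
      have tS: "transition d c x \<in> S" using t(2) T(7) by blast
      show "Omega1 s (D (local_rep d F) x u) (D (local_rep d F) x v) = 0"
        unfolding DF[OF d x] Omega1_def
        by (simp add: s_eq[OF t(2)] wJ[OF tS]) (simp add: w_eq JJ[OF tS] bilinear_lneg[OF g(1)[OF tS]])
      show "Omega2 s (D (local_rep d F) x u) (D (local_rep d F) x v) = 0"
        unfolding DF[OF d x] Omega2_def
        by (simp add: s_eq[OF t(2)] wJ[OF tS]) (simp add: w_eq)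
    qed
    then show "lagrangian_on A U F (Omega1 s)" "lagrangian_on A U F (Omega2 s)"
      unfolding lagrangian_on_def pullback_def by simp_all
  qed
  have metric: "g d x u v = pullback F (product_metric s) d x u v"
    if d: "d \<in> A" and x: "x \<in> snd d ` (fst d \<inter> U)" for d x u v
  proof -
    note t = tau[OF d x]
    have tS: "transition d c x \<in> S" using t(2) T(7) by blast
    have bs: "bilinear s" using symp by (simp add: symplectic_form_def)
    show ?thesis
      unfolding pullback_def DF[OF d x] product_metric_def polarization_def gtr[OF d t(1), symmetric]
      by (simp add: bilinear_ladd[OF bs] bilinear_radd[OF bs] s_eq[OF t(2)] wJ[OF tS])
        (simp add: gsym[OF tS, of "D (transition d c) x v" "D (transition d c) x u"] field_simps)
  qed
  have ld: "local_diffeo_on X A U (fst \<circ> F)" "local_diffeo_on X A U (snd \<circ> F)"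
    using compatible_chart_local_diffeo[OF M z1(1)] compatible_chart_local_diffeo[OF M z2(1)]
    unfolding zU zF .
  have imm: "immersion_on A U F"
    unfolding immersion_on_def smooth_map_on_def
  proof (intro conjI ballI)
    fix d assume d: "d \<in> A"
    have o: "open (snd d ` (fst d \<inter> U))" using chart_open_image[OF ch[OF d] Uo] .
    show "smooth_on (snd d ` (fst d \<inter> U)) (local_rep d F)"
      unfolding repF by (intro smooth_on_Pair o sm d)
    fix x assume x: "x \<in> snd d ` (fst d \<inter> U)"
    note t = tau[OF d x]
    have "inj (D (transition d c) x)"
      using D_transition_bij[OF ch[OF d] ch[OF c(1)] smooth_manifold_compatible[OF M d c(1)] t(1)] bij_is_inj by blast
    then show "inj (D (local_rep d F) x)"
      unfolding inj_def DF[OF d x] by (simp add: F.D_eq_iff[OF t(2)])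
  qed
  have z1ch: "is_chart X z1" using z1(1) by (simp add: compatible_chart_def)
  have contF: "continuous_map (subtopology X U) euclidean F"
  proof -
    have "continuous_map (subtopology X (fst c)) euclidean (snd c)"
      using homeomorphic_imp_continuous_map[of "subtopology X (fst c)" "top_of_set (snd c ` fst c)" "snd c"] ch[OF c(1)]
      by (simp add: is_chart_def continuous_map_in_subtopology)
    then have "continuous_map (subtopology X U) euclidean (snd c)"
      by (rule continuous_map_from_subtopology_mono) (auto simp: U_def)
    then have "continuous_map (subtopology X U) (top_of_set T) (snd c)"
      by (auto simp: continuous_map_in_subtopology U_def)
    moreover have "continuous_map (top_of_set T) euclidean (\<lambda>x. (f x, \<phi> x))"
      using fT smooth_on_continuous by (auto intro!: continuous_on_Pair)
    ultimately have "continuous_map (subtopology X U) euclidean ((\<lambda>x. (f x, \<phi> x)) \<circ> snd c)"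
      by (rule continuous_map_compose)
    then show ?thesis by (simp add: F_def[abs_def] o_def)
  qed
  have "embedding_map (subtopology X U) euclidean F"
    using embedding_map_of_chart[OF z1ch, of F fst] contF zF(1)
    unfolding zU by (auto simp: fun_eq_iff continuous_on_fst continuous_on_id)
  then have "smooth_embedding_on X A U F" unfolding smooth_embedding_on_def using imm by blast
  moreover have "bilagrangian_transversal_on s X A U F"
    unfolding bilagrangian_transversal_on_def using lag ld by blast
  ultimately show ?thesis using that[OF Uo pU symp _ _ metric] by blast
qed

theorem theorem2:
  shows "(\<forall>(s :: 'v::euclidean_space \<Rightarrow> 'v \<Rightarrow> real) (M :: ('v \<times> 'v) set)
            (A :: ('v \<times> 'v, 'm::euclidean_space) chart set).
            symplectic_form s \<and> embedded_submanifold M A \<and>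
            bilagrangian_transversal_on s (top_of_set M) A M (\<lambda>w. w) \<longrightarrow>
            special_pseudo_kahler_metric (top_of_set M) A (pullback (\<lambda>w. w) (product_metric s)))
       \<and> (\<forall>(X :: 'a topology) (A :: ('a, 'n::euclidean_space) chart set) g.
            special_pseudo_kahler_metric X A g \<longrightarrow>
            (\<forall>p\<in>topspace X. \<exists>U (s :: 'n \<Rightarrow> 'n \<Rightarrow> real) f.
               openin X U \<and> p \<in> U \<and> symplectic_form s \<and>
               smooth_embedding_on X A U f \<and> bilagrangian_transversal_on s X A U f \<and>
               (\<forall>c\<in>A. \<forall>x\<in>snd c ` (fst c \<inter> U). \<forall>u v.
                  g c x u v = pullback f (product_metric s) c x u v)))"
proof (rule conjI; intro allI impI ballI)
  fix s :: "'v \<Rightarrow> 'v \<Rightarrow> real" and M :: "('v \<times> 'v) set" and A :: "('v \<times> 'v, 'm) chart set"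
  assume "symplectic_form s \<and> embedded_submanifold M A \<and>
            bilagrangian_transversal_on s (top_of_set M) A M (\<lambda>w. w)"
  then show "special_pseudo_kahler_metric (top_of_set M) A (pullback (\<lambda>w. w) (product_metric s))"
    by (intro bilagrangian_imp_special_pseudo_kahler) (auto simp: embedded_submanifold_def)
next
  fix X :: "'a topology" and A :: "('a, 'n) chart set" and g p
  assume "special_pseudo_kahler_metric X A g" and p: "p \<in> topspace X"
  then obtain I \<Gamma> where "special_pseudo_kahler X A g I \<Gamma>" unfolding special_pseudo_kahler_metric_def by blast
  from special_pseudo_kahler_imp_bilagrangian[OF this p]
  show "\<exists>U (s :: 'n \<Rightarrow> 'n \<Rightarrow> real) f.
               openin X U \<and> p \<in> U \<and> symplectic_form s \<and>
               smooth_embedding_on X A U f \<and> bilagrangian_transversal_on s X A U f \<and>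
               (\<forall>c\<in>A. \<forall>x\<in>snd c ` (fst c \<inter> U). \<forall>u v.
                  g c x u v = pullback f (product_metric s) c x u v)"
    by metis
qed

end
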